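(* Let $\nabla$ be the generalised Levi-Civita connection on $\Omega^1(\mathbb{C}_q[S^2])$ induced by the $q$-monopole. Its Riemann tensor is $$\mathrm{Riemann}|_{\Omega^{0,1}}=[2]_q\Upsilon\bar\otimes\mathrm{id},\qquad \mathrm{Riemann}|_{\Omega^{1,0}}=-q^4[2]_q\Upsilon\bar\otimes\mathrm{id}.$$ The lift $i:\Omega^2(\mathbb{C}_q[S^2])\to\Omega^1(\mathbb{C}_q[S^2])\bar\otimes\Omega^1(\mathbb{C}_q[S^2])$ (a left-module map splitting the wedge product, $\wedge\circ i=\mathrm{id}$) given by $$i(\Upsilon)=\frac{q^{-1}}{[2]_q}\left(-(\mathrm{id}\bar\otimes * )g+\frac{1-q^{-4}}{1+q^{-4}}\,g\right)$$ and the trace in the middle position give the Ricci tensor $$\mathrm{Ricci}=\frac{2q^{-1}}{1+q^{-4}}\,g,$$ making the $q$-sphere an `Einstein space' (Ricci proportional to the metric).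
   Context: $q\in\mathbb{C}$ is invertible (with $[2]_q\neq0$ and $1+q^{-4}\neq0$ where these occur in denominators), $[2]_q=q+q^{-1}$; $\bar\otimes$ is the tensor product over $\mathbb{C}_q[S^2]$. $\mathbb{C}_q[SL_2]$ is the Hopf algebra generated by $a,b,c,d$ with $ba=qab$, $ca=qac$, $db=qbd$, $dc=qcd$, $bc=cb$, $ad=1+q^{-1}bc$, $da=1+qbc$. It is $\mathbb{Z}$-graded by $\deg a=\deg c=1$, $\deg b=\deg d=-1$; $\mathbb{C}_q[SL_2]_n$ is the degree $n$ component. $\mathbb{C}_q[S^2]=\mathbb{C}_q[SL_2]_0$ is generated by $b_0=bc$, $b_+=cd$, $b_-=ab$. $\Omega^1(\mathbb{C}_q[SL_2])$ is the bimodule calculus that is free as a left module on $e^+,e^-,e^0$, with $e^\pm x=q^{\deg x}x\,e^\pm$ and $e^0x=q^{2\deg x}x\,e^0$ for homogeneous $x$, and $$\mathrm{d}a=ae^0+qbe^+,\quad \mathrm{d}b=ae^--q^{-2}be^0,\quad \mathrm{d}c=ce^0+qde^+,\quad \mathrm{d}d=ce^--q^{-2}de^0.$$ It extends to an exterior algebra with $(e^\pm)^2=(e^0)^2=0$, $q^2e^+\wedge e^-+e^-\wedge e^+=0$, $e^0\wedge e^\pm+q^{\pm4}e^\pm\wedge e^0=0$, $\mathrm{d}e^0=q^3e^+\wedge e^-$, $\mathrm{d}e^\pm=\mp q^{\pm2}(1+q^{-2})e^\pm\wedge e^0$. $\Omega(\mathbb{C}_q[S^2])$ is the differential subalgebra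 generated by $\mathbb{C}_q[S^2]$ and $\mathrm{d}\mathbb{C}_q[S^2]$. One has $\Omega^1(\mathbb{C}_q[S^2])=\Omega^{1,0}\oplus\Omega^{0,1}$ with $\Omega^{1,0}=\mathbb{C}_q[SL_2]_{-2}e^+$, $\Omega^{0,1}=\mathbb{C}_q[SL_2]_2e^-$; $\Omega^2(\mathbb{C}_q[S^2])=\mathbb{C}_q[S^2]\,\Upsilon$ with $\Upsilon=e^+\wedge e^-$ central over $\mathbb{C}_q[S^2]$. The Hodge operator on 1-forms is the bimodule map $*(fe^\pm)=\pm fe^\pm$. Metric: $g=q^2\,\mathrm{d}b_-\bar\otimes\mathrm{d}b_++\mathrm{d}b_+\bar\otimes\mathrm{d}b_--[2]_q\,\mathrm{d}b_0\bar\otimes\mathrm{d}b_0$. Connection: $\nabla(m\tau)=\mathrm{d}m\bar\otimes\tau+m\nabla\tau$ for $m\in\mathbb{C}_q[S^2]$, with $\nabla(\mathrm{d}b_\pm)=[2]_qb_\pm\,g$, $\nabla(\mathrm{d}b_0)=(1+[2]_qb_0)\,g$. More precisely, writing $\partial,\bar\partial$ for the components of $\mathrm{d}$ in $\Omega^{1,0},\Omega^{0,1}$ and $g=g_{+-}+g_{-+}$ with $g_{+-}\in\Omega^{1,0}\bar\otimes\Omega^{0,1}$, $g_{-+}\in\Omega^{0,1}\bar\otimes\Omega^{1,0}$: $\nabla(\partial b_\pm)=[2]_qb_\pm g_{-+}$, $\nabla(\partial b_0)=(1+[2]_qb_0)g_{-+}$, $\nabla(\bar\partial b_\pm)=[2]_qb_\pm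 g_{+-}$, $\nabla(\bar\partial b_0)=(1+[2]_qb_0)g_{+-}$. Curvature: $\mathrm{Riemann}=(\mathrm{id}\wedge\nabla-\mathrm{d}\bar\otimes\mathrm{id})\nabla:\Omega^1\to\Omega^2\bar\otimes\Omega^1$, where $(\mathrm{id}\wedge\nabla)(\tau\bar\otimes\eta)=\tau\wedge\nabla\eta$ and $(\mathrm{d}\bar\otimes\mathrm{id})(\tau\bar\otimes\eta)=\mathrm{d}\tau\bar\otimes\eta$ (the combination is well defined). Ricci: apply $i$ to the $\Omega^2$ factor to obtain $i(\mathrm{Riemann}):\Omega^1\to\Omega^1\bar\otimes\Omega^1\bar\otimes\Omega^1$ and take the trace between the second (middle) output factor and the input. Concretely, if $\mathrm{Riemann}(\tau)=\Upsilon\bar\otimes\rho(\tau)$ with $\rho:\Omega^1\to\Omega^1$ a bimodule map, then $\mathrm{Ricci}=(\mathrm{id}\bar\otimes\rho)\,i(\Upsilon)\in\Omega^1\bar\otimes\Omega^1$.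
   Formalization: The claim that i splits the wedge product (wedge∘i = id) fails for the displayed i(Υ) unless q²=1, since wedge(i(Υ)) = 2q²/(1+q²) Υ; the formal statement keeps the displayed i and Ricci and proves wedge∘i = (2q/[2]_q) id instead. *)

theory Defs
  imports Complex_Main "HOL-Library.Poly_Mapping" "HOL-Library.FuncSet"
    "HOL-Algebra.QuotRing" "HOL-Algebra.Free_Abelian_Groups" "HOL-Algebra.Algebraic_Closure_Type"
begin

section \<open>Bimodules and their tensor product over a noncommutative ring\<close>

text \<open>
  The library's module record supplies addition and the left action; a right action is added.
  As for library modules, the multiplicative ring fields carry no information.
\<close>

record ('s, 'm) bimodule = "('s, 'm) module" +
  rsmult :: "['m, 's] \<Rightarrow> 'm" (infixl \<open>\<odot>r\<index>\<close> 70)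

definition left_hom ::
  "('s, 'x) ring_scheme \<Rightarrow> ('s, 'm, 'y) module_scheme \<Rightarrow> ('s, 'n, 'z) module_scheme \<Rightarrow> ('m \<Rightarrow> 'n) set"
  where "left_hom R M N =
    {f \<in> carrier M \<rightarrow> carrier N.
       (\<forall>x\<in>carrier M. \<forall>y\<in>carrier M. f (x \<oplus>\<^bsub>M\<^esub> y) = f x \<oplus>\<^bsub>N\<^esub> f y) \<and>
       (\<forall>s\<in>carrier R. \<forall>x\<in>carrier M. f (s \<odot>\<^bsub>M\<^esub> x) = s \<odot>\<^bsub>N\<^esub> f x)}"

definition bimodule_hom ::
  "('s, 'x) ring_scheme \<Rightarrow> ('s, 'm, 'y) bimodule_scheme \<Rightarrow> ('s, 'n, 'z) bimodule_scheme \<Rightarrow> ('m \<Rightarrow> 'n) set"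
  where "bimodule_hom R M N =
    {f \<in> left_hom R M N. \<forall>s\<in>carrier R. \<forall>x\<in>carrier M. f (x \<odot>r\<^bsub>M\<^esub> s) = f x \<odot>r\<^bsub>N\<^esub> s}"

text \<open>
  The tensor product over R is the free abelian group on pairs modulo biadditivity and
  R-balancedness. Its elements are cosets.
\<close>

definition tensor_rels ::
  "('s, 'x) ring_scheme \<Rightarrow> ('s, 'm, 'y) bimodule_scheme \<Rightarrow> ('s, 'n, 'z) bimodule_scheme
    \<Rightarrow> (('m \<times> 'n) \<Rightarrow>\<^sub>0 int) set"
  where "tensor_rels R M N =
      {frag_of (x \<oplus>\<^bsub>M\<^esub> x', y) - frag_of (x, y) - frag_of (x', y) | x x' y.
         x \<in> carrier M \<and> x' \<in> carrier M \<and> y \<in> carrier N}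
    \<union> {frag_of (x, y \<oplus>\<^bsub>N\<^esub> y') - frag_of (x, y) - frag_of (x, y') | x y y'.
         x \<in> carrier M \<and> y \<in> carrier N \<and> y' \<in> carrier N}
    \<union> {frag_of (x \<odot>r\<^bsub>M\<^esub> s, y) - frag_of (x, s \<odot>\<^bsub>N\<^esub> y) | x s y.
         x \<in> carrier M \<and> s \<in> carrier R \<and> y \<in> carrier N}"

definition tensor_null ::
  "('s, 'x) ring_scheme \<Rightarrow> ('s, 'm, 'y) bimodule_scheme \<Rightarrow> ('s, 'n, 'z) bimodule_scheme
    \<Rightarrow> (('m \<times> 'n) \<Rightarrow>\<^sub>0 int) set"
  where "tensor_null R M N =
    generate (free_Abelian_group (carrier M \<times> carrier N)) (tensor_rels R M N)"

definition tensor_group ::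
  "('s, 'x) ring_scheme \<Rightarrow> ('s, 'm, 'y) bimodule_scheme \<Rightarrow> ('s, 'n, 'z) bimodule_scheme
    \<Rightarrow> (('m \<times> 'n) \<Rightarrow>\<^sub>0 int) set ring"
  where "tensor_group R M N =
    (let G = free_Abelian_group (carrier M \<times> carrier N) Mod tensor_null R M N
     in \<lparr>carrier = carrier G, monoid.mult = undefined, one = undefined,
         zero = \<one>\<^bsub>G\<^esub>, add = monoid.mult G\<rparr>)"

definition tens ::
  "('s, 'x) ring_scheme \<Rightarrow> ('s, 'm, 'y) bimodule_scheme \<Rightarrow> ('s, 'n, 'z) bimodule_scheme
    \<Rightarrow> 'm \<Rightarrow> 'n \<Rightarrow> (('m \<times> 'n) \<Rightarrow>\<^sub>0 int) set"
  where "tens R M N x y =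
    tensor_null R M N #>\<^bsub>free_Abelian_group (carrier M \<times> carrier N)\<^esub> frag_of (x, y)"

text \<open>
  The additive map out of a tensor product into G induced by a map of two arguments. It is
  meaningful when that map is biadditive and balanced, which makes the value independent of
  the representative.
\<close>

definition tensor_lift ::
  "('g, 'x) ring_scheme \<Rightarrow> ('m \<Rightarrow> 'n \<Rightarrow> 'g) \<Rightarrow> (('m \<times> 'n) \<Rightarrow>\<^sub>0 int) set \<Rightarrow> 'g"
  where "tensor_lift G \<phi> t =
    (THE v. \<forall>c\<in>t. v =
      (\<Oplus>\<^bsub>G\<^esub>p\<in>Poly_Mapping.keys c. [Poly_Mapping.lookup c p] \<cdot>\<^bsub>G\<^esub> \<phi> (fst p) (snd p)))"

definition tensor ::
  "('s, 'x) ring_scheme \<Rightarrow> ('s, 'm, 'y) bimodule_scheme \<Rightarrow> ('s, 'n, 'z) bimodule_scheme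
    \<Rightarrow> ('s, (('m \<times> 'n) \<Rightarrow>\<^sub>0 int) set) bimodule"
  where "tensor R M N =
    (let T = tensor_group R M N
     in \<lparr>carrier = carrier T, monoid.mult = undefined, one = undefined,
         zero = zero T, add = add T,
         module.smult = (\<lambda>s. tensor_lift T (\<lambda>x y. tens R M N (s \<odot>\<^bsub>M\<^esub> x) y)),
         rsmult = (\<lambda>t s. tensor_lift T (\<lambda>x y. tens R M N x (y \<odot>r\<^bsub>N\<^esub> s)) t)\<rparr>)"

section \<open>The algebra of functions on quantum SL2\<close>

datatype gen = GenA | GenB | GenC | GenD

text \<open>
  Words form the free monoid, written additively so that finitely supported functions on
  words with the convolution product of \<^theory>\<open>HOL-Library.Poly_Mapping\<close> are the free
  algebra.
\<close>

datatype word = Word (letters: "gen list")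

instantiation word :: monoid_add
begin

definition zero_word :: word where "zero_word = Word []"

definition plus_word :: "word \<Rightarrow> word \<Rightarrow> word" where
  "plus_word v w = Word (letters v @ letters w)"

instance
  by standard (simp_all add: zero_word_def plus_word_def)

end

type_synonym free_alg = "word \<Rightarrow>\<^sub>0 complex"

abbreviation gen_free :: "gen \<Rightarrow> free_alg" where
  "gen_free x \<equiv> Poly_Mapping.single (Word [x]) 1"

abbreviation scalar_free :: "complex \<Rightarrow> free_alg" where
  "scalar_free z \<equiv> Poly_Mapping.single 0 z"

definition sl2_rels :: "complex \<Rightarrow> free_alg set" where
  "sl2_rels q =
    (let a = gen_free GenA; b = gen_free GenB; c = gen_free GenC; d = gen_free GenD
     in {b * a - scalar_free q * a * b,
         c * a - scalar_free q * a * c,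
         d * b - scalar_free q * b * d,
         d * c - scalar_free q * c * d,
         b * c - c * b,
         a * d - 1 - scalar_free (inverse q) * b * c,
         d * a - 1 - scalar_free q * b * c})"

type_synonym sl2 = "free_alg set"

abbreviation sl2_ideal :: "complex \<Rightarrow> free_alg set" where
  "sl2_ideal q \<equiv> Idl\<^bsub>ring_of_type_algebra\<^esub> (sl2_rels q)"

definition SL2 :: "complex \<Rightarrow> sl2 ring" where
  "SL2 q = ring_of_type_algebra Quot sl2_ideal q"

definition cls :: "complex \<Rightarrow> free_alg \<Rightarrow> sl2" where
  "cls q f = sl2_ideal q +>\<^bsub>ring_of_type_algebra\<^esub> f"

definition gn :: "complex \<Rightarrow> gen \<Rightarrow> sl2" where
  "gn q x = cls q (gen_free x)"

definition sc :: "complex \<Rightarrow> complex \<Rightarrow> sl2" where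
  "sc q z = cls q (scalar_free z)"

fun gen_deg :: "gen \<Rightarrow> int" where
  "gen_deg GenA = 1"
| "gen_deg GenB = -1"
| "gen_deg GenC = 1"
| "gen_deg GenD = -1"

definition word_deg :: "word \<Rightarrow> int" where
  "word_deg w = sum_list (map gen_deg (letters w))"

definition SL2_deg :: "complex \<Rightarrow> int \<Rightarrow> sl2 set" where
  "SL2_deg q n = {cls q f | f. \<forall>w\<in>Poly_Mapping.keys f. word_deg w = n}"

definition S2 :: "complex \<Rightarrow> sl2 ring" where
  "S2 q = (SL2 q)\<lparr>carrier := SL2_deg q 0\<rparr>"

definition b_zero :: "complex \<Rightarrow> sl2" where
  "b_zero q = gn q GenB \<otimes>\<^bsub>SL2 q\<^esub> gn q GenC"

definition b_plus :: "complex \<Rightarrow> sl2" where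
  "b_plus q = gn q GenC \<otimes>\<^bsub>SL2 q\<^esub> gn q GenD"

definition b_minus :: "complex \<Rightarrow> sl2" where
  "b_minus q = gn q GenA \<otimes>\<^bsub>SL2 q\<^esub> gn q GenB"

definition qtwo :: "complex \<Rightarrow> complex" where
  "qtwo q = q + inverse q"

section \<open>The calculus on quantum SL2 in degrees up to two\<close>

text \<open>The additive map sending x to q to the power (k * deg x) times x on homogeneous x.\<close>

definition deg_scale :: "complex \<Rightarrow> int \<Rightarrow> sl2 \<Rightarrow> sl2" where
  "deg_scale q k =
    (THE s. s \<in> carrier (SL2 q) \<rightarrow>\<^sub>E carrier (SL2 q) \<and>
       (\<forall>x\<in>carrier (SL2 q). \<forall>y\<in>carrier (SL2 q).
          s (x \<oplus>\<^bsub>SL2 q\<^esub> y) = s x \<oplus>\<^bsub>SL2 q\<^esub> s y) \<and>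
       (\<forall>n. \<forall>x\<in>SL2_deg q n. s x = sc q (q powi (k * n)) \<otimes>\<^bsub>SL2 q\<^esub> x))"

text \<open>
  Forms are families of left coefficients with respect to a finite basis. A basis element e
  of weight k satisfies e x = q^(k deg x) x e for homogeneous x.
\<close>

definition forms :: "complex \<Rightarrow> ('e \<Rightarrow> int) \<Rightarrow> (sl2, 'e \<Rightarrow> sl2) bimodule" where
  "forms q wt =
    \<lparr>carrier = UNIV \<rightarrow> carrier (SL2 q), monoid.mult = undefined, one = undefined,
     zero = (\<lambda>_. \<zero>\<^bsub>SL2 q\<^esub>),
     add = (\<lambda>x y i. x i \<oplus>\<^bsub>SL2 q\<^esub> y i),
     module.smult = (\<lambda>f x i. f \<otimes>\<^bsub>SL2 q\<^esub> x i),
     rsmult = (\<lambda>x f i. x i \<otimes>\<^bsub>SL2 q\<^esub> deg_scale q (wt i) f)\<rparr>"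

datatype basis1 = Ep | Em | E0

text \<open>The basis of 2-forms is e+ e-, e+ e0, e- e0, in this order of the factors.\<close>

datatype basis2 = EpEm | EpE0 | EmE0

type_synonym form1 = "basis1 \<Rightarrow> sl2"
type_synonym form2 = "basis2 \<Rightarrow> sl2"

fun wt1 :: "basis1 \<Rightarrow> int" where
  "wt1 Ep = 1" | "wt1 Em = 1" | "wt1 E0 = 2"

fun wt2 :: "basis2 \<Rightarrow> int" where
  "wt2 EpEm = 2" | "wt2 EpE0 = 3" | "wt2 EmE0 = 3"

definition Om1_SL2 :: "complex \<Rightarrow> (sl2, form1) bimodule" where
  "Om1_SL2 q = forms q wt1"

definition Om2_SL2 :: "complex \<Rightarrow> (sl2, form2) bimodule" where
  "Om2_SL2 q = forms q wt2"

definition form1_of :: "sl2 \<Rightarrow> sl2 \<Rightarrow> sl2 \<Rightarrow> form1" where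
  "form1_of x y z = (\<lambda>i. case i of Ep \<Rightarrow> x | Em \<Rightarrow> y | E0 \<Rightarrow> z)"

definition form2_of :: "sl2 \<Rightarrow> sl2 \<Rightarrow> sl2 \<Rightarrow> form2" where
  "form2_of x y z = (\<lambda>i. case i of EpEm \<Rightarrow> x | EpE0 \<Rightarrow> y | EmE0 \<Rightarrow> z)"

text \<open>
  The product (x e) (y f) = x (e y) f, with e moved past y and the result brought to the
  above basis by e- e+ = - q^2 e+ e-, e0 e+ = - q^4 e+ e0, e0 e- = - q^(-4) e- e0.
\<close>

definition wedge :: "complex \<Rightarrow> form1 \<Rightarrow> form1 \<Rightarrow> form2" where
  "wedge q x y =
    (let A = SL2 q; m = (\<lambda>i j. x i \<otimes>\<^bsub>A\<^esub> deg_scale q (wt1 i) (y j))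
     in form2_of
       (m Ep Em \<ominus>\<^bsub>A\<^esub> sc q (q ^ 2) \<otimes>\<^bsub>A\<^esub> m Em Ep)
       (m Ep E0 \<ominus>\<^bsub>A\<^esub> sc q (q ^ 4) \<otimes>\<^bsub>A\<^esub> m E0 Ep)
       (m Em E0 \<ominus>\<^bsub>A\<^esub> sc q (q powi (-4)) \<otimes>\<^bsub>A\<^esub> m E0 Em))"

definition e1 :: "complex \<Rightarrow> basis1 \<Rightarrow> form1" where
  "e1 q i = (\<lambda>j. if j = i then \<one>\<^bsub>SL2 q\<^esub> else \<zero>\<^bsub>SL2 q\<^esub>)"

fun d_gen :: "complex \<Rightarrow> gen \<Rightarrow> form1" where
  "d_gen q GenA = form1_of (sc q q \<otimes>\<^bsub>SL2 q\<^esub> gn q GenB) \<zero>\<^bsub>SL2 q\<^esub> (gn q GenA)"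
| "d_gen q GenB = form1_of \<zero>\<^bsub>SL2 q\<^esub> (gn q GenA) (sc q (- (q powi (-2))) \<otimes>\<^bsub>SL2 q\<^esub> gn q GenB)"
| "d_gen q GenC = form1_of (sc q q \<otimes>\<^bsub>SL2 q\<^esub> gn q GenD) \<zero>\<^bsub>SL2 q\<^esub> (gn q GenC)"
| "d_gen q GenD = form1_of \<zero>\<^bsub>SL2 q\<^esub> (gn q GenC) (sc q (- (q powi (-2))) \<otimes>\<^bsub>SL2 q\<^esub> gn q GenD)"

text \<open>The differential on functions is the unique complex linear derivation with the above values.\<close>

definition d0 :: "complex \<Rightarrow> sl2 \<Rightarrow> form1" where
  "d0 q =
    (THE D. D \<in> carrier (SL2 q) \<rightarrow>\<^sub>E carrier (Om1_SL2 q) \<and>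
       (\<forall>x\<in>carrier (SL2 q). \<forall>y\<in>carrier (SL2 q).
          D (x \<oplus>\<^bsub>SL2 q\<^esub> y) = D x \<oplus>\<^bsub>Om1_SL2 q\<^esub> D y) \<and>
       (\<forall>z. \<forall>x\<in>carrier (SL2 q).
          D (sc q z \<otimes>\<^bsub>SL2 q\<^esub> x) = sc q z \<odot>\<^bsub>Om1_SL2 q\<^esub> D x) \<and>
       (\<forall>x\<in>carrier (SL2 q). \<forall>y\<in>carrier (SL2 q).
          D (x \<otimes>\<^bsub>SL2 q\<^esub> y) = (D x \<odot>r\<^bsub>Om1_SL2 q\<^esub> y) \<oplus>\<^bsub>Om1_SL2 q\<^esub> (x \<odot>\<^bsub>Om1_SL2 q\<^esub> D y)) \<and>
       (\<forall>g. D (gn q g) = d_gen q g))"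

definition d_e :: "complex \<Rightarrow> basis1 \<Rightarrow> form2" where
  "d_e q i = (let z = \<zero>\<^bsub>SL2 q\<^esub> in
     case i of
       Ep \<Rightarrow> form2_of z (sc q (- (q ^ 2) * (1 + q powi (-2)))) z
     | Em \<Rightarrow> form2_of z z (sc q (q powi (-2) * (1 + q powi (-2))))
     | E0 \<Rightarrow> form2_of (sc q (q ^ 3)) z z)"

text \<open>d (x e) = dx e + x de, summed over the three basis elements.\<close>

definition d1 :: "complex \<Rightarrow> form1 \<Rightarrow> form2" where
  "d1 q x =
    (let t = (\<lambda>i. wedge q (d0 q (x i)) (e1 q i) \<oplus>\<^bsub>Om2_SL2 q\<^esub> (x i \<odot>\<^bsub>Om2_SL2 q\<^esub> d_e q i))
     in t Ep \<oplus>\<^bsub>Om2_SL2 q\<^esub> t Em \<oplus>\<^bsub>Om2_SL2 q\<^esub> t E0)"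

section \<open>The calculus on the quantum sphere\<close>

text \<open>
  The components in degrees one and two of the differential subalgebra generated by the
  functions on the sphere, which are its degree zero component.
\<close>

inductive_set Om1_S2_set :: "complex \<Rightarrow> form1 set" for q :: complex where
  "f \<in> carrier (S2 q) \<Longrightarrow> d0 q f \<in> Om1_S2_set q"
| "x \<in> Om1_S2_set q \<Longrightarrow> y \<in> Om1_S2_set q \<Longrightarrow> x \<oplus>\<^bsub>Om1_SL2 q\<^esub> y \<in> Om1_S2_set q"
| "f \<in> carrier (S2 q) \<Longrightarrow> x \<in> Om1_S2_set q \<Longrightarrow> f \<odot>\<^bsub>Om1_SL2 q\<^esub> x \<in> Om1_S2_set q"
| "f \<in> carrier (S2 q) \<Longrightarrow> x \<in> Om1_S2_set q \<Longrightarrow> x \<odot>r\<^bsub>Om1_SL2 q\<^esub> f \<in> Om1_S2_set q"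

inductive_set Om2_S2_set :: "complex \<Rightarrow> form2 set" for q :: complex where
  "x \<in> Om1_S2_set q \<Longrightarrow> y \<in> Om1_S2_set q \<Longrightarrow> wedge q x y \<in> Om2_S2_set q"
| "x \<in> Om1_S2_set q \<Longrightarrow> d1 q x \<in> Om2_S2_set q"
| "u \<in> Om2_S2_set q \<Longrightarrow> v \<in> Om2_S2_set q \<Longrightarrow> u \<oplus>\<^bsub>Om2_SL2 q\<^esub> v \<in> Om2_S2_set q"
| "f \<in> carrier (S2 q) \<Longrightarrow> u \<in> Om2_S2_set q \<Longrightarrow> f \<odot>\<^bsub>Om2_SL2 q\<^esub> u \<in> Om2_S2_set q"
| "f \<in> carrier (S2 q) \<Longrightarrow> u \<in> Om2_S2_set q \<Longrightarrow> u \<odot>r\<^bsub>Om2_SL2 q\<^esub> f \<in> Om2_S2_set q"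

definition Om1 :: "complex \<Rightarrow> (sl2, form1) bimodule" where
  "Om1 q = (Om1_SL2 q)\<lparr>carrier := Om1_S2_set q\<rparr>"

definition Om2 :: "complex \<Rightarrow> (sl2, form2) bimodule" where
  "Om2 q = (Om2_SL2 q)\<lparr>carrier := Om2_S2_set q\<rparr>"

definition Om10 :: "complex \<Rightarrow> form1 set" where
  "Om10 q = {form1_of f \<zero>\<^bsub>SL2 q\<^esub> \<zero>\<^bsub>SL2 q\<^esub> | f. f \<in> SL2_deg q (-2)}"

definition Om01 :: "complex \<Rightarrow> form1 set" where
  "Om01 q = {form1_of \<zero>\<^bsub>SL2 q\<^esub> f \<zero>\<^bsub>SL2 q\<^esub> | f. f \<in> SL2_deg q 2}"

definition proj10 :: "complex \<Rightarrow> form1 \<Rightarrow> form1" where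
  "proj10 q x = form1_of (x Ep) \<zero>\<^bsub>SL2 q\<^esub> \<zero>\<^bsub>SL2 q\<^esub>"

definition proj01 :: "complex \<Rightarrow> form1 \<Rightarrow> form1" where
  "proj01 q x = form1_of \<zero>\<^bsub>SL2 q\<^esub> (x Em) \<zero>\<^bsub>SL2 q\<^esub>"

definition del :: "complex \<Rightarrow> sl2 \<Rightarrow> form1" where
  "del q f = proj10 q (d0 q f)"

definition delbar :: "complex \<Rightarrow> sl2 \<Rightarrow> form1" where
  "delbar q f = proj01 q (d0 q f)"

definition hodge :: "complex \<Rightarrow> form1 \<Rightarrow> form1" where
  "hodge q x = form1_of (x Ep) (\<ominus>\<^bsub>SL2 q\<^esub> x Em) \<zero>\<^bsub>SL2 q\<^esub>"

definition Ups :: "complex \<Rightarrow> form2" where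
  "Ups q = wedge q (e1 q Ep) (e1 q Em)"

definition T11 :: "complex \<Rightarrow> (sl2, ((form1 \<times> form1) \<Rightarrow>\<^sub>0 int) set) bimodule" where
  "T11 q = tensor (S2 q) (Om1 q) (Om1 q)"

definition T21 :: "complex \<Rightarrow> (sl2, ((form2 \<times> form1) \<Rightarrow>\<^sub>0 int) set) bimodule" where
  "T21 q = tensor (S2 q) (Om2 q) (Om1 q)"

definition t11 :: "complex \<Rightarrow> form1 \<Rightarrow> form1 \<Rightarrow> ((form1 \<times> form1) \<Rightarrow>\<^sub>0 int) set" where
  "t11 q = tens (S2 q) (Om1 q) (Om1 q)"

definition t21 :: "complex \<Rightarrow> form2 \<Rightarrow> form1 \<Rightarrow> ((form2 \<times> form1) \<Rightarrow>\<^sub>0 int) set" where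
  "t21 q = tens (S2 q) (Om2 q) (Om1 q)"

definition wedge_map :: "complex \<Rightarrow> ((form1 \<times> form1) \<Rightarrow>\<^sub>0 int) set \<Rightarrow> form2" where
  "wedge_map q = tensor_lift (Om2 q) (wedge q)"

text \<open>The tensor product of two maps of 1-forms, such as id tensor Hodge.\<close>

definition map11 ::
  "complex \<Rightarrow> (form1 \<Rightarrow> form1) \<Rightarrow> (form1 \<Rightarrow> form1)
    \<Rightarrow> ((form1 \<times> form1) \<Rightarrow>\<^sub>0 int) set \<Rightarrow> ((form1 \<times> form1) \<Rightarrow>\<^sub>0 int) set" where
  "map11 q f h = tensor_lift (T11 q) (\<lambda>x y. t11 q (f x) (h y))"

section \<open>Metric, connection and curvature\<close>

definition metric :: "complex \<Rightarrow> ((form1 \<times> form1) \<Rightarrow>\<^sub>0 int) set" where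
  "metric q =
    (sc q (q ^ 2) \<odot>\<^bsub>T11 q\<^esub> t11 q (d0 q (b_minus q)) (d0 q (b_plus q))
     \<oplus>\<^bsub>T11 q\<^esub> t11 q (d0 q (b_plus q)) (d0 q (b_minus q)))
    \<ominus>\<^bsub>T11 q\<^esub> sc q (qtwo q) \<odot>\<^bsub>T11 q\<^esub> t11 q (d0 q (b_zero q)) (d0 q (b_zero q))"

definition metric_pm :: "complex \<Rightarrow> ((form1 \<times> form1) \<Rightarrow>\<^sub>0 int) set" where
  "metric_pm q = map11 q (proj10 q) (proj01 q) (metric q)"

definition metric_mp :: "complex \<Rightarrow> ((form1 \<times> form1) \<Rightarrow>\<^sub>0 int) set" where
  "metric_mp q = map11 q (proj01 q) (proj10 q) (metric q)"

definition left_connection ::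
  "complex \<Rightarrow> (form1 \<Rightarrow> ((form1 \<times> form1) \<Rightarrow>\<^sub>0 int) set) \<Rightarrow> bool" where
  "left_connection q nabla \<longleftrightarrow>
     nabla \<in> carrier (Om1 q) \<rightarrow> carrier (T11 q) \<and>
     (\<forall>\<tau>\<in>carrier (Om1 q). \<forall>\<eta>\<in>carrier (Om1 q).
        nabla (\<tau> \<oplus>\<^bsub>Om1 q\<^esub> \<eta>) = nabla \<tau> \<oplus>\<^bsub>T11 q\<^esub> nabla \<eta>) \<and>
     (\<forall>m\<in>carrier (S2 q). \<forall>\<tau>\<in>carrier (Om1 q).
        nabla (m \<odot>\<^bsub>Om1 q\<^esub> \<tau>) = t11 q (d0 q m) \<tau> \<oplus>\<^bsub>T11 q\<^esub> m \<odot>\<^bsub>T11 q\<^esub> nabla \<tau>)"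

text \<open>
  The values on the exact forms, being the sums of the values on their two components, are
  nabla (d b+-) = [2] b+- g and nabla (d b0) = (1 + [2] b0) g.
\<close>

definition monopole_levi_civita ::
  "complex \<Rightarrow> (form1 \<Rightarrow> ((form1 \<times> form1) \<Rightarrow>\<^sub>0 int) set) \<Rightarrow> bool" where
  "monopole_levi_civita q nabla \<longleftrightarrow>
     left_connection q nabla \<and>
     (\<forall>b\<in>{b_plus q, b_minus q}.
        nabla (del q b) = (sc q (qtwo q) \<otimes>\<^bsub>S2 q\<^esub> b) \<odot>\<^bsub>T11 q\<^esub> metric_mp q \<and>
        nabla (delbar q b) = (sc q (qtwo q) \<otimes>\<^bsub>S2 q\<^esub> b) \<odot>\<^bsub>T11 q\<^esub> metric_pm q) \<and>
     nabla (del q (b_zero q)) =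
       (\<one>\<^bsub>S2 q\<^esub> \<oplus>\<^bsub>S2 q\<^esub> sc q (qtwo q) \<otimes>\<^bsub>S2 q\<^esub> b_zero q) \<odot>\<^bsub>T11 q\<^esub> metric_mp q \<and>
     nabla (delbar q (b_zero q)) =
       (\<one>\<^bsub>S2 q\<^esub> \<oplus>\<^bsub>S2 q\<^esub> sc q (qtwo q) \<otimes>\<^bsub>S2 q\<^esub> b_zero q) \<odot>\<^bsub>T11 q\<^esub> metric_pm q"

text \<open>The product of a 1-form with the first factor of a tensor.\<close>

definition wedge_left ::
  "complex \<Rightarrow> form1 \<Rightarrow> ((form1 \<times> form1) \<Rightarrow>\<^sub>0 int) set \<Rightarrow> ((form2 \<times> form1) \<Rightarrow>\<^sub>0 int) set" where
  "wedge_left q \<tau> = tensor_lift (T21 q) (\<lambda>\<sigma> \<zeta>. t21 q (wedge q \<tau> \<sigma>) \<zeta>)"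

text \<open>
  Only the difference of the two terms is balanced, hence the single lift.
\<close>

definition Riemann ::
  "complex \<Rightarrow> (form1 \<Rightarrow> ((form1 \<times> form1) \<Rightarrow>\<^sub>0 int) set)
    \<Rightarrow> form1 \<Rightarrow> ((form2 \<times> form1) \<Rightarrow>\<^sub>0 int) set" where
  "Riemann q nabla \<tau> =
    tensor_lift (T21 q)
      (\<lambda>\<sigma> \<eta>. wedge_left q \<sigma> (nabla \<eta>) \<ominus>\<^bsub>T21 q\<^esub> t21 q (d1 q \<sigma>) \<eta>) (nabla \<tau>)"

text \<open>
  The contraction of (i tensor id) Riemann between the middle output factor and the input,
  for a curvature of the form Ups tensor rho with rho a bimodule map.
\<close>

definition Ricci ::
  "complex \<Rightarrow> (form1 \<Rightarrow> ((form1 \<times> form1) \<Rightarrow>\<^sub>0 int) set)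
    \<Rightarrow> (form2 \<Rightarrow> ((form1 \<times> form1) \<Rightarrow>\<^sub>0 int) set) \<Rightarrow> ((form1 \<times> form1) \<Rightarrow>\<^sub>0 int) set" where
  "Ricci q nabla i =
    (THE R. \<exists>\<rho>\<in>bimodule_hom (S2 q) (Om1 q) (Om1 q).
       (\<forall>\<tau>\<in>carrier (Om1 q). Riemann q nabla \<tau> = t21 q (Ups q) (\<rho> \<tau>)) \<and>
       R = map11 q (\<lambda>x. x) \<rho> (i (Ups q)))"

text \<open>
  The value of the lift i on the generator Ups. With the above relations the wedge product
  sends g_{+-} to q^2 Ups and g_{-+} to - q^2 Ups, so it sends this value to (2 q / [2]) Ups:
  i splits the wedge product exactly only when q^2 = 1, otherwise up to this factor.
\<close>

definition lift_value :: "complex \<Rightarrow> ((form1 \<times> form1) \<Rightarrow>\<^sub>0 int) set" where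
  "lift_value q =
    sc q (inverse q / qtwo q) \<odot>\<^bsub>T11 q\<^esub>
      (\<ominus>\<^bsub>T11 q\<^esub> map11 q (\<lambda>x. x) (hodge q) (metric q)
       \<oplus>\<^bsub>T11 q\<^esub> sc q ((1 - q powi (-4)) / (1 + q powi (-4))) \<odot>\<^bsub>T11 q\<^esub> metric q)"

end

theory Submission
  imports Defs
begin

text \<open>
  A form on the sphere is f e+ + h e- with f of degree -2 and h of degree 2. The two halves of
  the metric give partitions of unity, sum u v = 1 with u of degree -2 and v of degree 2 and
  likewise in the opposite order, where the v e- (respectively the u e+) are the components of
  d b+-, d b0. The prescribed values of nabla are annihilated by the cofactors, so nabla is the
  Grassmann connection f e- -> sum d(f u) tensor v e-. Wedging and moving coefficients through
  the central form Ups, the curvature becomes Ups tensor rho with rho multiplication by an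
  explicit element, which a normal form computation in the quantum group shows to be [2] on the
  forms h e- and -q^4 [2] on the forms f e+. Since Ups tensor x determines x, the map rho is
  unique, and the Ricci tensor follows by splitting the metric into its two mixed components,
  on which all the maps involved are scalars.
\<close>

text \<open>Definite descriptions shape the proof. \<open>deg_scale\<close>, \<open>d0\<close>,
  \<open>tensor_lift\<close> and \<open>Ricci\<close> have usable values only once existence and
  uniqueness are known: the first two are built on words and shown to preserve the ideal of
  relations, \<open>tensor_lift\<close> asks for a balanced map each time, and \<open>Ricci\<close>
  asks that the curvature determine \<rho>. The curvature integrand is balanced only as a
  difference, which is read off from a closed formula for \<open>nabla\<close> on all forms.

  The identities behind the computation have a common source. \<open>dif Em\<close> annihilates
  polynomials in a, c and \<open>dif Ep\<close> those in b, d; \<open>cp\<close> and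
  \<open>bm\<close> are of the first kind, \<open>cm\<close> and \<open>bp\<close> of the second. So
  whenever a partition of unity is differentiated, only one of its factors contributes. Moreover
  \<open>beta k\<close> is \<open>dif Em (bp k)\<close> and, up to q^2,
  \<open>dif Ep (bm k)\<close>, which is why both cofactor triples annihilate it. The curvature [2]
  arises from the derivatives of \<open>beta k\<close>, which are [2] times \<open>bm k\<close> or
  \<open>bp k\<close> and pair to 1 with the cofactors.\<close>

section \<open>The free algebra and its quotient\<close>

lemma ring_ring_of_type_algebra: "ring (ring_of_type_algebra :: 'a::ring_1 ring)"
proof -
  have "\<exists>y. x + y = 0" for x :: 'a
    using add.right_inverse by blast
  then show ?thesis
    unfolding ring_of_type_algebra_def
    by unfold_locales (auto simp: algebra_simps Units_def)
qed

lemma type_algebra_simps: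
  "carrier ring_of_type_algebra = UNIV"
  "x \<otimes>\<^bsub>ring_of_type_algebra\<^esub> y = x * y"
  "x \<oplus>\<^bsub>ring_of_type_algebra\<^esub> y = x + y"
  "\<one>\<^bsub>ring_of_type_algebra\<^esub> = 1"
  "\<zero>\<^bsub>ring_of_type_algebra\<^esub> = 0"
  by (simp_all add: ring_of_type_algebra_def)

lemma type_algebra_uminus: "\<ominus>\<^bsub>ring_of_type_algebra\<^esub> x = - (x :: 'a::ring_1)"
proof -
  interpret ring "ring_of_type_algebra :: 'a ring" by (rule ring_ring_of_type_algebra)
  show ?thesis
    by (rule minus_equality) (simp_all add: type_algebra_simps)
qed

lemma ideal_sl2_ideal: "ideal (sl2_ideal q) ring_of_type_algebra"
  by (rule ring.genideal_ideal[OF ring_ring_of_type_algebra]) (simp add: type_algebra_simps)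

lemma ring_SL2: "ring (SL2 q)"
  unfolding SL2_def by (rule ideal.quotient_is_ring[OF ideal_sl2_ideal])

lemma ring_hom_cls: "cls q \<in> ring_hom ring_of_type_algebra (SL2 q)"
  using ideal.rcos_ring_hom[OF ideal_sl2_ideal] unfolding SL2_def cls_def[abs_def] .

lemma cls_closed: "cls q x \<in> carrier (SL2 q)"
  using ring_hom_closed[OF ring_hom_cls] by (simp add: type_algebra_simps)

lemma carrier_SL2: "carrier (SL2 q) = range (cls q)"
  by (auto simp: SL2_def cls_def[abs_def] FactRing_def A_RCOSETS_def RCOSETS_def a_r_coset_def type_algebra_simps
    ring_of_type_algebra_def)

lemma cls_hom:
  "cls q (x + y) = cls q x \<oplus>\<^bsub>SL2 q\<^esub> cls q y"
  "cls q (x * y) = cls q x \<otimes>\<^bsub>SL2 q\<^esub> cls q y"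
  "cls q 1 = \<one>\<^bsub>SL2 q\<^esub>"
  using ring_hom_cls by (auto simp: ring_hom_def type_algebra_simps)

lemma cls_zero: "cls q 0 = \<zero>\<^bsub>SL2 q\<^esub>"
proof -
  interpret ring "SL2 q" by (rule ring_SL2)
  show ?thesis using cls_hom(1)[of q 0 0] cls_closed[of q 0] by (metis add.l_cancel_one' add_0)
qed

lemma cls_uminus: "cls q (- x) = \<ominus>\<^bsub>SL2 q\<^esub> cls q x"
proof -
  interpret ring "SL2 q" by (rule ring_SL2)
  show ?thesis
    by (rule minus_equality[symmetric]) (simp_all add: cls_closed cls_hom(1)[symmetric] cls_zero)
qed

lemma cls_eq_iff: "cls q x = cls q y \<longleftrightarrow> x - y \<in> sl2_ideal q"
proof -
  interpret ideal "sl2_ideal q" ring_of_type_algebra by (rule ideal_sl2_ideal)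
  have "x - y = x \<ominus>\<^bsub>ring_of_type_algebra\<^esub> y"
    by (simp add: a_minus_def type_algebra_uminus type_algebra_simps)
  then show ?thesis
    using quotient_eq_iff_same_a_r_cos[OF ideal_sl2_ideal, of x y]
    by (simp add: cls_def type_algebra_simps)
qed

lemma cls_eq_zero_iff: "cls q x = \<zero>\<^bsub>SL2 q\<^esub> \<longleftrightarrow> x \<in> sl2_ideal q"
  using cls_eq_iff[of q x 0] by (simp add: cls_zero)

lemma poly_mapping_eq_sum: "x = (\<Sum>w\<in>Poly_Mapping.keys x. Poly_Mapping.single w (Poly_Mapping.lookup x w))"
  by (rule poly_mapping_eqI) (simp add: lookup_sum lookup_single when_def in_keys_iff)

lemma single_Word_Cons:
  "Poly_Mapping.single (Word (g # w)) z = gen_free g * Poly_Mapping.single (Word w) (z :: complex)"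
  by (simp add: mult_single plus_word_def)

lemma free_alg_word_induct [case_names word add]:
  assumes word: "\<And>w z. P (Poly_Mapping.single (Word w) z)"
    and add: "\<And>x y. P x \<Longrightarrow> P y \<Longrightarrow> P (x + y)"
  shows "P (x :: free_alg)"
proof -
  have "P (\<Sum>w\<in>S. Poly_Mapping.single w (Poly_Mapping.lookup x w))" if "finite S" for S
    using that
  proof (induction S rule: finite_induct)
    case empty
    then show ?case using word[of "[]" 0] by simp
  next
    case (insert w S)
    then show ?case using add word[of "letters w"] by auto
  qed
  then show ?thesis using poly_mapping_eq_sum[of x] by (metis finite_keys)
qed

lemma free_alg_induct [case_names scalar add gen]:
  assumes scalar: "\<And>z. P (scalar_free z)"
    and add: "\<And>x y. P x \<Longrightarrow> P y \<Longrightarrow> P (x + y)"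
    and gen: "\<And>g x. P x \<Longrightarrow> P (gen_free g * x)"
  shows "P x"
proof (induction x rule: free_alg_word_induct)
  case (word w z)
  show ?case
  proof (induction w)
    case Nil
    show ?case using scalar[of z] by (simp add: zero_word_def)
  next
    case (Cons g w)
    then show ?case by (subst single_Word_Cons) (rule gen)
  qed
qed (rule add)

lemma scalar_free_commute: "scalar_free z * x = x * scalar_free z"
proof (induction x rule: free_alg_induct)
  case (scalar y)
  then show ?case by (simp add: mult_single mult.commute)
next
  case (gen g x)
  have "scalar_free z * gen_free g = gen_free g * scalar_free z"
    by (simp add: mult_single)
  then have "scalar_free z * (gen_free g * x) = gen_free g * (scalar_free z * x)"
    unfolding mult.assoc[symmetric] by (rule arg_cong)
  also have "\<dots> = gen_free g * (x * scalar_free z)" unfolding gen ..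
  finally show ?case unfolding mult.assoc .
qed (simp add: algebra_simps)

section \<open>A ring type for the family of all quantum groups\<close>

text \<open>
  The rings SL2 q depend on a parameter and so are not types. Their product over all nonzero q
  is one, which makes type class automation available for computations with generators; an
  identity in it amounts to the same identity in SL2 q for every nonzero q.
\<close>

typedef qsl = "\<Pi>\<^sub>E q\<in>-{0}. carrier (SL2 q)"
proof -
  have "(\<lambda>q\<in>-{0}. cls q 0) \<in> (\<Pi>\<^sub>E q\<in>-{0}. carrier (SL2 q))" by (auto simp: cls_closed)
  then show ?thesis by blast
qed

definition ev :: "complex \<Rightarrow> qsl \<Rightarrow> sl2" where "ev q x = Rep_qsl x q"

definition fam :: "(complex \<Rightarrow> sl2) \<Rightarrow> qsl" where "fam \<phi> = Abs_qsl (\<lambda>q\<in>-{0}. \<phi> q)"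

lemma ev_closed: "q \<noteq> 0 \<Longrightarrow> ev q x \<in> carrier (SL2 q)"
  using Rep_qsl[of x] by (auto simp: ev_def PiE_def)

lemma ev_fam:
  assumes "\<And>p. p \<noteq> 0 \<Longrightarrow> \<phi> p \<in> carrier (SL2 p)" and "q \<noteq> 0"
  shows "ev q (fam \<phi>) = \<phi> q"
proof -
  have "(\<lambda>q\<in>-{0}. \<phi> q) \<in> (\<Pi>\<^sub>E q\<in>-{0}. carrier (SL2 q))" using assms(1) by auto
  then show ?thesis using assms(2) by (simp add: ev_def fam_def Abs_qsl_inverse)
qed

lemma qsl_eqI: "(\<And>q. q \<noteq> 0 \<Longrightarrow> ev q x = ev q y) \<Longrightarrow> x = y"
  unfolding ev_def
  by (rule Rep_qsl_inject[THEN iffD1], rule PiE_ext[OF Rep_qsl Rep_qsl]) simp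

instantiation qsl :: "{ring, monoid_mult}"
begin

definition "0 = fam (\<lambda>q. \<zero>\<^bsub>SL2 q\<^esub>)"
definition "1 = fam (\<lambda>q. \<one>\<^bsub>SL2 q\<^esub>)"
definition "x + y = fam (\<lambda>q. ev q x \<oplus>\<^bsub>SL2 q\<^esub> ev q y)"
definition "x * y = fam (\<lambda>q. ev q x \<otimes>\<^bsub>SL2 q\<^esub> ev q y)"
definition "- x = fam (\<lambda>q. \<ominus>\<^bsub>SL2 q\<^esub> ev q x)"
definition "x - y = fam (\<lambda>q. ev q x \<oplus>\<^bsub>SL2 q\<^esub> (\<ominus>\<^bsub>SL2 q\<^esub> ev q y))"

context
  fixes q :: complex
  assumes q: "q \<noteq> 0"
begin

lemma ev_zero: "ev q 0 = \<zero>\<^bsub>SL2 q\<^esub>"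
  unfolding zero_qsl_def
  by (rule ev_fam[OF _ q]) (meson ring_SL2 ring.ring_simprules)
lemma ev_one: "ev q 1 = \<one>\<^bsub>SL2 q\<^esub>"
  unfolding one_qsl_def by (rule ev_fam[OF _ q]) (meson ring_SL2 ring.ring_simprules)
lemma ev_add: "ev q (x + y) = ev q x \<oplus>\<^bsub>SL2 q\<^esub> ev q y"
  unfolding plus_qsl_def by (rule ev_fam[OF _ q]) (meson ring_SL2 ring.ring_simprules ev_closed)
lemma ev_mult: "ev q (x * y) = ev q x \<otimes>\<^bsub>SL2 q\<^esub> ev q y"
  unfolding times_qsl_def by (rule ev_fam[OF _ q]) (meson ring_SL2 ring.ring_simprules ev_closed)
lemma ev_uminus: "ev q (- x) = \<ominus>\<^bsub>SL2 q\<^esub> ev q x"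
  unfolding uminus_qsl_def by (rule ev_fam[OF _ q]) (meson ring_SL2 ring.ring_simprules ev_closed)
lemma ev_minus: "ev q (x - y) = ev q x \<oplus>\<^bsub>SL2 q\<^esub> (\<ominus>\<^bsub>SL2 q\<^esub> ev q y)"
  unfolding minus_qsl_def by (rule ev_fam[OF _ q]) (meson ring_SL2 ring.ring_simprules ev_closed)

end

lemmas ev_hom = ev_zero ev_one ev_add ev_mult ev_uminus ev_minus

instance
proof
  fix x y z :: qsl
  note ring = ring.ring_simprules[OF ring_SL2]
  show "x + y + z = x + (y + z)" by (rule qsl_eqI) (simp add: ev_hom ev_closed ring)
  show "x * y * z = x * (y * z)" by (rule qsl_eqI) (simp add: ev_hom ev_closed ring)
  show "x + y = y + x" by (rule qsl_eqI) (simp add: ev_hom ev_closed ring)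
  show "0 + x = x" by (rule qsl_eqI) (simp add: ev_hom ev_closed ring)
  show "1 * x = x" by (rule qsl_eqI) (simp add: ev_hom ev_closed ring)
  show "x * 1 = x"
    by (rule qsl_eqI)
      (simp add: ev_hom ev_closed monoid.r_one[OF ring.is_monoid[OF ring_SL2]])
  show "- x + x = 0" by (rule qsl_eqI) (simp add: ev_hom ev_closed ring)
  show "x - y = x + - y" by (rule qsl_eqI) (simp add: ev_hom ev_closed ring)
  show "(x + y) * z = x * z + y * z" by (rule qsl_eqI) (simp add: ev_hom ev_closed ring)
  show "z * (x + y) = z * x + z * y" by (rule qsl_eqI) (simp add: ev_hom ev_closed ring)
qed

end

section \<open>Generators and scalars in the family ring\<close>

lemma gn_closed: "gn q g \<in> carrier (SL2 q)"
  by (simp add: gn_def cls_closed)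

lemma sc_closed: "sc q z \<in> carrier (SL2 q)"
  by (simp add: sc_def cls_closed)

lemma sc_commute: "x \<in> carrier (SL2 q) \<Longrightarrow> x \<otimes>\<^bsub>SL2 q\<^esub> sc q z = sc q z \<otimes>\<^bsub>SL2 q\<^esub> x"
  unfolding sc_def carrier_SL2 by (auto simp: cls_hom[symmetric] scalar_free_commute)

lemma sc_add: "sc q (y + z) = sc q y \<oplus>\<^bsub>SL2 q\<^esub> sc q z"
  by (simp add: sc_def cls_hom[symmetric] single_add)

lemma sc_mult: "sc q (y * z) = sc q y \<otimes>\<^bsub>SL2 q\<^esub> sc q z"
  by (simp add: sc_def cls_hom[symmetric] mult_single)

lemma sc_one: "sc q 1 = \<one>\<^bsub>SL2 q\<^esub>"
  by (simp add: sc_def flip: cls_hom)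

lemma sc_zero: "sc q 0 = \<zero>\<^bsub>SL2 q\<^esub>"
  by (simp add: sc_def cls_zero)

lemma sc_uminus: "sc q (- z) = \<ominus>\<^bsub>SL2 q\<^esub> sc q z"
  by (simp add: sc_def single_uminus flip: cls_uminus)

definition gA :: qsl where "gA = fam (\<lambda>q. gn q GenA)"
definition gB :: qsl where "gB = fam (\<lambda>q. gn q GenB)"
definition gC :: qsl where "gC = fam (\<lambda>q. gn q GenC)"
definition gD :: qsl where "gD = fam (\<lambda>q. gn q GenD)"

text \<open>Powers of the varying parameter are indexed by integer exponents, so that the simplifier
  collects them by integer arithmetic.\<close>

definition qs :: "int \<Rightarrow> qsl \<Rightarrow> qsl" where
  "qs n x = fam (\<lambda>q. sc q (q powi n) \<otimes>\<^bsub>SL2 q\<^esub> ev q x)"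

lemma ev_gen:
  assumes "q \<noteq> 0"
  shows "ev q gA = gn q GenA" "ev q gB = gn q GenB" "ev q gC = gn q GenC" "ev q gD = gn q GenD"
  unfolding gA_def gB_def gC_def gD_def by (rule ev_fam[OF gn_closed assms])+

lemma ev_qs: "q \<noteq> 0 \<Longrightarrow> ev q (qs n x) = sc q (q powi n) \<otimes>\<^bsub>SL2 q\<^esub> ev q x"
  unfolding qs_def by (rule ev_fam) (meson ring_SL2 ring.ring_simprules ev_closed sc_closed)

lemma qs_simps [simp]:
  "qs m (qs n x) = qs (m + n) x"
  "qs n x * y = qs n (x * y)"
  "x * qs n y = qs n (x * y)"
  "qs n (x + y) = qs n x + qs n y"
  "qs n (- x) = - qs n x"
  "qs n (x - y) = qs n x - qs n y"
  "qs n 0 = 0"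
  "qs 0 x = x"
proof -
  have "sc q z \<otimes>\<^bsub>SL2 q\<^esub> (ev q x \<otimes>\<^bsub>SL2 q\<^esub> ev q y) = ev q x \<otimes>\<^bsub>SL2 q\<^esub> (sc q z \<otimes>\<^bsub>SL2 q\<^esub> ev q y)"
    if "q \<noteq> 0" for q z x y
  proof -
    interpret ring "SL2 q" by (rule ring_SL2)
    show ?thesis using that by (simp add: m_assoc[symmetric] ev_closed sc_closed sc_commute)
  qed
  then show "x * qs n y = qs n (x * y)"
    by (intro qsl_eqI) (simp add: ev_qs ev_hom)
  note ring = ring.ring_simprules[OF ring_SL2]
  show "qs m (qs n x) = qs (m + n) x"
    by (rule qsl_eqI)
      (simp add: ev_qs ev_closed sc_closed power_int_add sc_mult monoid.m_assoc[OF ring.is_monoid[OF ring_SL2]])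
  show "qs n x * y = qs n (x * y)"
    by (rule qsl_eqI)
      (simp add: ev_qs ev_hom ev_closed sc_closed monoid.m_assoc[OF ring.is_monoid[OF ring_SL2]])
  show add: "qs n (x + y) = qs n x + qs n y" for x y
    by (rule qsl_eqI) (simp add: ev_qs ev_hom ev_closed sc_closed ring)
  show zero: "qs n 0 = 0"
    using add[of 0 0] by simp
  show uminus: "qs n (- x) = - qs n x" for x
    by (subst eq_neg_iff_add_eq_0) (simp add: zero flip: add)
  have "qs n (x - y) = qs n x + qs n (- y)"
    unfolding add[symmetric] by simp
  then show "qs n (x - y) = qs n x - qs n y"
    by (simp add: uminus)
  show "qs 0 x = x"
    by (rule qsl_eqI) (simp add: ev_qs ev_hom ev_closed sc_closed sc_one monoid.l_one[OF ring.is_monoid[OF ring_SL2]])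
qed

lemma cls_rel: "r \<in> sl2_rels q \<Longrightarrow> cls q r = \<zero>\<^bsub>SL2 q\<^esub>"
  using ring.genideal_self[OF ring_ring_of_type_algebra, of "sl2_rels q"]
  by (auto simp: cls_eq_zero_iff type_algebra_simps)

lemma gn_relations:
  shows "gB * gA = qs 1 (gA * gB)" "gC * gA = qs 1 (gA * gC)"
    "gD * gB = qs 1 (gB * gD)" "gD * gC = qs 1 (gC * gD)" "gB * gC = gC * gB"
    "gA * gD = 1 + qs (-1) (gB * gC)" "gD * gA = 1 + qs 1 (gB * gC)"
proof -
  have *: "cls q (x - y) = \<zero>\<^bsub>SL2 q\<^esub> \<Longrightarrow> cls q x = cls q y" for q x y
    by (simp add: cls_eq_zero_iff cls_eq_iff)
  note defs = not_False_eq_True ev_hom ev_gen ev_qs gn_def sc_def cls_hom[symmetric]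
  show "gB * gA = qs 1 (gA * gB)" "gC * gA = qs 1 (gA * gC)"
    "gD * gB = qs 1 (gB * gD)" "gD * gC = qs 1 (gC * gD)" "gB * gC = gC * gB"
    "gA * gD = 1 + qs (-1) (gB * gC)" "gD * gA = 1 + qs 1 (gB * gC)"
    by - (rule qsl_eqI, simp only: defs, rule *,
      rule cls_rel, simp add: sl2_rels_def Let_def mult.assoc power_int_minus diff_diff_eq)+
qed

text \<open>In a right-nested product two neighbouring letters do not form a subterm; this turns a
  rule for a word of two letters into one that still fires there.\<close>

lemma left_mult_eq: "x * y = z \<Longrightarrow> x * (y * w) = z * (w :: 'a::semigroup_mult)"
  by (simp flip: mult.assoc)

text \<open>A confluent rewriting system with normal forms b^i c^j a^k and b^i c^j d^k.\<close>

lemma gn_swap: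
  "gA * gB = qs (-1) (gB * gA)" "gA * gC = qs (-1) (gC * gA)" "gC * gB = gB * gC"
  by (simp_all add: gn_relations)

lemmas nf_base = gn_swap gn_relations(3,4,6,7)

lemmas nf = nf_base nf_base[THEN left_mult_eq]

section \<open>Degree scaling and derivations on the free algebra\<close>

text \<open>Linear extension of a map given on words; \<open>sigma\<close> and \<open>der\<close>
  are obtained this way, so that their linearity is automatic.\<close>

definition lin :: "(gen list \<Rightarrow> free_alg) \<Rightarrow> free_alg \<Rightarrow> free_alg" where
  "lin \<phi> x = (\<Sum>w\<in>Poly_Mapping.keys x. scalar_free (Poly_Mapping.lookup x w) * \<phi> (letters w))"

lemma lin_superset:
  assumes "finite S" "Poly_Mapping.keys x \<subseteq> S"
  shows "lin \<phi> x = (\<Sum>w\<in>S. scalar_free (Poly_Mapping.lookup x w) * \<phi> (letters w))"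
  unfolding lin_def using assms
  by (intro sum.mono_neutral_left) (auto simp: in_keys_iff)

lemma lin_add: "lin \<phi> (x + y) = lin \<phi> x + lin \<phi> y"
proof -
  define S where "S = Poly_Mapping.keys x \<union> Poly_Mapping.keys y"
  have "finite S" "Poly_Mapping.keys x \<subseteq> S" "Poly_Mapping.keys y \<subseteq> S" "Poly_Mapping.keys (x + y) \<subseteq> S"
    using keys_add[of x y] by (auto simp: S_def)
  then show ?thesis
    by (simp add: lin_superset[of S] lookup_add single_add distrib_right sum.distrib)
qed

lemma lin_word: "lin \<phi> (Poly_Mapping.single (Word w) z) = scalar_free z * \<phi> w"
  by (simp add: lin_superset[of "{Word w}"])

lemma lin_uminus: "lin \<phi> (- x) = - lin \<phi> x"
  by (simp add: lin_def keys_minus single_uminus sum_negf)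

lemma lin_zero: "lin \<phi> 0 = 0"
  by (simp add: lin_def)

lemma lin_minus: "lin \<phi> (x - y) = lin \<phi> x - lin \<phi> y"
  using lin_add[of \<phi> x "- y"] by (simp add: lin_uminus)

lemma scalar_word: "scalar_free y * Poly_Mapping.single (Word w) z = Poly_Mapping.single (Word w) (y * z)"
  by (simp add: mult_single)

lemma scalar_free_mult: "scalar_free (y * z) = scalar_free y * scalar_free z"
  by (simp add: mult_single)

lemma scalar_free_left_commute: "x * (scalar_free z * y) = scalar_free z * (x * y)"
  unfolding mult.assoc[symmetric] scalar_free_commute[of z x] ..

lemma lin_scalar: "lin \<phi> (scalar_free z * x) = scalar_free z * lin \<phi> x"
proof (induction x rule: free_alg_word_induct)
  case (word w y)
  then show ?case unfolding scalar_word lin_word scalar_free_mult mult.assoc ..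
qed (simp add: distrib_left lin_add)

section \<open>Degree scaling and twisted derivations on words\<close>

definition sigma :: "complex \<Rightarrow> int \<Rightarrow> free_alg \<Rightarrow> free_alg" where
  "sigma q k = lin (\<lambda>w. Poly_Mapping.single (Word w) (q powi (k * word_deg (Word w))))"

lemma sigma_word:
  "sigma q k (Poly_Mapping.single (Word w) z) =
    scalar_free (q powi (k * word_deg (Word w))) * Poly_Mapping.single (Word w) z"
  by (simp only: sigma_def lin_word scalar_word mult.commute)

lemma letters_zero: "letters 0 = []"
  by (simp add: zero_word_def)

lemma sigma_scalar: "sigma q k (scalar_free z) = scalar_free z"
  using sigma_word[of q k "[]" z] by (simp add: word_deg_def letters_zero flip: zero_word_def)

lemma sigma_gen_mult:
  assumes "q \<noteq> 0"
  shows "sigma q k (gen_free g * x) = scalar_free (q powi (k * gen_deg g)) * (gen_free g * sigma q k x)"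
proof (induction x rule: free_alg_word_induct)
  case (word w z)
  have "sigma q k (gen_free g * Poly_Mapping.single (Word w) z)
    = scalar_free (q powi (k * gen_deg g) * q powi (k * word_deg (Word w)))
        * (gen_free g * Poly_Mapping.single (Word w) z)"
    using assms unfolding single_Word_Cons[symmetric] sigma_word
    by (simp add: word_deg_def distrib_left power_int_add)
  then show ?case
    unfolding sigma_word scalar_free_mult mult.assoc scalar_free_left_commute[of "gen_free g"] .
next
  case (add x y)
  then show ?case by (simp add: distrib_left sigma_def lin_add)
qed

lemma sigma_add: "sigma q k (x + y) = sigma q k x + sigma q k y"
  and sigma_zero: "sigma q k 0 = 0"
  and sigma_uminus: "sigma q k (- x) = - sigma q k x"
  and sigma_minus: "sigma q k (x - y) = sigma q k x - sigma q k y"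
  and sigma_scalar_mult: "sigma q k (scalar_free z * x) = scalar_free z * sigma q k x"
  by (simp_all add: sigma_def lin_zero lin_add lin_uminus lin_minus lin_scalar)

lemma sigma_mult:
  assumes "q \<noteq> 0"
  shows "sigma q k (x * y) = sigma q k x * sigma q k y"
proof (induction x rule: free_alg_induct)
  case (scalar z)
  then show ?case by (simp only: sigma_scalar_mult sigma_scalar)
next
  case (add x y)
  then show ?case by (simp add: distrib_right sigma_add)
next
  case (gen g x)
  then show ?case by (simp only: sigma_gen_mult[OF assms] mult.assoc)
qed

lemma sigma_one: "sigma q k 1 = 1"
  using sigma_scalar[of q k 1] by simp

lemma sigma_gen:
  assumes "q \<noteq> 0"
  shows "sigma q k (gen_free g) = scalar_free (q powi (k * gen_deg g)) * gen_free g"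
  using sigma_gen_mult[OF assms, of k g 1] by (simp only: sigma_one mult_1_right)

text \<open>The components of \<open>d_gen\<close> before passing to classes. Writing
  \<open>q powi 1\<close> for \<open>q\<close> gives every scalar the shape that folds back into
  \<open>qs\<close>.\<close>

fun gen_der :: "complex \<Rightarrow> basis1 \<Rightarrow> gen \<Rightarrow> free_alg" where
  "gen_der q Ep GenA = scalar_free (q powi 1) * gen_free GenB"
| "gen_der q Em GenA = 0"
| "gen_der q E0 GenA = gen_free GenA"
| "gen_der q Ep GenB = 0"
| "gen_der q Em GenB = gen_free GenA"
| "gen_der q E0 GenB = - (scalar_free (q powi (-2)) * gen_free GenB)"
| "gen_der q Ep GenC = scalar_free (q powi 1) * gen_free GenD"
| "gen_der q Em GenC = 0"
| "gen_der q E0 GenC = gen_free GenC"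
| "gen_der q Ep GenD = 0"
| "gen_der q Em GenD = gen_free GenC"
| "gen_der q E0 GenD = - (scalar_free (q powi (-2)) * gen_free GenD)"

text \<open>Left coefficients force the twist: in d(g w) = (d g) w + g d w the basis form in d g is
  moved to the right past w, which scales w by its degree.\<close>

fun der_word :: "complex \<Rightarrow> basis1 \<Rightarrow> gen list \<Rightarrow> free_alg" where
  "der_word q i [] = 0"
| "der_word q i (g # w) =
    gen_der q i g * sigma q (wt1 i) (Poly_Mapping.single (Word w) 1) + gen_free g * der_word q i w"

definition der :: "complex \<Rightarrow> basis1 \<Rightarrow> free_alg \<Rightarrow> free_alg" where
  "der q i = lin (der_word q i)"

lemma der_add: "der q i (x + y) = der q i x + der q i y"
  and der_zero: "der q i 0 = 0"
  and der_uminus: "der q i (- x) = - der q i x"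
  and der_minus: "der q i (x - y) = der q i x - der q i y"
  and der_scalar_mult: "der q i (scalar_free z * x) = scalar_free z * der q i x"
  by (simp_all add: der_def lin_zero lin_add lin_uminus lin_minus lin_scalar)

lemma der_word: "der q i (Poly_Mapping.single (Word w) z) = scalar_free z * der_word q i w"
  by (simp only: der_def lin_word)

lemma der_scalar: "der q i (scalar_free z) = 0"
  using der_word[of q i "[]" z] by (simp flip: zero_word_def)

lemma der_one: "der q i 1 = 0"
  using der_scalar[of q i 1] by simp

lemma der_gen_mult:
  "der q i (gen_free g * x) = gen_der q i g * sigma q (wt1 i) x + gen_free g * der q i x"
proof (induction x rule: free_alg_word_induct)
  case (word w z)
  have w: "Poly_Mapping.single (Word w) z = scalar_free z * Poly_Mapping.single (Word w) 1"
    unfolding scalar_word by simp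
  show ?case
    unfolding single_Word_Cons[symmetric] der_word
    unfolding w sigma_scalar_mult der_word.simps distrib_left scalar_free_left_commute ..
qed (simp add: distrib_left der_add sigma_add)

lemma der_gen: "der q i (gen_free g) = gen_der q i g"
  using der_gen_mult[of q i g 1] by (simp only: sigma_one der_one mult_1_right mult_zero_right add_0_right)

lemma der_mult:
  assumes "q \<noteq> 0"
  shows "der q i (x * y) = der q i x * sigma q (wt1 i) y + x * der q i y"
proof (induction x rule: free_alg_induct)
  case (scalar z)
  then show ?case by (simp only: der_scalar_mult der_scalar) simp
next
  case (add x y)
  then show ?case by (simp add: distrib_right der_add)
next
  case (gen g x)
  then show ?case
    by (simp only: der_gen_mult mult.assoc sigma_mult[OF assms] distrib_left distrib_right add.assoc)
qed

section \<open>Descent to the quotient by the relations\<close>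

lemma sl2_ideal_closed:
  assumes "x \<in> sl2_ideal q"
  shows "x * y \<in> sl2_ideal q" "y * x \<in> sl2_ideal q"
  using assms ideal.I_r_closed[OF ideal_sl2_ideal, of x q y] ideal.I_l_closed[OF ideal_sl2_ideal, of x q y]
  by (simp_all add: type_algebra_simps)

lemma sl2_ideal_group:
  shows "0 \<in> sl2_ideal q"
    "x \<in> sl2_ideal q \<Longrightarrow> y \<in> sl2_ideal q \<Longrightarrow> x + y \<in> sl2_ideal q"
    "x \<in> sl2_ideal q \<Longrightarrow> - x \<in> sl2_ideal q"
  using additive_subgroup.zero_closed[OF ideal.axioms(1)[OF ideal_sl2_ideal]]
    additive_subgroup.a_closed[OF ideal.axioms(1)[OF ideal_sl2_ideal]]
    additive_subgroup.a_inv_closed[OF ideal.axioms(1)[OF ideal_sl2_ideal]]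
  by (simp_all add: type_algebra_simps type_algebra_uminus)

lemma sl2_ideal_minimal:
  assumes "x \<in> sl2_ideal q" and "sl2_rels q \<subseteq> J" "0 \<in> J"
    and "\<And>x y. x \<in> J \<Longrightarrow> y \<in> J \<Longrightarrow> x + y \<in> J"
    and "\<And>x. x \<in> J \<Longrightarrow> - x \<in> J"
    and "\<And>x y. x \<in> J \<Longrightarrow> x * y \<in> J"
    and "\<And>x y. x \<in> J \<Longrightarrow> y * x \<in> J"
  shows "x \<in> J"
proof -
  have "ideal J (ring_of_type_algebra :: free_alg ring)"
  proof (rule idealI[OF ring_ring_of_type_algebra])
    show "subgroup J (add_monoid (ring_of_type_algebra :: free_alg ring))"
    proof (rule group.subgroupI)
      show "group (add_monoid (ring_of_type_algebra :: free_alg ring))"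
        by (rule abelian_group.a_group[OF ring.is_abelian_group[OF ring_ring_of_type_algebra]])
      show "inv\<^bsub>add_monoid ring_of_type_algebra\<^esub> y \<in> J" if "y \<in> J" for y
        using assms(5)[OF that] unfolding type_algebra_uminus[unfolded a_inv_def] .
    qed (use assms(3,4) in \<open>auto simp: type_algebra_simps\<close>)
  qed (use assms in \<open>auto simp: type_algebra_simps\<close>)
  then have "sl2_ideal q \<subseteq> J"
    by (rule ring.genideal_minimal[OF ring_ring_of_type_algebra _ assms(2)])
  with assms(1) show ?thesis by blast
qed

lemmas cls_to_ev = cls_hom cls_uminus cls_zero gn_def[symmetric] sc_def[symmetric]
  ev_gen[symmetric] ev_hom[symmetric] ev_qs[symmetric]

lemma cls_scalar_one: "scalar_free q = scalar_free (q powi 1)" "scalar_free (inverse q) = scalar_free (q powi (-1))"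
  by (simp_all add: power_int_minus)

text \<open>Each relation is homogeneous, so degree scaling multiplies it by a power of q. The check
  is made in the quotient, where folding back into \<open>qsl\<close> makes the normal form
  rewriting available.\<close>

lemma sigma_ideal:
  assumes "q \<noteq> 0" "x \<in> sl2_ideal q"
  shows "sigma q k x \<in> sl2_ideal q"
proof -
  have "cls q (sigma q k r) = \<zero>\<^bsub>SL2 q\<^esub>" if "r \<in> sl2_rels q" for r
    using that unfolding sl2_rels_def Let_def cls_scalar_one[of q] insert_iff empty_iff
    apply (elim disjE)
    apply (simp_all only: sigma_mult[OF assms(1)] sigma_add sigma_uminus sigma_one sigma_gen[OF assms(1)] sigma_scalar diff_conv_add_uminus)
    apply (simp_all only: cls_to_ev assms not_False_eq_True wt1.simps)
    apply (simp_all add: nf algebra_simps)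
    done
  then have "sl2_rels q \<subseteq> {x. sigma q k x \<in> sl2_ideal q}"
    unfolding cls_eq_zero_iff by blast
  then have "x \<in> {x. sigma q k x \<in> sl2_ideal q}"
    by (rule sl2_ideal_minimal[OF assms(2)])
      (simp_all add: sigma_zero sl2_ideal_group sigma_add sigma_uminus sigma_mult[OF assms(1)] sl2_ideal_closed)
  then show ?thesis by simp
qed

text \<open>The twisted Leibniz rule has terms with an underived factor. Minimality of the ideal is
  therefore applied to a set that also remembers membership of x itself; for the scaled factor
  \<open>sigma_ideal\<close> is used.\<close>

lemma der_ideal:
  assumes "q \<noteq> 0" "x \<in> sl2_ideal q"
  shows "der q i x \<in> sl2_ideal q"
proof -
  have "cls q (der q i r) = \<zero>\<^bsub>SL2 q\<^esub>" if "r \<in> sl2_rels q" for r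
    using that unfolding sl2_rels_def Let_def cls_scalar_one[of q] insert_iff empty_iff
    apply (cases i; elim disjE)
    apply (simp_all only: der_mult[OF assms(1)] der_add der_uminus der_one der_gen der_scalar diff_conv_add_uminus
       sigma_mult[OF assms(1)] sigma_one sigma_gen[OF assms(1)] sigma_scalar gen_der.simps)
    apply (simp_all only: cls_to_ev assms not_False_eq_True wt1.simps)
    apply (simp_all add: nf algebra_simps)
    done
  then have "sl2_rels q \<subseteq> {x \<in> sl2_ideal q. der q i x \<in> sl2_ideal q}"
    using cls_rel unfolding cls_eq_zero_iff by blast
  then have "x \<in> {x \<in> sl2_ideal q. der q i x \<in> sl2_ideal q}"
    by (rule sl2_ideal_minimal[OF assms(2)])
      (simp_all add: der_zero sl2_ideal_group der_add der_uminus der_mult[OF assms(1)]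
        sl2_ideal_closed sigma_ideal[OF assms(1)])
  then show ?thesis by simp
qed

section \<open>Degree scaling and the differential on quantum SL2\<close>

definition homog_free :: "int \<Rightarrow> free_alg \<Rightarrow> bool" where
  "homog_free n f \<longleftrightarrow> (\<forall>w\<in>Poly_Mapping.keys f. word_deg w = n)"

lemma SL2_deg_eq: "SL2_deg q n = {cls q f | f. homog_free n f}"
  by (simp add: SL2_deg_def homog_free_def)

lemma word_deg_add: "word_deg (v + w) = word_deg v + word_deg w"
  by (simp add: word_deg_def plus_word_def)

lemma homog_free_closed:
  "homog_free n 0"
  "homog_free n f \<Longrightarrow> homog_free n g \<Longrightarrow> homog_free n (f + g)"
  "homog_free n f \<Longrightarrow> homog_free n (- f)"
  "homog_free m f \<Longrightarrow> homog_free n g \<Longrightarrow> homog_free (m + n) (f * g)"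
  "homog_free 0 (scalar_free z)"
  "homog_free (word_deg w) (Poly_Mapping.single w z)"
proof -
  show "homog_free n f \<Longrightarrow> homog_free n g \<Longrightarrow> homog_free n (f + g)"
    using keys_add[of f g] by (auto simp: homog_free_def)
  show "homog_free m f \<Longrightarrow> homog_free n g \<Longrightarrow> homog_free (m + n) (f * g)"
    using keys_mult[of f g] by (auto 0 3 simp: homog_free_def word_deg_add)
qed (auto simp: homog_free_def keys_minus word_deg_def letters_zero)

lemma homog_free_scalar_mult: "homog_free n f \<Longrightarrow> homog_free n (scalar_free z * f)"
  using homog_free_closed(4)[OF homog_free_closed(5), of n f z] by simp

lemma homog_free_gen: "homog_free (gen_deg g) (gen_free g)"
  using homog_free_closed(6)[of "Word [g]" 1] by (simp add: word_deg_def)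

lemma homog_free_lin:
  assumes "homog_free n f" and "\<And>w. word_deg (Word w) = n \<Longrightarrow> homog_free m (\<phi> w)"
  shows "homog_free m (lin \<phi> f)"
proof -
  have "homog_free m (\<Sum>w\<in>S. scalar_free (Poly_Mapping.lookup f w) * \<phi> (letters w))"
    if "finite S" "S \<subseteq> Poly_Mapping.keys f" for S
    using that
  proof (induction S rule: finite_induct)
    case (insert w S)
    then have "word_deg (Word (letters w)) = n" using assms(1) by (auto simp: homog_free_def)
    with insert show ?case
      by (auto intro!: homog_free_closed(2) homog_free_scalar_mult assms(2))
  qed (simp add: homog_free_closed)
  from this[OF finite_keys order_refl] show ?thesis unfolding lin_def .
qed

lemma sigma_homog:
  assumes "homog_free n f"
  shows "sigma q k f = scalar_free (q powi (k * n)) * f"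
proof -
  have "sigma q k f = (\<Sum>w\<in>Poly_Mapping.keys f. scalar_free (q powi (k * n)) * Poly_Mapping.single w (Poly_Mapping.lookup f w))"
    unfolding sigma_def lin_def using assms
    by (intro sum.cong) (simp_all add: homog_free_def mult_single mult.commute)
  also have "\<dots> = scalar_free (q powi (k * n)) * f"
    by (simp add: sum_distrib_left[symmetric] flip: poly_mapping_eq_sum)
  finally show ?thesis .
qed

lemma sigma_homog_closed: "homog_free n f \<Longrightarrow> homog_free n (sigma q k f)"
  by (simp only: sigma_homog homog_free_scalar_mult)

text \<open>With degrees 2, -2, 0 assigned to e+, e-, e0 the differential preserves total degree;
  these are the compensating shifts of the coefficients.\<close>

fun shift :: "basis1 \<Rightarrow> int" where
  "shift Ep = -2" | "shift Em = 2" | "shift E0 = 0"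

lemma der_homog:
  assumes "homog_free n f"
  shows "homog_free (n + shift i) (der q i f)"
proof -
  have gen: "homog_free (gen_deg g + shift i) (gen_der q i g)" for g
    using homog_free_gen[of GenA] homog_free_gen[of GenB] homog_free_gen[of GenC] homog_free_gen[of GenD]
    by (cases i; cases g) (auto intro!: homog_free_scalar_mult homog_free_closed(1,3))
  have word: "homog_free (word_deg (Word w) + shift i) (der_word q i w)" for w
  proof (induction w)
    case (Cons g w)
    have "homog_free ((gen_deg g + shift i) + word_deg (Word w))
        (gen_der q i g * sigma q (wt1 i) (Poly_Mapping.single (Word w) 1))"
      by (intro homog_free_closed gen sigma_homog_closed)
    moreover have "homog_free (gen_deg g + (word_deg (Word w) + shift i)) (gen_free g * der_word q i w)"
      by (intro homog_free_closed homog_free_gen Cons)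
    ultimately show ?case
      by (auto simp: word_deg_def add_ac intro!: homog_free_closed)
  qed (simp add: homog_free_closed)
  show ?thesis
    unfolding der_def by (rule homog_free_lin[OF assms]) (use word in auto)
qed

text \<open>The eigenvalue of the derivation in direction e0 on degree n, a q-integer in base q^2.\<close>

definition qint :: "complex \<Rightarrow> int \<Rightarrow> complex" where
  "qint q n = (if q ^ 2 = 1 then of_int n else (q powi (2 * n) - 1) / (q ^ 2 - 1))"

text \<open>At q^2 = 1 the closed formula for the q-integer degenerates, and the ordinary integer
  satisfies the same recursion because q^(2 n) is then 1.\<close>

lemma qint_succ:
  assumes "q \<noteq> 0"
  shows "qint q (1 + n) = q powi (2 * n) + qint q n"
proof (cases "q ^ 2 = 1")
  case True
  then have "q powi (2 * n) = 1" by (simp add: power_int_mult)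
  with True show ?thesis by (simp add: qint_def)
next
  case False
  then have "q ^ 2 - 1 \<noteq> 0" by simp
  moreover have "q powi (2 * (1 + n)) = q ^ 2 * q powi (2 * n)"
    using assms by (simp add: distrib_left power_int_add)
  ultimately show ?thesis using False by (simp add: qint_def field_simps)
qed

lemma qint_pred:
  assumes "q \<noteq> 0"
  shows "qint q (-1 + n) = - (q powi (-2)) * q powi (2 * n) + qint q n"
  using qint_succ[OF assms, of "-1 + n"] assms by (simp add: right_diff_distrib power_int_diff power_int_minus divide_inverse mult.commute)

text \<open>The e0 direction is a q-deformed grading operator: a letter contributes 1 or -q^(-2),
  the q-integers of 1 and -1, and the twist by the rest of the word supplies the powers that add
  these up to the q-integer of the degree.\<close>

lemma der_vertical_homog:
  assumes "q \<noteq> 0" "homog_free n f"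
  shows "der q E0 f = scalar_free (qint q n) * f"
proof -
  have word: "der_word q E0 w = Poly_Mapping.single (Word w) (qint q (word_deg (Word w)))" for w
  proof (induction w)
    case Nil
    then show ?case by (simp add: qint_def word_deg_def)
  next
    case (Cons g w)
    define c where "c = (if gen_deg g = 1 then 1 else - (q powi (-2)))"
    have c: "gen_der q E0 g = scalar_free c * gen_free g"
      "qint q (gen_deg g + n) = c * q powi (2 * n) + qint q n" for n
      using qint_succ[OF assms(1)] qint_pred[OF assms(1)]
      by (cases g; simp add: c_def single_uminus)+
    have "der_word q E0 (g # w) = Poly_Mapping.single (Word (g # w))
        (c * q powi (2 * word_deg (Word w)) + qint q (word_deg (Word w)))"
      unfolding der_word.simps c(1) sigma_word Cons
      by (simp add: mult_single plus_word_def single_add letters_zero)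
    then show ?case by (simp add: c(2)[symmetric] word_deg_def)
  qed
  have "der q E0 f = (\<Sum>w\<in>Poly_Mapping.keys f. scalar_free (qint q n) * Poly_Mapping.single w (Poly_Mapping.lookup f w))"
    unfolding der_def lin_def using assms(2)
    by (intro sum.cong) (simp_all add: word homog_free_def mult_single mult.commute)
  also have "\<dots> = scalar_free (qint q n) * f"
    by (simp add: sum_distrib_left[symmetric] flip: poly_mapping_eq_sum)
  finally show ?thesis .
qed

lemma SL2_cases:
  assumes "x \<in> carrier (SL2 q)"
  obtains f where "x = cls q f"
  using assms by (auto simp: carrier_SL2)

lemma SL2_deg_subset: "SL2_deg q n \<subseteq> carrier (SL2 q)"
  by (auto simp: SL2_deg_def cls_closed)

text \<open>Existence: \<open>sigma\<close> preserves the ideal, so its value on a chosen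
  representative is as good as on any other. Uniqueness: words are homogeneous and the classes of
  their scalar multiples generate additively, while extensionality fixes the values off the
  carrier.\<close>

lemma deg_scale_cls:
  assumes "q \<noteq> 0"
  shows "deg_scale q k (cls q x) = cls q (sigma q k x)"
proof -
  let ?P = "\<lambda>s. s \<in> carrier (SL2 q) \<rightarrow>\<^sub>E carrier (SL2 q) \<and>
       (\<forall>x\<in>carrier (SL2 q). \<forall>y\<in>carrier (SL2 q).
          s (x \<oplus>\<^bsub>SL2 q\<^esub> y) = s x \<oplus>\<^bsub>SL2 q\<^esub> s y) \<and>
       (\<forall>n. \<forall>x\<in>SL2_deg q n. s x = sc q (q powi (k * n)) \<otimes>\<^bsub>SL2 q\<^esub> x)"
  define s where "s = restrict (\<lambda>u. cls q (sigma q k (inv_into UNIV (cls q) u))) (carrier (SL2 q))"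
  have s: "s (cls q x) = cls q (sigma q k x)" for x
  proof -
    have "cls q x = cls q (inv_into UNIV (cls q) (cls q x))" by (simp add: f_inv_into_f)
    then have "cls q (sigma q k x) = cls q (sigma q k (inv_into UNIV (cls q) (cls q x)))"
      using sigma_ideal[OF assms] unfolding cls_eq_iff sigma_minus[symmetric] by blast
    then show ?thesis by (simp add: s_def cls_closed)
  qed
  have "?P s"
  proof (intro conjI ballI allI)
    show "s \<in> carrier (SL2 q) \<rightarrow>\<^sub>E carrier (SL2 q)" by (auto simp: s_def cls_closed)
    show "s (x \<oplus>\<^bsub>SL2 q\<^esub> y) = s x \<oplus>\<^bsub>SL2 q\<^esub> s y"
      if "x \<in> carrier (SL2 q)" "y \<in> carrier (SL2 q)" for x y
      using that by (elim SL2_cases) (simp add: s sigma_add flip: cls_hom)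
    show "s x = sc q (q powi (k * n)) \<otimes>\<^bsub>SL2 q\<^esub> x" if "x \<in> SL2_deg q n" for x n
      using that by (auto simp: SL2_deg_eq s sigma_homog sc_def simp flip: cls_hom)
  qed
  moreover have "t = s" if t: "?P t" for t
  proof -
    have "t (cls q x) = s (cls q x)" for x
    proof (induction x rule: free_alg_word_induct)
      case (word w z)
      have "cls q (Poly_Mapping.single (Word w) z) \<in> SL2_deg q (word_deg (Word w))"
        by (auto simp: SL2_deg_eq homog_free_closed)
      then show ?case using t \<open>?P s\<close> by metis
    next
      case (add x y)
      then show ?case using t \<open>?P s\<close> by (simp add: cls_hom cls_closed)
    qed
    then show ?thesis
      using t \<open>?P s\<close> by (intro PiE_ext[of t "carrier (SL2 q)" "\<lambda>_. carrier (SL2 q)" s]) (auto elim: SL2_cases)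
  qed
  ultimately have "deg_scale q k = s"
    unfolding deg_scale_def by (rule the_equality)
  then show ?thesis by (simp add: s)
qed

lemma forms_simps:
  "carrier (forms q wt) = UNIV \<rightarrow> carrier (SL2 q)"
  "\<zero>\<^bsub>forms q wt\<^esub> = (\<lambda>_. \<zero>\<^bsub>SL2 q\<^esub>)"
  "x \<oplus>\<^bsub>forms q wt\<^esub> y = (\<lambda>i. x i \<oplus>\<^bsub>SL2 q\<^esub> y i)"
  "f \<odot>\<^bsub>forms q wt\<^esub> x = (\<lambda>i. f \<otimes>\<^bsub>SL2 q\<^esub> x i)"
  "x \<odot>r\<^bsub>forms q wt\<^esub> f = (\<lambda>i. x i \<otimes>\<^bsub>SL2 q\<^esub> deg_scale q (wt i) f)"
  by (simp_all add: forms_def)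

lemma d_gen_eq: "d_gen q g = (\<lambda>i. cls q (gen_der q i g))"
proof
  have "cls q (- (scalar_free z * x)) = sc q (- z) \<otimes>\<^bsub>SL2 q\<^esub> cls q x" for z x
    by (simp add: sc_def single_uminus flip: cls_hom)
  then show "d_gen q g i = cls q (gen_der q i g)" for i
    by (cases i; cases g) (simp_all add: form1_of_def cls_hom cls_zero gn_def[symmetric] sc_def[symmetric])
qed

lemma d0_cls:
  assumes "q \<noteq> 0"
  shows "d0 q (cls q x) = (\<lambda>i. cls q (der q i x))"
proof -
  let ?P = "\<lambda>D. D \<in> carrier (SL2 q) \<rightarrow>\<^sub>E carrier (Om1_SL2 q) \<and>
       (\<forall>x\<in>carrier (SL2 q). \<forall>y\<in>carrier (SL2 q).
          D (x \<oplus>\<^bsub>SL2 q\<^esub> y) = D x \<oplus>\<^bsub>Om1_SL2 q\<^esub> D y) \<and>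
       (\<forall>z. \<forall>x\<in>carrier (SL2 q).
          D (sc q z \<otimes>\<^bsub>SL2 q\<^esub> x) = sc q z \<odot>\<^bsub>Om1_SL2 q\<^esub> D x) \<and>
       (\<forall>x\<in>carrier (SL2 q). \<forall>y\<in>carrier (SL2 q).
          D (x \<otimes>\<^bsub>SL2 q\<^esub> y) = (D x \<odot>r\<^bsub>Om1_SL2 q\<^esub> y) \<oplus>\<^bsub>Om1_SL2 q\<^esub> (x \<odot>\<^bsub>Om1_SL2 q\<^esub> D y)) \<and>
       (\<forall>g. D (gn q g) = d_gen q g)"
  interpret ring "SL2 q" by (rule ring_SL2)
  define D where "D = restrict (\<lambda>u i. cls q (der q i (inv_into UNIV (cls q) u))) (carrier (SL2 q))"
  have D: "D (cls q x) = (\<lambda>i. cls q (der q i x))" for x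
  proof -
    have "cls q x = cls q (inv_into UNIV (cls q) (cls q x))" by (simp add: f_inv_into_f)
    then have "cls q (der q i x) = cls q (der q i (inv_into UNIV (cls q) (cls q x)))" for i
      using der_ideal[OF assms] unfolding cls_eq_iff der_minus[symmetric] by blast
    then show ?thesis by (simp add: D_def cls_closed)
  qed
  have "?P D"
  proof (intro conjI ballI allI)
    show "D \<in> carrier (SL2 q) \<rightarrow>\<^sub>E carrier (Om1_SL2 q)"
      by (auto simp: D_def cls_closed Om1_SL2_def forms_simps)
    show "D (x \<oplus>\<^bsub>SL2 q\<^esub> y) = D x \<oplus>\<^bsub>Om1_SL2 q\<^esub> D y"
      if "x \<in> carrier (SL2 q)" "y \<in> carrier (SL2 q)" for x y
      using that by (elim SL2_cases) (simp add: D der_add Om1_SL2_def forms_simps flip: cls_hom)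
    show "D (sc q z \<otimes>\<^bsub>SL2 q\<^esub> x) = sc q z \<odot>\<^bsub>Om1_SL2 q\<^esub> D x"
      if "x \<in> carrier (SL2 q)" for x z
      using that by (elim SL2_cases) (simp add: D der_scalar_mult sc_def Om1_SL2_def forms_simps flip: cls_hom)
    show "D (x \<otimes>\<^bsub>SL2 q\<^esub> y) = (D x \<odot>r\<^bsub>Om1_SL2 q\<^esub> y) \<oplus>\<^bsub>Om1_SL2 q\<^esub> (x \<odot>\<^bsub>Om1_SL2 q\<^esub> D y)"
      if "x \<in> carrier (SL2 q)" "y \<in> carrier (SL2 q)" for x y
      using that
      by (elim SL2_cases)
        (simp add: D der_mult[OF assms] Om1_SL2_def forms_simps deg_scale_cls[OF assms] flip: cls_hom)
    show "D (gn q g) = d_gen q g" for g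
      by (simp add: gn_def D der_gen d_gen_eq)
  qed
  moreover have "E = D" if E: "?P E" for E
  proof -
    \<comment> \<open>The Leibniz rule at 1 = 1 1 forces every candidate to vanish on 1, hence by
      linearity on all scalars; this is the base of the induction on words.\<close>
    have one: "F \<one>\<^bsub>SL2 q\<^esub> = (\<lambda>_. \<zero>\<^bsub>SL2 q\<^esub>)" if "?P F" for F
    proof
      fix i
      have "F (\<one>\<^bsub>SL2 q\<^esub> \<otimes>\<^bsub>SL2 q\<^esub> \<one>\<^bsub>SL2 q\<^esub>) = (F \<one>\<^bsub>SL2 q\<^esub> \<odot>r\<^bsub>Om1_SL2 q\<^esub> \<one>\<^bsub>SL2 q\<^esub>)
          \<oplus>\<^bsub>Om1_SL2 q\<^esub> (\<one>\<^bsub>SL2 q\<^esub> \<odot>\<^bsub>Om1_SL2 q\<^esub> F \<one>\<^bsub>SL2 q\<^esub>)"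
        using that one_closed by blast
      from fun_cong[OF this, of i]
      have "F \<one>\<^bsub>SL2 q\<^esub> i = F \<one>\<^bsub>SL2 q\<^esub> i \<otimes>\<^bsub>SL2 q\<^esub> deg_scale q (wt1 i) \<one>\<^bsub>SL2 q\<^esub>
          \<oplus>\<^bsub>SL2 q\<^esub> \<one>\<^bsub>SL2 q\<^esub> \<otimes>\<^bsub>SL2 q\<^esub> F \<one>\<^bsub>SL2 q\<^esub> i"
        by (simp only: Om1_SL2_def forms_simps l_one[OF one_closed])
      moreover have "deg_scale q (wt1 i) \<one>\<^bsub>SL2 q\<^esub> = \<one>\<^bsub>SL2 q\<^esub>"
        by (simp add: cls_hom(3)[symmetric] deg_scale_cls[OF assms] sigma_one)
      moreover have "F \<one>\<^bsub>SL2 q\<^esub> i \<in> carrier (SL2 q)"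
        using conjunct1[OF that] by (auto simp: Om1_SL2_def forms_simps)
      ultimately show "F \<one>\<^bsub>SL2 q\<^esub> i = \<zero>\<^bsub>SL2 q\<^esub>" by simp
    qed
    have "E (cls q x) = D (cls q x)" for x
    proof (induction x rule: free_alg_induct)
      case (scalar z)
      have "cls q (scalar_free z) = sc q z \<otimes>\<^bsub>SL2 q\<^esub> \<one>\<^bsub>SL2 q\<^esub>"
        by (simp add: sc_def flip: cls_hom)
      then show ?case using E \<open>?P D\<close> one[OF E] one[OF \<open>?P D\<close>] by simp
    next
      case (add x y)
      then show ?case using E \<open>?P D\<close> by (simp add: cls_hom cls_closed)
    next
      case (gen g x)
      then show ?case using E \<open>?P D\<close> by (simp add: cls_hom(2) gn_def[symmetric] cls_closed gn_closed)
    qed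
    then show ?thesis
      using E \<open>?P D\<close>
      by (intro PiE_ext[of E "carrier (SL2 q)" "\<lambda>_. carrier (Om1_SL2 q)" D]) (auto elim: SL2_cases)
  qed
  ultimately have "d0 q = D"
    unfolding d0_def by (rule the_equality)
  then show ?thesis by (simp add: D)
qed

section \<open>The calculus on the family of all quantum groups\<close>

definition sg :: "int \<Rightarrow> qsl \<Rightarrow> qsl" where
  "sg k x = fam (\<lambda>q. deg_scale q k (ev q x))"

definition dif :: "basis1 \<Rightarrow> qsl \<Rightarrow> qsl" where
  "dif i x = fam (\<lambda>q. d0 q (ev q x) i)"

lemma ev_cases:
  assumes "q \<noteq> 0"
  obtains f where "ev q x = cls q f"
  using ev_closed[OF assms] by (rule SL2_cases)

lemma deg_scale_closed: "q \<noteq> 0 \<Longrightarrow> x \<in> carrier (SL2 q) \<Longrightarrow> deg_scale q k x \<in> carrier (SL2 q)"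
  by (elim SL2_cases) (simp add: deg_scale_cls cls_closed)

lemma d0_closed: "q \<noteq> 0 \<Longrightarrow> x \<in> carrier (SL2 q) \<Longrightarrow> d0 q x i \<in> carrier (SL2 q)"
  by (elim SL2_cases) (simp add: d0_cls cls_closed)

lemma ev_sg: "q \<noteq> 0 \<Longrightarrow> ev q (sg k x) = deg_scale q k (ev q x)"
  unfolding sg_def by (rule ev_fam) (simp_all add: deg_scale_closed ev_closed)

lemma ev_dif: "q \<noteq> 0 \<Longrightarrow> ev q (dif i x) = d0 q (ev q x) i"
  unfolding dif_def by (rule ev_fam) (simp_all add: d0_closed ev_closed)

lemma sg_dif_hom:
  shows sg_add: "sg k (x + y) = sg k x + sg k y"
    and sg_uminus: "sg k (- x) = - sg k x"
    and sg_mult: "sg k (x * y) = sg k x * sg k y"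
    and sg_zero: "sg k 0 = 0"
    and sg_one: "sg k 1 = 1"
    and sg_qs: "sg k (qs n x) = qs n (sg k x)"
    and dif_add: "dif i (x + y) = dif i x + dif i y"
    and dif_uminus: "dif i (- x) = - dif i x"
    and dif_zero: "dif i 0 = 0"
    and dif_one: "dif i 1 = 0"
    and dif_qs: "dif i (qs n x) = qs n (dif i x)"
    and dif_mult: "dif i (x * y) = dif i x * sg (wt1 i) y + x * dif i y"
proof -
  have *: "u = v"
    if "\<And>q f g. q \<noteq> 0 \<Longrightarrow> ev q x = cls q f \<Longrightarrow> ev q y = cls q g \<Longrightarrow> ev q u = ev q v" for u v
    using that by (intro qsl_eqI) (metis ev_cases)
  note simps = ev_hom ev_qs ev_sg ev_dif sc_def deg_scale_cls d0_cls
    sigma_add sigma_uminus sigma_mult sigma_zero sigma_one sigma_scalar_mult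
    der_add der_uminus der_mult der_zero der_one der_scalar_mult
  show "sg k (x + y) = sg k x + sg k y" by (rule *) (simp add: simps flip: cls_hom)
  show "sg k (- x) = - sg k x" by (rule *) (simp add: simps flip: cls_uminus)
  show "sg k (x * y) = sg k x * sg k y" by (rule *) (simp add: simps flip: cls_hom)
  show "sg k 0 = 0" by (rule *) (simp add: simps flip: cls_zero)
  show "sg k 1 = 1" by (rule *) (simp add: simps flip: cls_hom)
  show "sg k (qs n x) = qs n (sg k x)" by (rule *) (simp add: simps flip: cls_hom)
  show "dif i (x + y) = dif i x + dif i y" by (rule *) (simp add: simps flip: cls_hom)
  show "dif i (- x) = - dif i x" by (rule *) (simp add: simps flip: cls_uminus)
  show "dif i 0 = 0" by (rule *) (simp add: simps flip: cls_zero)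
  show "dif i 1 = 0" by (rule *) (simp add: ev_hom ev_dif cls_hom(3)[symmetric] d0_cls der_one cls_zero)
  show "dif i (qs n x) = qs n (dif i x)" by (rule *) (simp add: simps flip: cls_hom)
  show "dif i (x * y) = dif i x * sg (wt1 i) y + x * dif i y" by (rule *) (simp add: simps flip: cls_hom)
qed

lemma sg_minus: "sg k (x - y) = sg k x - sg k y"
  using sg_add[of k x "- y"] by (simp add: sg_uminus)

lemma dif_minus: "dif i (x - y) = dif i x - dif i y"
  using dif_add[of i x "- y"] by (simp add: dif_uminus)

lemma sg_sg: "sg k (sg l x) = sg (k + l) x"
proof (rule qsl_eqI)
  fix q :: complex assume q: "q \<noteq> 0"
  obtain f where f: "ev q x = cls q f" using q by (rule ev_cases)
  have "sigma q k (sigma q l f) = sigma q (k + l) f"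
  proof (induction f rule: free_alg_word_induct)
    case (word w z)
    have "q powi (l * word_deg (Word w)) * q powi (k * word_deg (Word w)) = q powi ((k + l) * word_deg (Word w))"
      using q by (simp add: power_int_add distrib_right)
    then show ?case
      unfolding sigma_word sigma_scalar_mult
      by (simp only: mult.assoc[symmetric] scalar_free_mult[symmetric])
  qed (simp add: sigma_add)
  then show "ev q (sg k (sg l x)) = ev q (sg (k + l) x)"
    by (simp add: q ev_sg f deg_scale_cls)
qed

lemma dif_sg: "dif i (sg k x) = qs (- (k * shift i)) (sg k (dif i x))"
proof (rule qsl_eqI)
  fix q :: complex assume q: "q \<noteq> 0"
  obtain f where f: "ev q x = cls q f" using q by (rule ev_cases)
  have "der q i (sigma q k f) = scalar_free (q powi (- (k * shift i))) * sigma q k (der q i f)"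
  proof (induction f rule: free_alg_word_induct)
    case (word w z)
    have hom: "homog_free (word_deg (Word w)) (Poly_Mapping.single (Word w) z)"
      by (rule homog_free_closed)
    have "q powi (- (k * shift i)) * q powi (k * (word_deg (Word w) + shift i)) = q powi (k * word_deg (Word w))"
      using q by (simp add: power_int_add[symmetric] distrib_left)
    then show ?case
      unfolding sigma_homog[OF hom] sigma_homog[OF der_homog[OF hom]] der_scalar_mult
      by (simp only: mult.assoc[symmetric] scalar_free_mult[symmetric])
  qed (simp add: sigma_add der_add distrib_left)
  then show "ev q (dif i (sg k x)) = ev q (qs (- (k * shift i)) (sg k (dif i x)))"
    by (simp add: q ev_sg ev_dif ev_qs f deg_scale_cls d0_cls sc_def flip: cls_hom)
qed

lemma sg_gen [simp]: "sg k gA = qs k gA" "sg k gB = qs (- k) gB" "sg k gC = qs k gC" "sg k gD = qs (- k) gD"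
  by (rule qsl_eqI, simp add: ev_sg ev_gen ev_qs gn_def deg_scale_cls sigma_gen sc_def flip: cls_hom)+

lemma dif_gen [simp]:
  "dif Ep gA = qs 1 gB" "dif Em gA = 0" "dif E0 gA = gA"
  "dif Ep gB = 0" "dif Em gB = gA" "dif E0 gB = - qs (-2) gB"
  "dif Ep gC = qs 1 gD" "dif Em gC = 0" "dif E0 gC = gC"
  "dif Ep gD = 0" "dif Em gD = gC" "dif E0 gD = - qs (-2) gD"
  by (rule qsl_eqI, simp add: ev_dif ev_gen ev_qs ev_hom gn_def d0_cls der_gen sc_def cls_zero cls_uminus flip: cls_hom)+

lemmas calc [simp] = sg_add sg_uminus sg_minus sg_mult sg_zero sg_one sg_qs
  dif_add dif_uminus dif_minus dif_zero dif_one dif_qs dif_mult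

section \<open>Homogeneous families and the derivative along e0\<close>

definition homog :: "int \<Rightarrow> qsl \<Rightarrow> bool" where
  "homog n x \<longleftrightarrow> (\<forall>q. q \<noteq> 0 \<longrightarrow> ev q x \<in> SL2_deg q n)"

lemma homogD:
  assumes "homog n x" "q \<noteq> 0"
  obtains f where "ev q x = cls q f" "homog_free n f"
  using assms by (auto simp: homog_def SL2_deg_eq)

lemma homogI:
  assumes "\<And>q. q \<noteq> 0 \<Longrightarrow> \<exists>f. ev q x = cls q f \<and> homog_free n f"
  shows "homog n x"
  using assms by (auto simp: homog_def SL2_deg_eq)

lemma homog_closed:
  shows homog_zero: "homog n 0"
    and homog_one: "homog 0 1"
    and homog_add: "homog n x \<Longrightarrow> homog n y \<Longrightarrow> homog n (x + y)"
    and homog_uminus: "homog n x \<Longrightarrow> homog n (- x)"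
    and homog_minus: "homog n x \<Longrightarrow> homog n y \<Longrightarrow> homog n (x - y)"
    and homog_qs: "homog n x \<Longrightarrow> homog n (qs k x)"
    and homog_mult: "homog m x \<Longrightarrow> homog n y \<Longrightarrow> l = m + n \<Longrightarrow> homog l (x * y)"
    and homog_dif: "homog n x \<Longrightarrow> l = n + shift i \<Longrightarrow> homog l (dif i x)"
proof -
  show "homog n 0"
    by (rule homogI) (metis ev_hom(1) cls_zero homog_free_closed(1))
  have "homog_free 0 1" using homog_free_closed(5)[of 1] by simp
  then show "homog 0 1"
    by (intro homogI) (metis ev_hom(2) cls_hom(3))
  show add: "homog n x \<Longrightarrow> homog n y \<Longrightarrow> homog n (x + y)" for x y
    by (rule homogI) (metis homogD ev_hom(3) cls_hom(1) homog_free_closed(2))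
  show uminus: "homog n x \<Longrightarrow> homog n (- x)" for x
    by (rule homogI) (metis homogD ev_hom(5) cls_uminus homog_free_closed(3))
  show "homog n x \<Longrightarrow> homog n y \<Longrightarrow> homog n (x - y)"
    using add[of x "- y"] uminus[of y] by simp
  show "homog n x \<Longrightarrow> homog n (qs k x)"
    by (rule homogI) (metis homogD ev_qs sc_def cls_hom(2) homog_free_scalar_mult)
  show "homog m x \<Longrightarrow> homog n y \<Longrightarrow> l = m + n \<Longrightarrow> homog l (x * y)"
    by (rule homogI) (metis homogD ev_hom(4) cls_hom(2) homog_free_closed(4))
  show "homog n x \<Longrightarrow> l = n + shift i \<Longrightarrow> homog l (dif i x)"
    by (rule homogI) (metis homogD ev_dif d0_cls der_homog)
qed

lemma homog_gen: "homog 1 gA" "homog (-1) gB" "homog 1 gC" "homog (-1) gD"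
  using homog_free_gen[of GenA] homog_free_gen[of GenB] homog_free_gen[of GenC] homog_free_gen[of GenD]
  by (auto intro!: homogI simp: ev_gen gn_def)

lemma sg_homog: "homog n x \<Longrightarrow> sg k x = qs (k * n) x"
  by (rule qsl_eqI)
    (auto elim!: homogD simp: ev_sg ev_qs deg_scale_cls sigma_homog sc_def simp flip: cls_hom)

lemma ev_dif_vertical:
  assumes "homog n x" "q \<noteq> 0"
  shows "ev q (dif E0 x) = sc q (qint q n) \<otimes>\<^bsub>SL2 q\<^esub> ev q x"
  using assms
  by (auto elim!: homogD simp: ev_dif d0_cls der_vertical_homog sc_def simp flip: cls_hom)

lemma qint_values:
  assumes "q \<noteq> 0"
  shows "qint q 0 = 0" "qint q 2 = 1 + q powi 2" "qint q (-2) = - (q powi (-2)) - q powi (-4)"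
proof -
  show 0: "qint q 0 = 0" by (simp add: qint_def)
  have 1: "qint q 1 = 1" using qint_succ[OF assms, of 0] 0 by simp
  show "qint q 2 = 1 + q powi 2" using qint_succ[OF assms, of 1] 1 by simp
  have "qint q (-1) = - (q powi (-2))" using qint_pred[OF assms, of 0] 0 by simp
  then show "qint q (-2) = - (q powi (-2)) - q powi (-4)"
    using qint_pred[OF assms, of "-1"] power_int_add[of q "-2" "-2"] assms by simp
qed

text \<open>Degrees 0, 2 and -2 are those of the coefficients of forms on the sphere. The first
  value confines d f to e+ and e-; the other two cancel the e0 parts of d e- and d e+ in
  \<open>d1_frm\<close>.\<close>

lemma dif_vertical:
  shows "homog 0 x \<Longrightarrow> dif E0 x = 0"
    and "homog 2 x \<Longrightarrow> dif E0 x = x + qs 2 x"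
    and "homog (-2) x \<Longrightarrow> dif E0 x = - qs (-2) x - qs (-4) x"
proof -
  note ring = ring.ring_simprules[OF ring_SL2]
  show "homog 0 x \<Longrightarrow> dif E0 x = 0"
    by (rule qsl_eqI) (simp add: ev_dif_vertical qint_values sc_zero ev_hom ev_closed ring)
  have "sc q (1 + y) \<otimes>\<^bsub>SL2 q\<^esub> ev q x = ev q x \<oplus>\<^bsub>SL2 q\<^esub> sc q y \<otimes>\<^bsub>SL2 q\<^esub> ev q x"
    if "q \<noteq> 0" for q y
  proof -
    interpret ring "SL2 q" by (rule ring_SL2)
    show ?thesis using that by (simp add: sc_add sc_one l_distr ev_closed sc_closed)
  qed
  then show "homog 2 x \<Longrightarrow> dif E0 x = x + qs 2 x"
    by (intro qsl_eqI) (simp add: ev_dif_vertical qint_values ev_hom ev_qs)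
  have "sc q (- z - y) \<otimes>\<^bsub>SL2 q\<^esub> ev q x
      = \<ominus>\<^bsub>SL2 q\<^esub> (sc q z \<otimes>\<^bsub>SL2 q\<^esub> ev q x) \<oplus>\<^bsub>SL2 q\<^esub> \<ominus>\<^bsub>SL2 q\<^esub> (sc q y \<otimes>\<^bsub>SL2 q\<^esub> ev q x)"
    if "q \<noteq> 0" for q y z
  proof -
    interpret ring "SL2 q" by (rule ring_SL2)
    show ?thesis
      using that sc_add[of q "- z" "- y"] by (simp add: sc_uminus l_distr l_minus ev_closed sc_closed)
  qed
  then show "homog (-2) x \<Longrightarrow> dif E0 x = - qs (-2) x - qs (-4) x"
    by (intro qsl_eqI) (simp add: ev_dif_vertical qint_values ev_hom ev_qs)
qed

text \<open>This is the coefficient of e+ e- in the identity d d x = 0.\<close>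

lemma dif_dif: "dif Ep (dif Em x) = qs 2 (dif Em (dif Ep x)) - qs 3 (dif E0 x)"
proof (rule qsl_eqI)
  fix q :: complex assume q: "q \<noteq> 0"
  \<comment> \<open>The induction is over words while the statement lives in \<open>qsl\<close>.
    Families represented by one free element at all parameters connect the two: at the given q every
    element is the value of such a family.\<close>
  define cst where "cst f = fam (\<lambda>p. cls p f)" for f
  have ev_cst: "ev p (cst f) = cls p f" if "p \<noteq> 0" for p f
    unfolding cst_def by (rule ev_fam) (simp_all add: cls_closed that)
  have dif_cst: "dif i (cst (scalar_free z)) = 0" for i z
    by (rule qsl_eqI) (simp add: ev_dif ev_cst ev_hom d0_cls der_scalar cls_zero)
  have cst_add: "cst (f + g) = cst f + cst g" for f g
    by (rule qsl_eqI) (simp add: ev_cst ev_hom cls_hom)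
  have cst_gen: "cst (gen_free GenA * f) = gA * cst f" "cst (gen_free GenB * f) = gB * cst f"
    "cst (gen_free GenC * f) = gC * cst f" "cst (gen_free GenD * f) = gD * cst f" for f
    by (rule qsl_eqI, simp add: ev_cst ev_hom ev_gen gn_def cls_hom)+
  have *: "dif Ep (dif Em (cst f)) = qs 2 (dif Em (dif Ep (cst f))) - qs 3 (dif E0 (cst f))" for f
  proof (induction f rule: free_alg_induct)
    case (gen g f)
    \<comment> \<open>The Leibniz expansion leaves the second derivatives of f behind a generator,
      so the hypothesis is supplied already multiplied from the left.\<close>
    then have "h * dif Ep (dif Em (cst f)) = h * (qs 2 (dif Em (dif Ep (cst f))) - qs 3 (dif E0 (cst f)))" for h
      by (simp only:)
    from this[of gA] this[of gB] this[of gC] this[of gD] show ?case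
      by (cases g) (simp_all add: cst_gen sg_sg dif_sg algebra_simps)
  qed (simp_all add: dif_cst cst_add algebra_simps)
  obtain f where "ev q x = ev q (cst f)" using q ev_cst by (metis ev_cases)
  then show "ev q (dif Ep (dif Em x)) = ev q (qs 2 (dif Em (dif Ep x)) - qs 3 (dif E0 x))"
    using arg_cong[OF *[of f], of "ev q"] q by (simp add: ev_hom ev_qs ev_dif)
qed

section \<open>Tensor products over a noncommutative ring\<close>

locale bimod = R: ring R + M: abelian_group M
  for R :: "('s, 'x) ring_scheme" (structure) and M :: "('s, 'm, 'y) bimodule_scheme" (structure) +
  assumes smult_closed: "s \<in> carrier R \<Longrightarrow> x \<in> carrier M \<Longrightarrow> s \<odot>\<^bsub>M\<^esub> x \<in> carrier M"
    and rsmult_closed: "x \<in> carrier M \<Longrightarrow> s \<in> carrier R \<Longrightarrow> x \<odot>r\<^bsub>M\<^esub> s \<in> carrier M"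
    and smult_add: "s \<in> carrier R \<Longrightarrow> x \<in> carrier M \<Longrightarrow> y \<in> carrier M \<Longrightarrow>
      s \<odot>\<^bsub>M\<^esub> (x \<oplus>\<^bsub>M\<^esub> y) = s \<odot>\<^bsub>M\<^esub> x \<oplus>\<^bsub>M\<^esub> s \<odot>\<^bsub>M\<^esub> y"
    and add_smult: "s \<in> carrier R \<Longrightarrow> r \<in> carrier R \<Longrightarrow> x \<in> carrier M \<Longrightarrow>
      (s \<oplus>\<^bsub>R\<^esub> r) \<odot>\<^bsub>M\<^esub> x = s \<odot>\<^bsub>M\<^esub> x \<oplus>\<^bsub>M\<^esub> r \<odot>\<^bsub>M\<^esub> x"
    and mult_smult: "s \<in> carrier R \<Longrightarrow> r \<in> carrier R \<Longrightarrow> x \<in> carrier M \<Longrightarrow>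
      (s \<otimes>\<^bsub>R\<^esub> r) \<odot>\<^bsub>M\<^esub> x = s \<odot>\<^bsub>M\<^esub> (r \<odot>\<^bsub>M\<^esub> x)"
    and one_smult: "x \<in> carrier M \<Longrightarrow> \<one>\<^bsub>R\<^esub> \<odot>\<^bsub>M\<^esub> x = x"
    and smult_rsmult: "s \<in> carrier R \<Longrightarrow> r \<in> carrier R \<Longrightarrow> x \<in> carrier M \<Longrightarrow>
      (s \<odot>\<^bsub>M\<^esub> x) \<odot>r\<^bsub>M\<^esub> r = s \<odot>\<^bsub>M\<^esub> (x \<odot>r\<^bsub>M\<^esub> r)"

definition balanced_map where
  "balanced_map R M N G \<phi> \<longleftrightarrow>
    (\<forall>x\<in>carrier M. \<forall>y\<in>carrier N. \<phi> x y \<in> carrier G) \<and>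
    (\<forall>x\<in>carrier M. \<forall>x'\<in>carrier M. \<forall>y\<in>carrier N. \<phi> (x \<oplus>\<^bsub>M\<^esub> x') y = \<phi> x y \<oplus>\<^bsub>G\<^esub> \<phi> x' y) \<and>
    (\<forall>x\<in>carrier M. \<forall>y\<in>carrier N. \<forall>y'\<in>carrier N. \<phi> x (y \<oplus>\<^bsub>N\<^esub> y') = \<phi> x y \<oplus>\<^bsub>G\<^esub> \<phi> x y') \<and>
    (\<forall>x\<in>carrier M. \<forall>s\<in>carrier R. \<forall>y\<in>carrier N. \<phi> (x \<odot>r\<^bsub>M\<^esub> s) y = \<phi> x (s \<odot>\<^bsub>N\<^esub> y))"

lemma balanced_mapI:
  assumes "\<And>x y. x \<in> carrier M \<Longrightarrow> y \<in> carrier N \<Longrightarrow> \<phi> x y \<in> carrier G"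
    and "\<And>x x' y. x \<in> carrier M \<Longrightarrow> x' \<in> carrier M \<Longrightarrow> y \<in> carrier N \<Longrightarrow>
      \<phi> (x \<oplus>\<^bsub>M\<^esub> x') y = \<phi> x y \<oplus>\<^bsub>G\<^esub> \<phi> x' y"
    and "\<And>x y y'. x \<in> carrier M \<Longrightarrow> y \<in> carrier N \<Longrightarrow> y' \<in> carrier N \<Longrightarrow>
      \<phi> x (y \<oplus>\<^bsub>N\<^esub> y') = \<phi> x y \<oplus>\<^bsub>G\<^esub> \<phi> x y'"
    and "\<And>x s y. x \<in> carrier M \<Longrightarrow> s \<in> carrier R \<Longrightarrow> y \<in> carrier N \<Longrightarrow>
      \<phi> (x \<odot>r\<^bsub>M\<^esub> s) y = \<phi> x (s \<odot>\<^bsub>N\<^esub> y)"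
  shows "balanced_map R M N G \<phi>"
  using assms by (auto simp: balanced_map_def)

text \<open>The quotient group and the additive group of the tensor record share carrier, operation
  and unit but are different records; the axioms have to be carried across.\<close>

lemma comm_group_transfer:
  fixes G :: "('a, 'b) monoid_scheme" and K :: "('a, 'c) monoid_scheme"
  assumes "comm_group G" "carrier K = carrier G" "monoid.mult K = monoid.mult G" "one K = one G"
  shows "comm_group K"
proof -
  interpret G: comm_group G by fact
  show ?thesis
    by (rule comm_groupI) (simp_all add: assms(2-4) G.m_assoc G.l_inv_ex, simp add: G.m_comm)
qed

locale bimod_tensor = M: bimod R M + N: bimod R N
  for R :: "('s, 'x) ring_scheme" and M :: "('s, 'm, 'y) bimodule_scheme"
    and N :: "('s, 'n, 'z) bimodule_scheme"
begin

abbreviation "F \<equiv> free_Abelian_group (carrier M \<times> carrier N)"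
abbreviation "H \<equiv> tensor_null R M N"
abbreviation "T \<equiv> tensor R M N"
abbreviation "coset c \<equiv> H #>\<^bsub>F\<^esub> c"

sublocale F: comm_group F by (rule abelian_free_Abelian_group)

declare carrier_free_Abelian_group_iff [simp del]

lemma F_closed:
  shows F_zero: "0 \<in> carrier F"
    and F_add: "c \<in> carrier F \<Longrightarrow> c' \<in> carrier F \<Longrightarrow> c + c' \<in> carrier F"
    and F_uminus: "c \<in> carrier F \<Longrightarrow> - c \<in> carrier F"
    and F_diff: "c \<in> carrier F \<Longrightarrow> c' \<in> carrier F \<Longrightarrow> c - c' \<in> carrier F"
    and F_cmul: "c \<in> carrier F \<Longrightarrow> frag_cmul n c \<in> carrier F"
  using keys_add[of c c'] keys_diff[of c c'] keys_cmul[of n c]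
  by (auto simp: carrier_free_Abelian_group_iff keys_minus)

lemma rels_subset: "tensor_rels R M N \<subseteq> carrier F"
  unfolding tensor_rels_def
  by (auto simp: N.smult_closed M.rsmult_closed intro!: F_diff)

lemma H_subgroup: "subgroup H F"
  unfolding tensor_null_def by (rule F.generate_is_subgroup[OF rels_subset])

sublocale H: normal H F
  using F.normal_iff_subgroup H_subgroup by blast

lemma rel_in_H: "r \<in> tensor_rels R M N \<Longrightarrow> r \<in> H"
  unfolding tensor_null_def by (rule generate.incl)

sublocale T: abelian_group T
  by (rule comm_group_abelian_groupI, rule comm_group_transfer[OF F.abelian_FactGroup[OF H_subgroup]])
    (simp_all add: tensor_def tensor_group_def Let_def)

lemma abelian_group_tensor_group: "abelian_group (tensor_group R M N)"
  by (rule comm_group_abelian_groupI, rule comm_group_transfer[OF F.abelian_FactGroup[OF H_subgroup]])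
    (simp_all add: tensor_group_def Let_def)

lemma tensor_simps:
  "carrier T = rcosets\<^bsub>F\<^esub> H" "zero T = H" "add T = set_mult F"
  "carrier (tensor_group R M N) = carrier T" "zero (tensor_group R M N) = zero T"
  "add (tensor_group R M N) = add T"
  by (simp_all add: tensor_def tensor_group_def Let_def FactGroup_def)

lemma coset_closed: "c \<in> carrier F \<Longrightarrow> coset c \<in> carrier T"
  by (auto simp: tensor_simps RCOSETS_def)

lemma coset_add: "c \<in> carrier F \<Longrightarrow> c' \<in> carrier F \<Longrightarrow> coset (c + c') = coset c \<oplus>\<^bsub>T\<^esub> coset c'"
  by (simp add: tensor_simps H.rcos_sum)

lemma coset_eqI:
  assumes "c \<in> carrier F" "c' \<in> carrier F" "c - c' \<in> H"
  shows "coset c = coset c'"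
proof -
  have "c \<in> coset c'"
    using assms(3) by (force simp: r_coset_def)
  then show ?thesis
    using F.repr_independence[OF _ assms(2) H_subgroup] by simp
qed

lemma coset_zero: "coset 0 = \<zero>\<^bsub>T\<^esub>"
  using F.coset_mult_one[OF H.subset] by (simp add: tensor_simps)

lemma tens_eq: "tens R M N x y = coset (frag_of (x, y))"
  by (simp add: tens_def)

lemma tens_closed: "x \<in> carrier M \<Longrightarrow> y \<in> carrier N \<Longrightarrow> tens R M N x y \<in> carrier T"
  by (simp add: tens_eq coset_closed)

lemma tens_add_left:
  assumes "x \<in> carrier M" "x' \<in> carrier M" "y \<in> carrier N"
  shows "tens R M N (x \<oplus>\<^bsub>M\<^esub> x') y = tens R M N x y \<oplus>\<^bsub>T\<^esub> tens R M N x' y"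
proof -
  have "frag_of (x \<oplus>\<^bsub>M\<^esub> x', y) - (frag_of (x, y) + frag_of (x', y)) \<in> H"
    unfolding diff_diff_eq[symmetric] using assms by (intro rel_in_H) (auto simp: tensor_rels_def)
  then show ?thesis
    using assms unfolding tens_eq by (subst coset_add[symmetric]) (simp_all add: coset_eqI F_add)
qed

lemma tens_add_right:
  assumes "x \<in> carrier M" "y \<in> carrier N" "y' \<in> carrier N"
  shows "tens R M N x (y \<oplus>\<^bsub>N\<^esub> y') = tens R M N x y \<oplus>\<^bsub>T\<^esub> tens R M N x y'"
proof -
  have "frag_of (x, y \<oplus>\<^bsub>N\<^esub> y') - (frag_of (x, y) + frag_of (x, y')) \<in> H"
    unfolding diff_diff_eq[symmetric] using assms by (intro rel_in_H) (auto simp: tensor_rels_def)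
  then show ?thesis
    using assms unfolding tens_eq by (subst coset_add[symmetric]) (simp_all add: coset_eqI F_add)
qed

lemma tens_balanced:
  assumes "x \<in> carrier M" "s \<in> carrier R" "y \<in> carrier N"
  shows "tens R M N (x \<odot>r\<^bsub>M\<^esub> s) y = tens R M N x (s \<odot>\<^bsub>N\<^esub> y)"
proof -
  have "frag_of (x \<odot>r\<^bsub>M\<^esub> s, y) - frag_of (x, s \<odot>\<^bsub>N\<^esub> y) \<in> H"
    using assms by (intro rel_in_H) (auto simp: tensor_rels_def)
  then show ?thesis
    using assms unfolding tens_eq by (simp add: coset_eqI M.rsmult_closed N.smult_closed)
qed

lemma tens_zero_left: "y \<in> carrier N \<Longrightarrow> tens R M N \<zero>\<^bsub>M\<^esub> y = \<zero>\<^bsub>T\<^esub>"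
  using tens_add_left[of "\<zero>\<^bsub>M\<^esub>" "\<zero>\<^bsub>M\<^esub>" y] tens_closed[of "\<zero>\<^bsub>M\<^esub>" y] by simp

lemma tens_zero_right: "x \<in> carrier M \<Longrightarrow> tens R M N x \<zero>\<^bsub>N\<^esub> = \<zero>\<^bsub>T\<^esub>"
  using tens_add_right[of x "\<zero>\<^bsub>N\<^esub>" "\<zero>\<^bsub>N\<^esub>"] tens_closed[of x "\<zero>\<^bsub>N\<^esub>"] by simp

text \<open>Negation can be absorbed into the first factor, so sums of pure tensors already exhaust
  the tensor product.\<close>

lemma tensor_induct [consumes 1, case_names tens add]:
  assumes t: "t \<in> carrier T"
    and tens: "\<And>x y. x \<in> carrier M \<Longrightarrow> y \<in> carrier N \<Longrightarrow> P (tens R M N x y)"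
    and add: "\<And>t u. t \<in> carrier T \<Longrightarrow> u \<in> carrier T \<Longrightarrow> P t \<Longrightarrow> P u \<Longrightarrow> P (t \<oplus>\<^bsub>T\<^esub> u)"
  shows "P t"
proof -
  have minus: "coset (- frag_of (x, y)) = tens R M N (\<ominus>\<^bsub>M\<^esub> x) y"
    if "x \<in> carrier M" "y \<in> carrier N" for x y
  proof -
    have "\<zero>\<^bsub>T\<^esub> = tens R M N (\<ominus>\<^bsub>M\<^esub> x) y \<oplus>\<^bsub>T\<^esub> tens R M N x y"
      using tens_add_left[of "\<ominus>\<^bsub>M\<^esub> x" x y] that by (simp add: M.M.l_neg tens_zero_left)
    moreover have "\<zero>\<^bsub>T\<^esub> = coset (- frag_of (x, y)) \<oplus>\<^bsub>T\<^esub> tens R M N x y"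
      using coset_add[of "- frag_of (x, y)" "frag_of (x, y)"] that coset_zero
      by (simp add: tens_eq F_uminus)
    ultimately have "coset (- frag_of (x, y)) \<oplus>\<^bsub>T\<^esub> tens R M N x y = tens R M N (\<ominus>\<^bsub>M\<^esub> x) y \<oplus>\<^bsub>T\<^esub> tens R M N x y"
      by simp
    then show ?thesis
      using that by (simp add: coset_closed tens_closed F_uminus)
  qed
  \<comment> \<open>Induction in the free abelian group proceeds by differences, so the property is
    carried for c and -c together.\<close>
  have "P (coset c) \<and> P (coset (- c)) \<and> c \<in> carrier F" if "Poly_Mapping.keys c \<subseteq> carrier M \<times> carrier N" for c
  proof (rule free_Abelian_group_induct[OF that, where P = "\<lambda>c. P (coset c) \<and> P (coset (- c)) \<and> c \<in> carrier F"], goal_cases)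
    case 1
    have "coset 0 = tens R M N \<zero>\<^bsub>M\<^esub> \<zero>\<^bsub>N\<^esub>"
      by (simp add: tens_zero_left coset_zero)
    then show ?case using tens[of "\<zero>\<^bsub>M\<^esub>" "\<zero>\<^bsub>N\<^esub>"] F_zero by simp
  next
    case (2 x y)
    then have "coset (x - y) = coset x \<oplus>\<^bsub>T\<^esub> coset (- y)" "coset (- (x - y)) = coset y \<oplus>\<^bsub>T\<^esub> coset (- x)"
      using coset_add[of x "- y"] coset_add[of y "- x"] by (auto simp: F_uminus)
    then show ?case using 2 by (auto intro!: add coset_closed F_closed)
  next
    case (3 p)
    then show ?case
      using tens minus by (cases p) (auto simp: tens_eq[symmetric])
  qed
  moreover obtain c where "c \<in> carrier F" "t = coset c"
    using t by (auto simp: tensor_simps RCOSETS_def)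
  ultimately show ?thesis by (simp add: carrier_free_Abelian_group_iff)
qed

text \<open>The universal property of the free abelian group extends \<phi> to a homomorphism h.
  Balancedness puts the relations into its kernel, so the sum in \<open>tensor_lift\<close> has one
  value on the whole coset and the description denotes it.\<close>

lemma tensor_lift_coset:
  assumes "abelian_group G" and \<phi>: "balanced_map R M N G \<phi>"
  obtains h where "h \<in> hom F (add_monoid G)"
    "\<And>x y. x \<in> carrier M \<Longrightarrow> y \<in> carrier N \<Longrightarrow> h (frag_of (x, y)) = \<phi> x y"
    "\<And>c. c \<in> carrier F \<Longrightarrow> tensor_lift G \<phi> (coset c) = h c"
proof -
  interpret G: abelian_group G by fact
  have "(\<lambda>p. \<phi> (fst p) (snd p)) ` (carrier M \<times> carrier N) \<subseteq> carrier (add_monoid G)"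
    using \<phi> by (auto simp: balanced_map_def)
  then obtain h where h: "h \<in> hom F (add_monoid G)"
    and "\<And>p. p \<in> carrier M \<times> carrier N \<Longrightarrow> h (frag_of p) = \<phi> (fst p) (snd p)"
    by (rule comm_group.free_Abelian_group_universal[OF G.a_comm_group]) (rule that)
  then have h_frag: "h (frag_of (x, y)) = \<phi> x y" if "x \<in> carrier M" "y \<in> carrier N" for x y
    using that by force
  interpret h: group_hom F "add_monoid G" h
    using h by unfold_locales
  have h_closed: "h c \<in> carrier G" if "c \<in> carrier F" for c
    using h.hom_closed[OF that] by simp
  have h_add: "h (c + c') = h c \<oplus>\<^bsub>G\<^esub> h c'" if "c \<in> carrier F" "c' \<in> carrier F" for c c'
    using h.hom_mult[OF that] by simp
  have h_minus: "h (c - c') = \<zero>\<^bsub>G\<^esub>" if "c \<in> carrier F" "c' \<in> carrier F" "h c = h c'" for c c'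
  proof -
    have "c - c' \<in> carrier F" using that by (simp add: F_diff)
    with h_add[of "c - c'" c'] that h_closed[of c'] h_closed[of "c - c'"] show ?thesis
      by simp
  qed
  have "tensor_rels R M N \<subseteq> kernel F (add_monoid G) h"
  proof
    fix r assume r: "r \<in> tensor_rels R M N"
    then have "h r = \<zero>\<^bsub>G\<^esub>"
      using \<phi> unfolding tensor_rels_def diff_diff_eq
      by (elim UnE CollectE exE conjE; simp; intro h_minus)
        (auto simp: h_add h_frag balanced_map_def M.rsmult_closed N.smult_closed intro!: F_add)
    then show "r \<in> kernel F (add_monoid G) h"
      using r rels_subset by (auto simp: kernel_def)
  qed
  then have H: "H \<subseteq> kernel F (add_monoid G) h"
    unfolding tensor_null_def by (rule F.generate_subgroup_incl[OF _ h.subgroup_kernel])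
  have sum: "h (\<Sum>p\<in>K. frag_cmul (n p) (frag_of p)) = (\<Oplus>\<^bsub>G\<^esub>p\<in>K. [n p] \<cdot>\<^bsub>G\<^esub> \<phi> (fst p) (snd p))
      \<and> (\<Sum>p\<in>K. frag_cmul (n p) (frag_of p)) \<in> carrier F"
    if "finite K" "K \<subseteq> carrier M \<times> carrier N" for K n
    using that
  proof (induction K rule: finite_induct)
    case empty
    then show ?case using h.hom_one F_zero by simp
  next
    case (insert p K)
    then have p: "frag_of p \<in> carrier F" by simp
    have "h (frag_cmul (n p) (frag_of p)) = [n p] \<cdot>\<^bsub>G\<^esub> h (frag_of p)"
      using h.hom_int_pow[OF p, of "n p"] insert by (simp add: add_pow_def)
    moreover have "frag_cmul (n p) (frag_of p) \<in> carrier F"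
      using p by (rule F_cmul)
    moreover have "\<phi> (fst p') (snd p') \<in> carrier G" if "p' \<in> insert p K" for p'
      using that insert \<phi> by (auto simp: balanced_map_def)
    ultimately show ?case
      using insert h_frag[of "fst p" "snd p"]
      by (auto simp: h_add Pi_def G.finsum_insert intro: F_add)
  qed
  have h_value: "h c = (\<Oplus>\<^bsub>G\<^esub>p\<in>Poly_Mapping.keys c. [Poly_Mapping.lookup c p] \<cdot>\<^bsub>G\<^esub> \<phi> (fst p) (snd p))"
    if "c \<in> carrier F" for c
  proof -
    have "c = (\<Sum>p\<in>Poly_Mapping.keys c. frag_cmul (Poly_Mapping.lookup c p) (frag_of p))"
      by (rule poly_mapping_eqI) (simp add: lookup_sum lookup_single when_def in_keys_iff if_distrib[of "(*) _"] cong: if_cong)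
    then show ?thesis
      using sum[of "Poly_Mapping.keys c" "Poly_Mapping.lookup c"] that
      by (simp add: carrier_free_Abelian_group_iff)
  qed
  have "tensor_lift G \<phi> (coset c) = h c" if c: "c \<in> carrier F" for c
  proof -
    have "h c' = h c \<and> c' \<in> carrier F" if "c' \<in> coset c" for c'
    proof -
      from that obtain k where "k \<in> H" "c' = k + c" by (auto simp: r_coset_def)
      then show ?thesis
        using H c h_add[of k c] h_closed[OF c] F_add[of k c] by (auto simp: kernel_def)
    qed
    then have "h c = (\<Oplus>\<^bsub>G\<^esub>p\<in>Poly_Mapping.keys c'. [Poly_Mapping.lookup c' p] \<cdot>\<^bsub>G\<^esub> \<phi> (fst p) (snd p))"
      if "c' \<in> coset c" for c'
      using that h_value[of c'] by simp
    moreover have "c \<in> coset c"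
      using F.rcos_self[OF c H_subgroup] .
    ultimately show ?thesis
      unfolding tensor_lift_def by (intro the_equality) auto
  qed
  with h h_frag show ?thesis by (rule that)
qed

lemma
  assumes "abelian_group G" "balanced_map R M N G \<phi>"
  shows tensor_lift_tens: "x \<in> carrier M \<Longrightarrow> y \<in> carrier N \<Longrightarrow> tensor_lift G \<phi> (tens R M N x y) = \<phi> x y"
    and tensor_lift_add: "t \<in> carrier T \<Longrightarrow> u \<in> carrier T \<Longrightarrow>
      tensor_lift G \<phi> (t \<oplus>\<^bsub>T\<^esub> u) = tensor_lift G \<phi> t \<oplus>\<^bsub>G\<^esub> tensor_lift G \<phi> u"
    and tensor_lift_closed: "t \<in> carrier T \<Longrightarrow> tensor_lift G \<phi> t \<in> carrier G"
proof -
  obtain h where h: "h \<in> hom F (add_monoid G)"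
    "\<And>x y. x \<in> carrier M \<Longrightarrow> y \<in> carrier N \<Longrightarrow> h (frag_of (x, y)) = \<phi> x y"
    "\<And>c. c \<in> carrier F \<Longrightarrow> tensor_lift G \<phi> (coset c) = h c"
    using tensor_lift_coset[OF assms] by blast
  have h': "h c \<in> carrier G" "c' \<in> carrier F \<Longrightarrow> h (c + c') = h c \<oplus>\<^bsub>G\<^esub> h c'" if "c \<in> carrier F" for c c'
    using h(1) that by (auto simp: hom_def)
  have T: "\<exists>c\<in>carrier F. t = coset c" if "t \<in> carrier T" for t
    using that by (auto simp: tensor_simps RCOSETS_def)
  show "x \<in> carrier M \<Longrightarrow> y \<in> carrier N \<Longrightarrow> tensor_lift G \<phi> (tens R M N x y) = \<phi> x y"
    by (simp add: tens_eq h)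
  show "t \<in> carrier T \<Longrightarrow> tensor_lift G \<phi> t \<in> carrier G"
    using T[of t] h(3) h'(1) by auto
  show "tensor_lift G \<phi> (t \<oplus>\<^bsub>T\<^esub> u) = tensor_lift G \<phi> t \<oplus>\<^bsub>G\<^esub> tensor_lift G \<phi> u"
    if tu: "t \<in> carrier T" "u \<in> carrier T"
  proof -
    obtain c c' where c: "c \<in> carrier F" "t = coset c" "c' \<in> carrier F" "u = coset c'"
      using T[OF tu(1)] T[OF tu(2)] by blast
    then show ?thesis
      using coset_add[of c c'] F_add[of c c'] h'(2)[of c c'] h(3)[of c] h(3)[of c'] h(3)[of "c + c'"]
      by simp
  qed
qed

text \<open>The left action is defined by lifting into \<open>tensor_group\<close>, the bare
  additive group, since the full record is the one under construction. The balancing axiom holds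
  because the left and right actions on \<open>M\<close> commute.\<close>

lemma smult_balanced:
  assumes "s \<in> carrier R"
  shows "balanced_map R M N (tensor_group R M N) (\<lambda>x y. tens R M N (s \<odot>\<^bsub>M\<^esub> x) y)"
  using assms
  by (intro balanced_mapI)
    (simp_all add: tensor_simps(4-6) tens_closed M.smult_closed M.smult_add tens_add_left tens_add_right
      M.rsmult_closed tens_balanced M.smult_rsmult[symmetric])

lemma tensor_smult: "s \<odot>\<^bsub>T\<^esub> t = tensor_lift (tensor_group R M N) (\<lambda>x y. tens R M N (s \<odot>\<^bsub>M\<^esub> x) y) t"
  by (simp add: tensor_def Let_def)

lemma smult_tens:
  "s \<in> carrier R \<Longrightarrow> x \<in> carrier M \<Longrightarrow> y \<in> carrier N \<Longrightarrow> s \<odot>\<^bsub>T\<^esub> tens R M N x y = tens R M N (s \<odot>\<^bsub>M\<^esub> x) y"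
  by (simp add: tensor_smult tensor_lift_tens[OF abelian_group_tensor_group smult_balanced])

lemma T_smult_closed: "s \<in> carrier R \<Longrightarrow> t \<in> carrier T \<Longrightarrow> s \<odot>\<^bsub>T\<^esub> t \<in> carrier T"
  using tensor_lift_closed[OF abelian_group_tensor_group smult_balanced, of s t]
  by (simp add: tensor_smult tensor_simps(4-6))

lemma T_smult_add: "s \<in> carrier R \<Longrightarrow> t \<in> carrier T \<Longrightarrow> u \<in> carrier T \<Longrightarrow>
    s \<odot>\<^bsub>T\<^esub> (t \<oplus>\<^bsub>T\<^esub> u) = s \<odot>\<^bsub>T\<^esub> t \<oplus>\<^bsub>T\<^esub> s \<odot>\<^bsub>T\<^esub> u"
  using tensor_lift_add[OF abelian_group_tensor_group smult_balanced, of s t u]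
  by (simp add: tensor_smult tensor_simps(4-6))

lemma T_add_smult:
  assumes "s \<in> carrier R" "r \<in> carrier R" "t \<in> carrier T"
  shows "(s \<oplus>\<^bsub>R\<^esub> r) \<odot>\<^bsub>T\<^esub> t = s \<odot>\<^bsub>T\<^esub> t \<oplus>\<^bsub>T\<^esub> r \<odot>\<^bsub>T\<^esub> t"
  using assms(3)
proof (induction t rule: tensor_induct)
  case (tens x y)
  then show ?case using assms(1,2) by (simp add: smult_tens M.add_smult tens_add_left M.smult_closed)
next
  case (add t u)
  then show ?case using assms(1,2) by (simp add: T_smult_add T_smult_closed T.a_ac)
qed

lemma T_mult_smult:
  assumes "s \<in> carrier R" "r \<in> carrier R" "t \<in> carrier T"
  shows "(s \<otimes>\<^bsub>R\<^esub> r) \<odot>\<^bsub>T\<^esub> t = s \<odot>\<^bsub>T\<^esub> (r \<odot>\<^bsub>T\<^esub> t)"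
  using assms(3)
proof (induction t rule: tensor_induct)
  case (tens x y)
  then show ?case using assms(1,2) by (simp add: smult_tens M.mult_smult M.smult_closed)
next
  case (add t u)
  then show ?case using assms(1,2) by (simp add: T_smult_add T_smult_closed)
qed

lemma T_one_smult: "t \<in> carrier T \<Longrightarrow> \<one>\<^bsub>R\<^esub> \<odot>\<^bsub>T\<^esub> t = t"
proof (induction t rule: tensor_induct)
  case (tens x y)
  then show ?case by (simp add: smult_tens M.one_smult)
next
  case (add t u)
  then show ?case by (simp add: T_smult_add)
qed

lemma T_zero_smult: "t \<in> carrier T \<Longrightarrow> \<zero>\<^bsub>R\<^esub> \<odot>\<^bsub>T\<^esub> t = \<zero>\<^bsub>T\<^esub>"
  using T_add_smult[of "\<zero>\<^bsub>R\<^esub>" "\<zero>\<^bsub>R\<^esub>" t] T_smult_closed[of "\<zero>\<^bsub>R\<^esub>" t] by simp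

text \<open>The action of s on the target is kept abstract as an additive map f, which serves
  2-forms and tensors alike.\<close>

lemma tensor_lift_smult:
  assumes "abelian_group G" "balanced_map R M N G \<phi>" "s \<in> carrier R" "t \<in> carrier T"
    and "\<And>x y. x \<in> carrier M \<Longrightarrow> y \<in> carrier N \<Longrightarrow> \<phi> (s \<odot>\<^bsub>M\<^esub> x) y = f (\<phi> x y)"
    and "\<And>u v. u \<in> carrier G \<Longrightarrow> v \<in> carrier G \<Longrightarrow> f (u \<oplus>\<^bsub>G\<^esub> v) = f u \<oplus>\<^bsub>G\<^esub> f v"
  shows "tensor_lift G \<phi> (s \<odot>\<^bsub>T\<^esub> t) = f (tensor_lift G \<phi> t)"
  using assms(4)
proof (induction t rule: tensor_induct)
  case (tens x y)
  then show ?case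
    using assms by (simp add: smult_tens tensor_lift_tens M.smult_closed)
next
  case (add t u)
  then show ?case
    using assms by (simp add: T_smult_add T_smult_closed tensor_lift_add tensor_lift_closed)
qed

end

section \<open>Forms on the quantum sphere\<close>

text \<open>The e0 coefficient is fixed to zero because functions of degree 0 have no derivative
  along e0.\<close>

definition frm :: "complex \<Rightarrow> qsl \<Rightarrow> qsl \<Rightarrow> form1" where
  "frm q x y = form1_of (ev q x) (ev q y) \<zero>\<^bsub>SL2 q\<^esub>"

definition ups :: "complex \<Rightarrow> qsl \<Rightarrow> form2" where
  "ups q z = form2_of (ev q z) \<zero>\<^bsub>SL2 q\<^esub> \<zero>\<^bsub>SL2 q\<^esub>"

text \<open>Multiplication by [2]_q, expressed through powers of the parameter so that normal form
  rewriting applies.\<close>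

definition tw :: "qsl \<Rightarrow> qsl" where
  "tw x = qs 1 x + qs (-1) x"

text \<open>
  The components of d b+, d b-, d b0 in degrees -2 and 2, and cofactors expressing 1 as a
  combination of either triple; the latter are read off the two halves of the metric.
\<close>

definition bp :: "nat \<Rightarrow> qsl" where "bp k = [gD * gD, gB * gB, qs 1 (gB * gD)] ! k"
definition bm :: "nat \<Rightarrow> qsl" where "bm k = [gC * gC, gA * gA, qs 1 (gA * gC)] ! k"
definition cp :: "nat \<Rightarrow> qsl" where
  "cp k = [gA * gA, qs (-2) (gC * gC), - (gA * gC) - qs (-2) (gA * gC)] ! k"
definition cm :: "nat \<Rightarrow> qsl" where
  "cm k = [qs 2 (gB * gB), gD * gD, - qs 2 (gB * gD) - gB * gD] ! k"
definition bb :: "nat \<Rightarrow> qsl" where "bb k = [gC * gD, gA * gB, gB * gC] ! k"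
definition beta :: "nat \<Rightarrow> qsl" where "beta k = [tw (gC * gD), tw (gA * gB), 1 + tw (gB * gC)] ! k"

lemmas triple_simps = bp_def bm_def cp_def cm_def bb_def beta_def tw_def
  nth_Cons_0 nth_Cons_Suc numeral_2_eq_2 One_nat_def

definition sum3 :: "(nat \<Rightarrow> 'a::ab_semigroup_add) \<Rightarrow> 'a" where
  "sum3 f = f 0 + f 1 + f 2"

lemma homog_triples:
  assumes "k < 3"
  shows "homog (-2) (bp k)" "homog 2 (bm k)" "homog 2 (cp k)" "homog (-2) (cm k)"
    "homog 0 (bb k)" "homog 0 (beta k)"
proof -
  have "homog (-2) (gD * gD)" "homog (-2) (gB * gB)" "homog (-2) (gB * gD)"
    "homog 2 (gC * gC)" "homog 2 (gA * gA)" "homog 2 (gA * gC)"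
    "homog 0 (gC * gD)" "homog 0 (gA * gB)" "homog 0 (gB * gC)"
    by (rule homog_mult[OF homog_gen(4,4)] homog_mult[OF homog_gen(2,2)] homog_mult[OF homog_gen(2,4)]
      homog_mult[OF homog_gen(3,3)] homog_mult[OF homog_gen(1,1)] homog_mult[OF homog_gen(1,3)]
      homog_mult[OF homog_gen(3,4)] homog_mult[OF homog_gen(1,2)] homog_mult[OF homog_gen(2,3)]; simp)+
  note * = this
  from assms have "k = 0 \<or> k = 1 \<or> k = 2" by auto
  then show "homog (-2) (bp k)" "homog 2 (bm k)" "homog 2 (cp k)" "homog (-2) (cm k)"
    "homog 0 (bb k)" "homog 0 (beta k)"
    by (elim disjE; simp only: triple_simps;
      intro homog_add homog_minus homog_uminus homog_qs homog_one *)+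
qed

lemma dif_bb:
  assumes "k < 3"
  shows "dif Ep (bb k) = bp k" "dif Em (bb k) = bm k" "dif E0 (bb k) = 0"
proof -
  from assms have "k = 0 \<or> k = 1 \<or> k = 2" by auto
  then show "dif Ep (bb k) = bp k" "dif Em (bb k) = bm k" "dif E0 (bb k) = 0"
    by (elim disjE; simp add: triple_simps nf)+
qed

text \<open>At q = 1 the first four sums are squares of 2 by 2 determinants: ad - bc = 1 for
  matching triples, a determinant with a repeated column for the mixed ones. The last two are
  derivatives of the first two, since \<open>dif Em\<close> kills \<open>cp\<close>,
  \<open>dif Ep\<close> kills \<open>cm\<close>, and \<open>beta k\<close> is
  \<open>dif Em (bp k)\<close> and q^(-2) times \<open>dif Ep (bm k)\<close>.\<close>

lemma triple_identities:
  "sum3 (\<lambda>k. cp k * bp k) = 1" "sum3 (\<lambda>k. cm k * bm k) = 1"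
  "sum3 (\<lambda>k. cp k * bm k) = 0" "sum3 (\<lambda>k. cm k * bp k) = 0"
  "sum3 (\<lambda>k. cp k * beta k) = 0" "sum3 (\<lambda>k. cm k * beta k) = 0"
  by (simp_all add: sum3_def triple_simps nf algebra_simps)

text \<open>The twist scales \<open>cm k\<close> by q^(-2) and \<open>cp k\<close> by q^2, and the
  partitions of unity then leave the right-hand sides. The other Leibniz term, a derivative of the
  cofactors paired with \<open>bm k\<close> or \<open>bp k\<close>, sums to zero: in each direction
  one of the two triples has derivative zero, and the sum of the products is the constant 1.\<close>

lemma connection_identities:
  "sum3 (\<lambda>k. dif i (y * cm k) * bm k) = qs (-2) (dif i y)"
  "sum3 (\<lambda>k. dif i (x * cp k) * bp k) = qs 2 (dif i x)"
  if "i \<noteq> E0"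
  using that
  by (cases i; simp add: sum3_def triple_simps nf algebra_simps)+

text \<open>Here \<open>dif Em (bm k)\<close> and \<open>dif Ep (bp k)\<close> vanish, and the other
  derivatives of the components are q^2 \<open>beta k\<close> and \<open>beta k\<close>. As the
  cofactors annihilate \<open>beta\<close>, a derivative moves from them to \<open>beta\<close> with
  a change of sign and gives [2] times \<open>bm k\<close> or \<open>bp k\<close>, which pair to 1.
  The prefactors -q^(-2) q^2 and q^4 account for [2] against -q^4 [2].\<close>

lemma curvature_identities:
  "sum3 (\<lambda>k. dif Ep (y * cm k) * dif Em (bm k) - qs (-2) (dif Em (y * cm k) * dif Ep (bm k))) = tw y"
  "sum3 (\<lambda>k. qs 4 (dif Ep (x * cp k) * dif Em (bp k)) - qs 2 (dif Em (x * cp k) * dif Ep (bp k))) = - qs 4 (tw x)"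
  by (simp_all add: sum3_def triple_simps nf algebra_simps)

text \<open>Zero is homogeneous of every degree, so extending f by zero at the other parameters
  keeps homogeneity. Statements at a single q are thereby reached from the family ring.\<close>

lemma SL2_deg_lift:
  assumes "f \<in> SL2_deg q n" and q: "q \<noteq> 0"
  obtains x where "homog n x" "ev q x = f"
proof
  define x where "x = fam (\<lambda>p. if p = q then f else cls p 0)"
  have ev: "ev p x = (if p = q then f else cls p 0)" if "p \<noteq> 0" for p
    unfolding x_def using assms(1) SL2_deg_subset that by (intro ev_fam) (auto simp: cls_closed)
  then show "ev q x = f" using q by simp
  show "homog n x"
    using assms(1) ev homog_free_closed(1) by (fastforce simp: homog_def SL2_deg_eq)
qed

section \<open>The sphere at a fixed parameter\<close>

locale sphere =
  fixes q :: complex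
  assumes q_nz: "q \<noteq> 0"
begin

sublocale A: ring "SL2 q" by (rule ring_SL2)

lemmas ev_simps = ev_zero[OF q_nz] ev_one[OF q_nz] ev_add[OF q_nz] ev_mult[OF q_nz]
  ev_uminus[OF q_nz] ev_minus[OF q_nz] ev_qs[OF q_nz]

lemmas ev_cl = ev_closed[OF q_nz]

lemma S2_simps:
  "carrier (S2 q) = SL2_deg q 0" "add (S2 q) = add (SL2 q)" "monoid.mult (S2 q) = monoid.mult (SL2 q)"
  "one (S2 q) = one (SL2 q)" "zero (S2 q) = zero (SL2 q)"
  by (simp_all add: S2_def)

lemma ev_deg: "homog n x \<Longrightarrow> ev q x \<in> SL2_deg q n"
  using q_nz by (simp add: homog_def)

lemma deg_cases:
  assumes "f \<in> SL2_deg q n"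
  obtains x where "homog n x" "f = ev q x"
  using assms q_nz by (metis SL2_deg_lift)

sublocale S: ring "S2 q"
proof -
  have "subring (SL2_deg q 0) (SL2 q)"
  proof (rule A.subringI)
    show "SL2_deg q 0 \<subseteq> carrier (SL2 q)" by (rule SL2_deg_subset)
    show "\<one>\<^bsub>SL2 q\<^esub> \<in> SL2_deg q 0" using ev_deg[OF homog_one] by (simp add: ev_simps)
    show "\<ominus>\<^bsub>SL2 q\<^esub> x \<in> SL2_deg q 0" if "x \<in> SL2_deg q 0" for x
      using that by (elim deg_cases) (auto simp flip: ev_simps intro!: ev_deg homog_uminus)
    show "x \<otimes>\<^bsub>SL2 q\<^esub> y \<in> SL2_deg q 0" if "x \<in> SL2_deg q 0" "y \<in> SL2_deg q 0" for x y
      using that by (elim deg_cases) (auto simp flip: ev_simps intro!: ev_deg homog_mult)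
    show "x \<oplus>\<^bsub>SL2 q\<^esub> y \<in> SL2_deg q 0" if "x \<in> SL2_deg q 0" "y \<in> SL2_deg q 0" for x y
      using that by (elim deg_cases) (auto simp flip: ev_simps intro!: ev_deg homog_add)
  qed
  then show "ring (S2 q)"
    unfolding S2_def by (rule A.subring_is_ring)
qed

lemma S2_cases:
  assumes "m \<in> carrier (S2 q)"
  obtains m' where "homog 0 m'" "m = ev q m'"
  using assms by (auto simp: S2_simps elim: deg_cases)

lemma ev_S2: "homog 0 m \<Longrightarrow> ev q m \<in> carrier (S2 q)"
  by (simp add: S2_simps ev_deg)

lemma sg_ev: "deg_scale q k (ev q x) = ev q (sg k x)"
  by (simp add: ev_sg q_nz)

lemma sc_ev: "sc q (q powi n) = ev q (qs n 1)"
  by (simp add: ev_simps sc_closed)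

lemma d0_ev: "homog 0 m \<Longrightarrow> d0 q (ev q m) = frm q (dif Ep m) (dif Em m)"
proof
  fix i assume "homog 0 m"
  then show "d0 q (ev q m) i = frm q (dif Ep m) (dif Em m) i"
    using dif_vertical(1)[of m]
    by (cases i) (simp_all add: frm_def form1_of_def ev_dif[OF q_nz, symmetric] ev_simps)
qed

section \<open>Operations on forms in coordinates\<close>

lemma Om1_ops:
  "add (Om1 q) = add (Om1_SL2 q)" "zero (Om1 q) = zero (Om1_SL2 q)"
  "module.smult (Om1 q) = module.smult (Om1_SL2 q)" "rsmult (Om1 q) = rsmult (Om1_SL2 q)"
  "carrier (Om1 q) = Om1_S2_set q"
  by (simp_all add: Om1_def)

lemma Om2_ops:
  "add (Om2 q) = add (Om2_SL2 q)" "zero (Om2 q) = zero (Om2_SL2 q)"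
  "module.smult (Om2 q) = module.smult (Om2_SL2 q)" "rsmult (Om2 q) = rsmult (Om2_SL2 q)"
  "carrier (Om2 q) = Om2_S2_set q"
  by (simp_all add: Om2_def)

lemma frm_ops:
  "frm q x y \<oplus>\<^bsub>Om1_SL2 q\<^esub> frm q x' y' = frm q (x + x') (y + y')"
  "ev q m \<odot>\<^bsub>Om1_SL2 q\<^esub> frm q x y = frm q (m * x) (m * y)"
  "\<zero>\<^bsub>Om1_SL2 q\<^esub> = frm q 0 0"
  by (rule ext, rename_tac i, case_tac i;
    simp add: Om1_SL2_def forms_simps frm_def form1_of_def ev_simps ev_cl)+

lemma frm_rsmult: "homog 0 m \<Longrightarrow> frm q x y \<odot>r\<^bsub>Om1_SL2 q\<^esub> ev q m = frm q (x * m) (y * m)"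
  by (rule ext, rename_tac i, case_tac i)
    (simp_all add: Om1_SL2_def forms_simps frm_def form1_of_def ev_simps ev_cl sg_ev sg_homog)

lemma ups_ops:
  "ups q z \<oplus>\<^bsub>Om2_SL2 q\<^esub> ups q z' = ups q (z + z')"
  "ev q m \<odot>\<^bsub>Om2_SL2 q\<^esub> ups q z = ups q (m * z)"
  "\<zero>\<^bsub>Om2_SL2 q\<^esub> = ups q 0"
  by (rule ext, rename_tac i, case_tac i;
    simp add: Om2_SL2_def forms_simps ups_def form2_of_def ev_simps ev_cl)+

lemma ups_rsmult: "homog 0 m \<Longrightarrow> ups q z \<odot>r\<^bsub>Om2_SL2 q\<^esub> ev q m = ups q (z * m)"
  by (rule ext, rename_tac i, case_tac i)
    (simp_all add: Om2_SL2_def forms_simps ups_def form2_of_def ev_simps ev_cl sg_ev sg_homog)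

lemma wedge_ev:
  "wedge q (form1_of (ev q x) (ev q y) (ev q z)) (form1_of (ev q x') (ev q y') (ev q z')) =
    form2_of (ev q (x * sg 1 y' - qs 2 (y * sg 1 x'))) (ev q (x * sg 1 z' - qs 4 (z * sg 2 x')))
      (ev q (y * sg 1 z' - qs (-4) (z * sg 2 y')))"
  by (simp add: wedge_def Let_def form1_of_def sg_ev ev_simps a_minus_def del: qs_simps)

lemma wedge_frm:
  "homog (-2) s \<Longrightarrow> homog 2 t \<Longrightarrow> homog (-2) x \<Longrightarrow> homog 2 y \<Longrightarrow>
    wedge q (frm q s t) (frm q x y) = ups q (qs 2 (s * y) - t * x)"
  using wedge_ev[of s t 0 x y 0] by (simp add: frm_def ups_def ev_simps(1) sg_homog)

lemma e1_ev: "e1 q Ep = form1_of (ev q 1) (ev q 0) (ev q 0)" "e1 q Em = form1_of (ev q 0) (ev q 1) (ev q 0)"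
  "e1 q E0 = form1_of (ev q 0) (ev q 0) (ev q 1)"
  by (rule ext, rename_tac i, case_tac i; simp add: e1_def form1_of_def ev_simps)+

lemma Ups_eq: "Ups q = ups q 1"
  unfolding Ups_def e1_ev wedge_ev by (simp add: ups_def ev_simps)

lemma d0_ev_general: "d0 q (ev q x) = form1_of (ev q (dif Ep x)) (ev q (dif Em x)) (ev q (dif E0 x))"
  by (rule ext, rename_tac i, case_tac i) (simp_all add: form1_of_def ev_dif q_nz)

lemma d_e_ev:
  "d_e q Ep = form2_of (ev q 0) (ev q (- qs 2 1 - 1)) (ev q 0)"
  "d_e q Em = form2_of (ev q 0) (ev q 0) (ev q (qs (-2) 1 + qs (-4) 1))"
  "d_e q E0 = form2_of (ev q (qs 3 1)) (ev q 0) (ev q 0)"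
proof -
  have sc: "sc q (q powi m) = ev q (qs m 1)" for m by (rule sc_ev)
  have "- (q ^ 2) * (1 + q powi (-2)) = - (q powi 2) + - (q powi 0)"
    using q_nz by (simp add: field_simps power_int_minus)
  then show "d_e q Ep = form2_of (ev q 0) (ev q (- qs 2 1 - 1)) (ev q 0)"
    by (simp only: d_e_def Let_def basis1.simps sc_add sc_uminus sc) (simp add: ev_simps sc_closed sc_one)
  have "q powi (-2) * (1 + q powi (-2)) = q powi (-2) + q powi (-4)"
    using q_nz power_int_add[of q "-2" "-2"] by (simp add: distrib_left)
  then show "d_e q Em = form2_of (ev q 0) (ev q 0) (ev q (qs (-2) 1 + qs (-4) 1))"
    by (simp only: d_e_def Let_def basis1.simps sc_add sc) (simp add: ev_simps sc_closed)
  show "d_e q E0 = form2_of (ev q (qs 3 1)) (ev q 0) (ev q 0)"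
    using sc[of 3] by (simp add: d_e_def Let_def ev_simps)
qed

lemma form2_ops:
  "form2_of (ev q x) (ev q y) (ev q z) \<oplus>\<^bsub>Om2_SL2 q\<^esub> form2_of (ev q x') (ev q y') (ev q z')
    = form2_of (ev q (x + x')) (ev q (y + y')) (ev q (z + z'))"
  "ev q m \<odot>\<^bsub>Om2_SL2 q\<^esub> form2_of (ev q x) (ev q y) (ev q z) = form2_of (ev q (m * x)) (ev q (m * y)) (ev q (m * z))"
  by (rule ext, rename_tac i, case_tac i; simp add: Om2_SL2_def forms_simps form2_of_def ev_simps)+

text \<open>The e0 parts cancel: along e0 the coefficients have derivatives
  \<open>- qs (-2) s - qs (-4) s\<close> and \<open>t + qs 2 t\<close>, and reordering e0 past e+ or
  e- turns these into the negatives of the contributions of d e+ and d e-.\<close>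

lemma d1_frm:
  assumes "homog (-2) s" "homog 2 t"
  shows "d1 q (frm q s t) = ups q (dif Ep t - qs 2 (dif Em s))"
proof -
  have f: "frm q s t = form1_of (ev q s) (ev q t) (ev q 0)" by (simp add: frm_def ev_simps)
  have "form1_of a b c Ep = a" "form1_of a b c Em = b" "form1_of a b c E0 = c" for a b c
    by (simp_all add: form1_of_def)
  then show ?thesis
    unfolding d1_def Let_def f
    by (simp add: d0_ev_general e1_ev wedge_ev d_e_ev form2_ops dif_vertical(3)[OF assms(1)]
        dif_vertical(2)[OF assms(2)] ups_def algebra_simps flip: ev_zero[OF q_nz] del: ev_simps)
qed

lemma carrier_Om1: "carrier (Om1 q) = {frm q x y | x y. homog (-2) x \<and> homog 2 y}"
proof -
  define B where "B = {frm q x y | x y. homog (-2) x \<and> homog 2 y}"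
  have BI: "frm q x y \<in> B" if "homog (-2) x" "homog 2 y" for x y
    using that by (auto simp: B_def)
  have BE: "\<exists>x y. homog (-2) x \<and> homog 2 y \<and> z = frm q x y" if "z \<in> B" for z
    using that by (auto simp: B_def)
  have "z \<in> B" if "z \<in> Om1_S2_set q" for z
    using that
  proof (induction z rule: Om1_S2_set.induct)
    case (1 f)
    then obtain m where "homog 0 m" "f = ev q m" by (rule S2_cases)
    then show ?case by (auto simp: d0_ev intro!: BI homog_dif)
  next
    case (2 x y)
    then show ?case by (auto simp: frm_ops dest!: BE intro!: BI homog_add)
  next
    case (3 f x)
    then show ?case by (elim S2_cases) (auto simp: frm_ops dest!: BE intro!: BI homog_mult)
  next
    case (4 f x)
    then show ?case by (elim S2_cases) (auto simp: frm_rsmult dest!: BE intro!: BI homog_mult)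
  qed
  moreover have "frm q x y \<in> Om1_S2_set q" if xy: "homog (-2) x" "homog 2 y" for x y
  proof -
    \<comment> \<open>Since \<open>cp\<close> pairs to 1 with \<open>bp\<close> and to 0 with
      \<open>bm\<close>, and \<open>cm\<close> the other way round, these functions combine the
      differentials of the \<open>bb k\<close> into any prescribed pair of components.\<close>
    define w where "w k = x * cp k + y * cm k" for k
    have w: "homog 0 (w k)" if "k < 3" for k
      unfolding w_def using xy homog_triples[OF that] by (auto intro!: homog_add homog_mult)
    have "frm q (w k * bp k) (w k * bm k) \<in> Om1_S2_set q" if "k < 3" for k
    proof -
      have "ev q (w k) \<odot>\<^bsub>Om1_SL2 q\<^esub> d0 q (ev q (bb k)) \<in> Om1_S2_set q"
        by (intro Om1_S2_set.intros ev_S2 w homog_triples that)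
      then show ?thesis by (simp add: d0_ev homog_triples that dif_bb frm_ops)
    qed
    then have "frm q (sum3 (\<lambda>k. w k * bp k)) (sum3 (\<lambda>k. w k * bm k)) \<in> Om1_S2_set q"
      unfolding sum3_def frm_ops(1)[symmetric] by (intro Om1_S2_set.intros) simp_all
    moreover have "sum3 (\<lambda>k. w k * bp k) = x * sum3 (\<lambda>k. cp k * bp k) + y * sum3 (\<lambda>k. cm k * bp k)"
      "sum3 (\<lambda>k. w k * bm k) = x * sum3 (\<lambda>k. cp k * bm k) + y * sum3 (\<lambda>k. cm k * bm k)"
      by (simp_all add: w_def sum3_def algebra_simps)
    ultimately show ?thesis by (simp add: triple_identities)
  qed
  ultimately show ?thesis by (auto simp: Om1_ops B_def)
qed

lemma frm_closed: "homog (-2) x \<Longrightarrow> homog 2 y \<Longrightarrow> frm q x y \<in> carrier (Om1 q)"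
  by (auto simp: carrier_Om1)

lemma Om1_cases:
  assumes "\<tau> \<in> carrier (Om1 q)"
  obtains x y where "homog (-2) x" "homog 2 y" "\<tau> = frm q x y"
  using assms by (auto simp: carrier_Om1)

lemma carrier_Om2: "carrier (Om2 q) = {ups q z | z. homog 0 z}"
proof -
  define B where "B = {ups q z | z. homog 0 z}"
  have BI: "ups q z \<in> B" if "homog 0 z" for z
    using that by (auto simp: B_def)
  have BE: "\<exists>z. homog 0 z \<and> u = ups q z" if "u \<in> B" for u
    using that by (auto simp: B_def)
  have "u \<in> B" if "u \<in> Om2_S2_set q" for u
    using that
  proof (induction u rule: Om2_S2_set.induct)
    case (1 x y)
    then show ?case
      unfolding Om1_ops(5)[symmetric]
      by (elim Om1_cases) (auto simp: wedge_frm intro!: BI homog_minus homog_qs homog_mult)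
  next
    case (2 x)
    then show ?case
      unfolding Om1_ops(5)[symmetric]
      by (elim Om1_cases) (auto simp: d1_frm intro!: BI homog_minus homog_qs homog_dif)
  next
    case (3 u v)
    then show ?case by (auto simp: ups_ops dest!: BE intro!: BI homog_add)
  next
    case (4 f u)
    then show ?case by (elim S2_cases) (auto simp: ups_ops dest!: BE intro!: BI homog_mult)
  next
    case (5 f u)
    then show ?case by (elim S2_cases) (auto simp: ups_rsmult dest!: BE intro!: BI homog_mult)
  qed
  moreover have "ups q z \<in> Om2_S2_set q" if z: "homog 0 z" for z
  proof -
    \<comment> \<open>The factor q^(-2) offsets the q^2 that arises when e+ is carried past
      \<open>bm k\<close>, which has degree 2.\<close>
    have "ups q (qs 2 (qs (-2) z * cm k * bm k)) \<in> Om2_S2_set q" if "k < 3" for k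
    proof -
      have *: "homog (-2) (qs (-2) z * cm k)" "homog 2 (bm k)"
        using z homog_triples[OF that] by (auto intro!: homog_mult homog_qs)
      then have "frm q (qs (-2) z * cm k) 0 \<in> Om1_S2_set q" "frm q 0 (bm k) \<in> Om1_S2_set q"
        using frm_closed homog_zero by (simp_all add: Om1_ops)
      from Om2_S2_set.intros(1)[OF this] show ?thesis
        using * by (simp add: wedge_frm homog_zero)
    qed
    then have "ups q (sum3 (\<lambda>k. qs 2 (qs (-2) z * cm k * bm k))) \<in> Om2_S2_set q"
      unfolding sum3_def ups_ops(1)[symmetric] by (intro Om2_S2_set.intros) simp_all
    moreover have "sum3 (\<lambda>k. qs 2 (qs (-2) z * cm k * bm k)) = z * sum3 (\<lambda>k. cm k * bm k)"
      by (simp add: sum3_def algebra_simps)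
    ultimately show ?thesis by (simp add: triple_identities)
  qed
  ultimately show ?thesis by (auto simp: Om2_ops B_def)
qed

lemma ups_closed: "homog 0 z \<Longrightarrow> ups q z \<in> carrier (Om2 q)"
  by (auto simp: carrier_Om2)

lemma Om2_cases:
  assumes "u \<in> carrier (Om2 q)"
  obtains z where "homog 0 z" "u = ups q z"
  using assms by (auto simp: carrier_Om2)

lemmas Om1_calc = Om1_ops(1-4) frm_ops frm_rsmult
lemmas Om2_calc = Om2_ops(1-4) ups_ops ups_rsmult

sublocale Om1: bimod "S2 q" "Om1 q"
proof -
  have "abelian_group (Om1 q)"
  proof (rule abelian_groupI)
    show "\<exists>y\<in>carrier (Om1 q). y \<oplus>\<^bsub>Om1 q\<^esub> x = \<zero>\<^bsub>Om1 q\<^esub>" if "x \<in> carrier (Om1 q)" for x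
    proof -
      from that obtain a b where "homog (-2) a" "homog 2 b" "x = frm q a b" by (rule Om1_cases)
      then show ?thesis
        by (intro bexI[of _ "frm q (- a) (- b)"]) (simp_all add: Om1_calc frm_closed homog_uminus)
    qed
  qed (auto simp: Om1_calc add_ac elim!: Om1_cases intro!: frm_closed homog_add homog_zero)
  then interpret abelian_group "Om1 q" .
  show "bimod (S2 q) (Om1 q)"
    by unfold_locales
      (auto simp: Om1_calc S2_simps(2-) ev_simps(2-4)[symmetric] algebra_simps simp del: ev_simps
        elim!: Om1_cases S2_cases intro!: frm_closed homog_mult)
qed

sublocale Om2: bimod "S2 q" "Om2 q"
proof -
  have "abelian_group (Om2 q)"
  proof (rule abelian_groupI)
    show "\<exists>y\<in>carrier (Om2 q). y \<oplus>\<^bsub>Om2 q\<^esub> x = \<zero>\<^bsub>Om2 q\<^esub>" if "x \<in> carrier (Om2 q)" for x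
    proof -
      from that obtain z where "homog 0 z" "x = ups q z" by (rule Om2_cases)
      then show ?thesis
        by (intro bexI[of _ "ups q (- z)"]) (simp_all add: Om2_calc ups_closed homog_uminus)
    qed
  qed (auto simp: Om2_calc add_ac elim!: Om2_cases intro!: ups_closed homog_add homog_zero)
  then interpret abelian_group "Om2 q" .
  show "bimod (S2 q) (Om2 q)"
    by unfold_locales
      (auto simp: Om2_calc S2_simps(2-) ev_simps(2-4)[symmetric] algebra_simps simp del: ev_simps
        elim!: Om2_cases S2_cases intro!: ups_closed homog_mult)
qed

sublocale T11: bimod_tensor "S2 q" "Om1 q" "Om1 q"
  rewrites "tensor (S2 q) (Om1 q) (Om1 q) = T11 q" and "tens (S2 q) (Om1 q) (Om1 q) = t11 q"
  by unfold_locales (simp_all add: T11_def t11_def)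

sublocale T21: bimod_tensor "S2 q" "Om2 q" "Om1 q"
  rewrites "tensor (S2 q) (Om2 q) (Om1 q) = T21 q" and "tens (S2 q) (Om2 q) (Om1 q) = t21 q"
  by unfold_locales (simp_all add: T21_def t21_def)

end

section \<open>Curvature\<close>

lemmas homog_intros = homog_zero homog_add homog_minus homog_uminus homog_qs homog_mult homog_dif

text \<open>The same number at every parameter, unlike \<open>qs\<close>, whose factor varies with
  it. This expresses scalars that are fixed together with one chosen q, such as the curvature
  constants.\<close>

definition kc :: "complex \<Rightarrow> qsl" where
  "kc c = fam (\<lambda>p. sc p c)"

lemma ev_kc: "q \<noteq> 0 \<Longrightarrow> ev q (kc c) = sc q c"
  unfolding kc_def by (rule ev_fam) (simp_all add: sc_closed)

lemma homog_kc: "homog 0 (kc c)"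
  by (rule homogI) (use homog_free_closed(5) in \<open>auto simp: ev_kc sc_def\<close>)

lemma kc_commute: "x * kc c = kc c * x"
  by (rule qsl_eqI) (simp add: ev_hom ev_kc ev_closed sc_commute)

lemma kc_simps: "kc 1 = 1" "kc 0 = 0" "kc (- 1) = - 1"
  by (rule qsl_eqI, simp add: ev_hom ev_kc sc_one sc_zero sc_uminus)+

lemma less_3_cases: "(k::nat) < 3 \<Longrightarrow> k = 0 \<or> k = 1 \<or> k = 2"
  by auto

lemma less_3_simps: "(0::nat) < 3" "(1::nat) < 3" "(2::nat) < 3"
  by simp_all

section \<open>Tensors with a 2-form as first factor\<close>

context sphere
begin

lemma abelian_group_T21: "abelian_group (T21 q)"
  by (rule T21.T.abelian_group_axioms)

lemma abelian_group_T11: "abelian_group (T11 q)"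
  by (rule T11.T.abelian_group_axioms)

lemma t21_ups:
  "homog 0 z \<Longrightarrow> homog (-2) x \<Longrightarrow> homog 2 y \<Longrightarrow>
    t21 q (ups q z) (frm q x y) = t21 q (ups q 1) (frm q (z * x) (z * y))"
  using T21.tens_balanced[of "ups q 1" "ev q z" "frm q x y"]
  by (simp add: Om1_calc Om2_calc ups_closed homog_one frm_closed ev_S2)

lemma t21_add:
  "homog (-2) x \<Longrightarrow> homog 2 y \<Longrightarrow> homog (-2) x' \<Longrightarrow> homog 2 y' \<Longrightarrow>
    t21 q (ups q 1) (frm q x y) \<oplus>\<^bsub>T21 q\<^esub> t21 q (ups q 1) (frm q x' y') =
    t21 q (ups q 1) (frm q (x + x') (y + y'))"
  using T21.tens_add_right[of "ups q 1" "frm q x y" "frm q x' y'"]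
  by (simp add: Om1_calc ups_closed homog_one frm_closed)

lemma t21_closed: "homog (-2) x \<Longrightarrow> homog 2 y \<Longrightarrow> t21 q (ups q 1) (frm q x y) \<in> carrier (T21 q)"
  by (intro T21.tens_closed ups_closed frm_closed homog_one)

lemma t21_uminus:
  assumes "homog (-2) x" "homog 2 y"
  shows "\<ominus>\<^bsub>T21 q\<^esub> t21 q (ups q 1) (frm q x y) = t21 q (ups q 1) (frm q (- x) (- y))"
proof (rule T21.T.minus_equality)
  have "t21 q (ups q 1) (frm q 0 0) = \<zero>\<^bsub>T21 q\<^esub>"
    using T21.tens_zero_right[of "ups q 1"] by (simp add: Om1_calc ups_closed homog_one)
  then show "t21 q (ups q 1) (frm q (- x) (- y)) \<oplus>\<^bsub>T21 q\<^esub> t21 q (ups q 1) (frm q x y) = \<zero>\<^bsub>T21 q\<^esub>"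
    using assms by (simp add: t21_add homog_uminus)
qed (use assms in \<open>auto intro!: t21_closed homog_uminus\<close>)

lemma t21_minus:
  "homog (-2) x \<Longrightarrow> homog 2 y \<Longrightarrow> homog (-2) x' \<Longrightarrow> homog 2 y' \<Longrightarrow>
    t21 q (ups q 1) (frm q x y) \<ominus>\<^bsub>T21 q\<^esub> t21 q (ups q 1) (frm q x' y') =
    t21 q (ups q 1) (frm q (x - x') (y - y'))"
  by (simp add: a_minus_def t21_uminus t21_add homog_uminus)

lemma wedge_balanced:
  assumes "homog (-2) s" "homog 2 t"
  shows "balanced_map (S2 q) (Om1 q) (Om1 q) (T21 q) (\<lambda>\<sigma> \<zeta>. t21 q (wedge q (frm q s t) \<sigma>) \<zeta>)"
proof (rule balanced_mapI)
  have closed: "wedge q (frm q s t) x \<in> carrier (Om2 q)" if "x \<in> carrier (Om1 q)" for x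
    using that assms by (elim Om1_cases) (auto simp: wedge_frm intro!: ups_closed homog_intros)
  show "t21 q (wedge q (frm q s t) x) y \<in> carrier (T21 q)"
    if "x \<in> carrier (Om1 q)" "y \<in> carrier (Om1 q)" for x y
    by (intro T21.tens_closed closed that)
  show "t21 q (wedge q (frm q s t) x) (y \<oplus>\<^bsub>Om1 q\<^esub> y') =
      t21 q (wedge q (frm q s t) x) y \<oplus>\<^bsub>T21 q\<^esub> t21 q (wedge q (frm q s t) x) y'"
    if "x \<in> carrier (Om1 q)" "y \<in> carrier (Om1 q)" "y' \<in> carrier (Om1 q)" for x y y'
    by (intro T21.tens_add_right closed that)
  show "t21 q (wedge q (frm q s t) (x \<oplus>\<^bsub>Om1 q\<^esub> x')) y =
      t21 q (wedge q (frm q s t) x) y \<oplus>\<^bsub>T21 q\<^esub> t21 q (wedge q (frm q s t) x') y"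
    if "x \<in> carrier (Om1 q)" "x' \<in> carrier (Om1 q)" "y \<in> carrier (Om1 q)" for x x' y
  proof -
    have "wedge q (frm q s t) (x \<oplus>\<^bsub>Om1 q\<^esub> x') =
        wedge q (frm q s t) x \<oplus>\<^bsub>Om2 q\<^esub> wedge q (frm q s t) x'"
      using that(1,2) assms
      by (elim Om1_cases) (simp add: Om1_calc Om2_calc wedge_frm homog_add algebra_simps)
    then show ?thesis using that by (simp add: T21.tens_add_left closed)
  qed
  show "t21 q (wedge q (frm q s t) (x \<odot>r\<^bsub>Om1 q\<^esub> m)) y = t21 q (wedge q (frm q s t) x) (m \<odot>\<^bsub>Om1 q\<^esub> y)"
    if "x \<in> carrier (Om1 q)" "m \<in> carrier (S2 q)" "y \<in> carrier (Om1 q)" for x m y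
  proof -
    have "wedge q (frm q s t) (x \<odot>r\<^bsub>Om1 q\<^esub> m) = wedge q (frm q s t) x \<odot>r\<^bsub>Om2 q\<^esub> m"
      using that(1,2) assms
      by (elim Om1_cases S2_cases) (simp add: Om1_calc Om2_calc wedge_frm homog_mult algebra_simps)
    then show ?thesis using that by (simp add: T21.tens_balanced closed)
  qed
qed

lemma wedge_left_t11:
  assumes "homog (-2) s" "homog 2 t" "homog (-2) x" "homog 2 y" "\<eta> \<in> carrier (Om1 q)"
  shows "wedge_left q (frm q s t) (t11 q (frm q x y) \<eta>) = t21 q (ups q (qs 2 (s * y) - t * x)) \<eta>"
  unfolding wedge_left_def using assms
  by (simp add: T11.tensor_lift_tens[OF abelian_group_T21 wedge_balanced] frm_closed wedge_frm)

lemma wedge_left_add: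
  assumes "homog (-2) s" "homog 2 t" "u \<in> carrier (T11 q)" "v \<in> carrier (T11 q)"
  shows "wedge_left q (frm q s t) (u \<oplus>\<^bsub>T11 q\<^esub> v) =
    wedge_left q (frm q s t) u \<oplus>\<^bsub>T21 q\<^esub> wedge_left q (frm q s t) v"
  unfolding wedge_left_def using assms
  by (simp add: T11.tensor_lift_add[OF abelian_group_T21 wedge_balanced])

definition dfrm :: "qsl \<Rightarrow> form1" where
  "dfrm w = frm q (dif Ep w) (dif Em w)"

lemma dfrm_closed: "homog 0 w \<Longrightarrow> dfrm w \<in> carrier (Om1 q)"
  unfolding dfrm_def by (auto intro!: frm_closed homog_dif)

lemma ev_tw: "ev q (tw x) = sc q (qtwo q) \<otimes>\<^bsub>SL2 q\<^esub> ev q x"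
proof -
  have "qtwo q = q powi 1 + q powi (-1)" by (simp add: qtwo_def power_int_minus)
  then show ?thesis by (simp only: tw_def ev_simps sc_add A.l_distr[OF sc_closed sc_closed ev_cl])
qed

lemma T11_add_ev:
  assumes "homog 0 m" "homog 0 n" "t \<in> carrier (T11 q)"
  shows "ev q (m + n) \<odot>\<^bsub>T11 q\<^esub> t = ev q m \<odot>\<^bsub>T11 q\<^esub> t \<oplus>\<^bsub>T11 q\<^esub> ev q n \<odot>\<^bsub>T11 q\<^esub> t"
  using T11.T_add_smult[OF ev_S2[OF assms(1)] ev_S2[OF assms(2)] assms(3)]
  by (simp add: S2_simps(2) ev_simps(3))

lemma b_ev: "b_plus q = ev q (bb 0)" "b_minus q = ev q (bb 1)" "b_zero q = ev q (bb 2)"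
  by (simp_all add: b_plus_def b_minus_def b_zero_def triple_simps ev_simps ev_gen[OF q_nz])

lemma d0_bb: "k < 3 \<Longrightarrow> d0 q (ev q (bb k)) = frm q (bp k) (bm k)"
  by (simp add: d0_ev homog_triples dif_bb)

definition t11_sum :: "(nat \<Rightarrow> form1) \<Rightarrow> (nat \<Rightarrow> form1) \<Rightarrow> ((form1 \<times> form1) \<Rightarrow>\<^sub>0 int) set" where
  "t11_sum \<sigma> \<eta> = t11 q (\<sigma> 0) (\<eta> 0) \<oplus>\<^bsub>T11 q\<^esub> t11 q (\<sigma> 1) (\<eta> 1) \<oplus>\<^bsub>T11 q\<^esub> t11 q (\<sigma> 2) (\<eta> 2)"

section \<open>Bimodule maps and the closure of the metric\<close>

lemma bimodule_homD:
  assumes "f \<in> bimodule_hom (S2 q) (Om1 q) (Om1 q)"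
  shows "x \<in> carrier (Om1 q) \<Longrightarrow> f x \<in> carrier (Om1 q)"
    and "x \<in> carrier (Om1 q) \<Longrightarrow> y \<in> carrier (Om1 q) \<Longrightarrow> f (x \<oplus>\<^bsub>Om1 q\<^esub> y) = f x \<oplus>\<^bsub>Om1 q\<^esub> f y"
    and "m \<in> carrier (S2 q) \<Longrightarrow> x \<in> carrier (Om1 q) \<Longrightarrow> f (m \<odot>\<^bsub>Om1 q\<^esub> x) = m \<odot>\<^bsub>Om1 q\<^esub> f x"
    and "m \<in> carrier (S2 q) \<Longrightarrow> x \<in> carrier (Om1 q) \<Longrightarrow> f (x \<odot>r\<^bsub>Om1 q\<^esub> m) = f x \<odot>r\<^bsub>Om1 q\<^esub> m"
  using assms by (auto simp: bimodule_hom_def left_hom_def)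

lemma map11_balanced:
  assumes "f \<in> bimodule_hom (S2 q) (Om1 q) (Om1 q)" "h \<in> bimodule_hom (S2 q) (Om1 q) (Om1 q)"
  shows "balanced_map (S2 q) (Om1 q) (Om1 q) (T11 q) (\<lambda>x y. t11 q (f x) (h y))"
  by (rule balanced_mapI)
    (simp_all add: bimodule_homD[OF assms(1)] bimodule_homD[OF assms(2)] T11.tens_closed
      T11.tens_add_left T11.tens_add_right T11.tens_balanced)

text \<open>The projections, the Hodge operator and the curvature operator each act by one number on
  either component; treating them together lets bimodule linearity be proved once.\<close>

definition scales :: "complex \<Rightarrow> complex \<Rightarrow> (form1 \<Rightarrow> form1) \<Rightarrow> bool" where
  "scales c c' f \<longleftrightarrow> (\<forall>x y. homog (-2) x \<longrightarrow> homog 2 y \<longrightarrow> f (frm q x y) = frm q (kc c * x) (kc c' * y))"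

lemma scalesD: "scales c c' f \<Longrightarrow> homog (-2) x \<Longrightarrow> homog 2 y \<Longrightarrow> f (frm q x y) = frm q (kc c * x) (kc c' * y)"
  by (simp add: scales_def)

lemma homog_kc_mult: "homog n x \<Longrightarrow> homog n (kc c * x)"
  by (rule homog_mult[OF homog_kc]) simp_all

lemma scales_hom:
  assumes "scales c c' f"
  shows "f \<in> bimodule_hom (S2 q) (Om1 q) (Om1 q)"
proof -
  have kc: "x * (kc a * y) = kc a * (x * y)" for x y a
    by (simp add: mult.assoc[symmetric] kc_commute)
  note s = scalesD[OF assms]
  have "f x \<in> carrier (Om1 q)" if "x \<in> carrier (Om1 q)" for x
    using that by (elim Om1_cases) (auto simp: s intro!: frm_closed homog_kc_mult)
  moreover have "f (x \<oplus>\<^bsub>Om1 q\<^esub> y) = f x \<oplus>\<^bsub>Om1 q\<^esub> f y"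
    if "x \<in> carrier (Om1 q)" "y \<in> carrier (Om1 q)" for x y
    using that by (elim Om1_cases) (simp add: s Om1_calc homog_add algebra_simps)
  moreover have "f (m \<odot>\<^bsub>Om1 q\<^esub> x) = m \<odot>\<^bsub>Om1 q\<^esub> f x"
    if "m \<in> carrier (S2 q)" "x \<in> carrier (Om1 q)" for m x
    using that by (elim Om1_cases S2_cases) (simp add: s Om1_calc homog_mult kc)
  moreover have "f (x \<odot>r\<^bsub>Om1 q\<^esub> m) = f x \<odot>r\<^bsub>Om1 q\<^esub> m"
    if "m \<in> carrier (S2 q)" "x \<in> carrier (Om1 q)" for m x
    using that by (elim Om1_cases S2_cases) (simp add: s Om1_calc homog_mult mult.assoc)
  ultimately show ?thesis
    by (auto simp: bimodule_hom_def left_hom_def)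
qed

lemma scales_maps:
  "scales 1 0 (proj10 q)" "scales 0 1 (proj01 q)" "scales 1 (-1) (hodge q)" "scales 1 1 (\<lambda>x. x)"
  by (simp_all add: scales_def proj10_def proj01_def hodge_def kc_simps frm_def form1_of_def ev_simps)

lemma sc_S2: "sc q c \<in> carrier (S2 q)"
  using ev_S2[OF homog_kc, of c] by (simp add: ev_kc q_nz)

lemma metric_closed: "metric q \<in> carrier (T11 q)"
proof -
  have "d0 q (b_plus q) \<in> carrier (Om1 q)" "d0 q (b_minus q) \<in> carrier (Om1 q)"
    "d0 q (b_zero q) \<in> carrier (Om1 q)"
    unfolding b_ev by (simp_all only: d0_bb frm_closed homog_triples less_3_simps)
  then show ?thesis
    unfolding metric_def
    by (intro T11.T.minus_closed T11.T.a_closed T11.T_smult_closed T11.tens_closed sc_S2)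
qed

lemma metric_parts_closed: "metric_pm q \<in> carrier (T11 q)" "metric_mp q \<in> carrier (T11 q)"
  unfolding metric_pm_def metric_mp_def map11_def
  by (intro T11.tensor_lift_closed[OF abelian_group_T11] map11_balanced scales_hom[OF scales_maps(1)]
    scales_hom[OF scales_maps(2)] metric_closed)+

end

section \<open>The connection determined by its prescribed values\<close>

locale monopole = sphere +
  fixes nabla :: "form1 \<Rightarrow> ((form1 \<times> form1) \<Rightarrow>\<^sub>0 int) set"
  assumes levi_civita: "monopole_levi_civita q nabla"
begin

lemma nabla_closed: "\<tau> \<in> carrier (Om1 q) \<Longrightarrow> nabla \<tau> \<in> carrier (T11 q)"
  using levi_civita by (auto simp: monopole_levi_civita_def left_connection_def)

lemma nabla_add: "\<tau> \<in> carrier (Om1 q) \<Longrightarrow> \<eta> \<in> carrier (Om1 q) \<Longrightarrow>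
    nabla (\<tau> \<oplus>\<^bsub>Om1 q\<^esub> \<eta>) = nabla \<tau> \<oplus>\<^bsub>T11 q\<^esub> nabla \<eta>"
  using levi_civita by (simp add: monopole_levi_civita_def left_connection_def)

lemma nabla_smult: "homog 0 m \<Longrightarrow> \<tau> \<in> carrier (Om1 q) \<Longrightarrow>
    nabla (ev q m \<odot>\<^bsub>Om1 q\<^esub> \<tau>) = t11 q (dfrm m) \<tau> \<oplus>\<^bsub>T11 q\<^esub> ev q m \<odot>\<^bsub>T11 q\<^esub> nabla \<tau>"
  using levi_civita by (simp add: monopole_levi_civita_def left_connection_def ev_S2 d0_ev dfrm_def)

lemma nabla_basis:
  assumes "k < 3"
  shows "nabla (frm q (bp k) 0) = ev q (beta k) \<odot>\<^bsub>T11 q\<^esub> metric_mp q"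
    and "nabla (frm q 0 (bm k)) = ev q (beta k) \<odot>\<^bsub>T11 q\<^esub> metric_pm q"
proof -
  have del: "del q (ev q (bb k)) = frm q (bp k) 0" "delbar q (ev q (bb k)) = frm q 0 (bm k)" if "k < 3" for k
    using that by (simp_all add: del_def delbar_def proj10_def proj01_def d0_bb frm_def ev_simps form1_of_def)
  have "beta 0 = tw (bb 0)" "beta 1 = tw (bb 1)" "beta 2 = 1 + tw (bb 2)"
    by (simp_all add: beta_def bb_def numeral_2_eq_2)
  then show "nabla (frm q (bp k) 0) = ev q (beta k) \<odot>\<^bsub>T11 q\<^esub> metric_mp q"
    "nabla (frm q 0 (bm k)) = ev q (beta k) \<odot>\<^bsub>T11 q\<^esub> metric_pm q"
    using levi_civita less_3_cases[OF assms] del[of 0] del[of 1] del[of 2]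
    by (auto simp: monopole_levi_civita_def b_ev S2_simps ev_tw[symmetric] ev_simps(2,3)[symmetric] simp del: ev_simps)
qed

text \<open>
  The cofactors are annihilated by beta, so only the derivatives of the coefficients survive:
  this is the Grassmann connection of the projector given by the cofactors.
\<close>

lemma nabla_combination:
  assumes w: "\<And>k. k < 3 \<Longrightarrow> homog 0 (w k)" and \<eta>: "\<And>k. k < 3 \<Longrightarrow> \<eta> k \<in> carrier (Om1 q)"
    and nab: "\<And>k. k < 3 \<Longrightarrow> nabla (\<eta> k) = ev q (beta k) \<odot>\<^bsub>T11 q\<^esub> G" and G: "G \<in> carrier (T11 q)"
    and zero: "sum3 (\<lambda>k. w k * beta k) = 0"
  shows "nabla (ev q (w 0) \<odot>\<^bsub>Om1 q\<^esub> \<eta> 0 \<oplus>\<^bsub>Om1 q\<^esub> ev q (w 1) \<odot>\<^bsub>Om1 q\<^esub> \<eta> 1 \<oplus>\<^bsub>Om1 q\<^esub> ev q (w 2) \<odot>\<^bsub>Om1 q\<^esub> \<eta> 2)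
    = t11_sum (\<lambda>k. dfrm (w k)) \<eta>"
proof -
  define u where "u k = ev q (w k * beta k) \<odot>\<^bsub>T11 q\<^esub> G" for k
  have S: "ev q (w k) \<in> carrier (S2 q)" "ev q (beta k) \<in> carrier (S2 q)" if "k < 3" for k
    using w homog_triples that by (auto intro!: ev_S2)
  have wb: "homog 0 (w k * beta k)" if "k < 3" for k
    using w homog_triples that by (auto intro!: homog_intros)
  have t: "t11 q (dfrm (w k)) (\<eta> k) \<in> carrier (T11 q)" "u k \<in> carrier (T11 q)"
    "ev q (w k) \<odot>\<^bsub>Om1 q\<^esub> \<eta> k \<in> carrier (Om1 q)" if "k < 3" for k
    using that by (auto simp: u_def intro!: T11.tens_closed T11.T_smult_closed Om1.smult_closed
      dfrm_closed w \<eta> G S ev_S2 wb)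
  have step: "nabla (ev q (w k) \<odot>\<^bsub>Om1 q\<^esub> \<eta> k) = t11 q (dfrm (w k)) (\<eta> k) \<oplus>\<^bsub>T11 q\<^esub> u k" if "k < 3" for k
    using that S[OF that] T11.T_mult_smult[of "ev q (w k)" "ev q (beta k)" G] G
    by (simp add: nabla_smult w \<eta> nab u_def S2_simps ev_simps)
  have "u 0 \<oplus>\<^bsub>T11 q\<^esub> u 1 \<oplus>\<^bsub>T11 q\<^esub> u 2 = ev q (sum3 (\<lambda>k. w k * beta k)) \<odot>\<^bsub>T11 q\<^esub> G"
    by (simp add: u_def sum3_def wb homog_add G T11_add_ev)
  also have "\<dots> = \<zero>\<^bsub>T11 q\<^esub>"
    using T11.T_zero_smult[OF G] by (simp add: zero S2_simps ev_simps)
  finally have u: "u 0 \<oplus>\<^bsub>T11 q\<^esub> u 1 \<oplus>\<^bsub>T11 q\<^esub> u 2 = \<zero>\<^bsub>T11 q\<^esub>" .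
  have "(a \<oplus>\<^bsub>T11 q\<^esub> u 0) \<oplus>\<^bsub>T11 q\<^esub> (b \<oplus>\<^bsub>T11 q\<^esub> u 1) \<oplus>\<^bsub>T11 q\<^esub> (c \<oplus>\<^bsub>T11 q\<^esub> u 2) = a \<oplus>\<^bsub>T11 q\<^esub> b \<oplus>\<^bsub>T11 q\<^esub> c"
    if "a \<in> carrier (T11 q)" "b \<in> carrier (T11 q)" "c \<in> carrier (T11 q)" for a b c
  proof -
    have "(a \<oplus>\<^bsub>T11 q\<^esub> u 0) \<oplus>\<^bsub>T11 q\<^esub> (b \<oplus>\<^bsub>T11 q\<^esub> u 1) \<oplus>\<^bsub>T11 q\<^esub> (c \<oplus>\<^bsub>T11 q\<^esub> u 2)
        = (a \<oplus>\<^bsub>T11 q\<^esub> b \<oplus>\<^bsub>T11 q\<^esub> c) \<oplus>\<^bsub>T11 q\<^esub> (u 0 \<oplus>\<^bsub>T11 q\<^esub> u 1 \<oplus>\<^bsub>T11 q\<^esub> u 2)"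
      using that t(2) by (simp add: T11.T.a_ac)
    then show ?thesis using that u by simp
  qed
  then show ?thesis
    by (simp add: nabla_add t step t11_sum_def)
qed

end

context sphere
begin

lemma t11_sum_closed:
  "(\<And>k. k < 3 \<Longrightarrow> \<sigma> k \<in> carrier (Om1 q)) \<Longrightarrow> (\<And>k. k < 3 \<Longrightarrow> \<eta> k \<in> carrier (Om1 q)) \<Longrightarrow>
    t11_sum \<sigma> \<eta> \<in> carrier (T11 q)"
  unfolding t11_sum_def by (intro T11.T.a_closed T11.tens_closed) simp_all

lemma frm_combination:
  assumes "homog (-2) x" "homog 2 y"
  shows "frm q x 0 = ev q (x * cp 0) \<odot>\<^bsub>Om1 q\<^esub> frm q (bp 0) 0 \<oplus>\<^bsub>Om1 q\<^esub> ev q (x * cp 1) \<odot>\<^bsub>Om1 q\<^esub> frm q (bp 1) 0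
      \<oplus>\<^bsub>Om1 q\<^esub> ev q (x * cp 2) \<odot>\<^bsub>Om1 q\<^esub> frm q (bp 2) 0"
    and "frm q 0 y = ev q (y * cm 0) \<odot>\<^bsub>Om1 q\<^esub> frm q 0 (bm 0) \<oplus>\<^bsub>Om1 q\<^esub> ev q (y * cm 1) \<odot>\<^bsub>Om1 q\<^esub> frm q 0 (bm 1)
      \<oplus>\<^bsub>Om1 q\<^esub> ev q (y * cm 2) \<odot>\<^bsub>Om1 q\<^esub> frm q 0 (bm 2)"
  using arg_cong[OF triple_identities(1), of "\<lambda>z. x * z"] arg_cong[OF triple_identities(2), of "\<lambda>z. y * z"]
  by (simp_all add: Om1_calc sum3_def algebra_simps)

text \<open>The second factor when the curvature integrand is written as \<open>Ups q\<close> tensor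
  a 1-form. In each component the first two terms come from \<open>nabla\<close> through
  \<open>connection_identities\<close>, the last from the differential of the first factor.\<close>

definition riemann_form :: "qsl \<Rightarrow> qsl \<Rightarrow> qsl \<Rightarrow> qsl \<Rightarrow> form1" where
  "riemann_form s t x y = frm q
    (qs 4 (s * dif Em x) - qs 2 (t * dif Ep x) - (dif Ep t - qs 2 (dif Em s)) * x)
    (s * dif Em y - qs (-2) (t * dif Ep y) - (dif Ep t - qs 2 (dif Em s)) * y)"

lemma riemann_form_closed:
  "homog (-2) s \<Longrightarrow> homog 2 t \<Longrightarrow> homog (-2) x \<Longrightarrow> homog 2 y \<Longrightarrow> riemann_form s t x y \<in> carrier (Om1 q)"
  unfolding riemann_form_def by (auto intro!: frm_closed homog_intros)

end

context monopole
begin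

lemma nabla_frm:
  assumes "homog (-2) x" "homog 2 y"
  shows "nabla (frm q x 0) = t11_sum (\<lambda>k. dfrm (x * cp k)) (\<lambda>k. frm q (bp k) 0)"
    and "nabla (frm q 0 y) = t11_sum (\<lambda>k. dfrm (y * cm k)) (\<lambda>k. frm q 0 (bm k))"
proof -
  have z: "sum3 (\<lambda>k. u * f k * beta k) = u * sum3 (\<lambda>k. f k * beta k)" for u f
    by (simp add: sum3_def algebra_simps)
  show "nabla (frm q x 0) = t11_sum (\<lambda>k. dfrm (x * cp k)) (\<lambda>k. frm q (bp k) 0)"
    unfolding frm_combination(1)[OF assms]
    by (rule nabla_combination[where G = "metric_mp q"])
      (use assms homog_triples in \<open>auto simp: nabla_basis metric_parts_closed z triple_identities
        intro!: frm_closed homog_intros\<close>)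
  show "nabla (frm q 0 y) = t11_sum (\<lambda>k. dfrm (y * cm k)) (\<lambda>k. frm q 0 (bm k))"
    unfolding frm_combination(2)[OF assms]
    by (rule nabla_combination[where G = "metric_pm q"])
      (use assms homog_triples in \<open>auto simp: nabla_basis metric_parts_closed z triple_identities
        intro!: frm_closed homog_intros\<close>)
qed

text \<open>After wedging, the Grassmann sums collapse by \<open>connection_identities\<close> and
  only derivatives of x and y remain. This cofactor-free form is what makes balancedness of the
  integrand verifiable.\<close>

lemma wedge_left_nabla:
  assumes "homog (-2) s" "homog 2 t" "homog (-2) x" "homog 2 y"
  shows "wedge_left q (frm q s t) (nabla (frm q x y)) = t21 q (ups q 1)
    (frm q (qs 4 (s * dif Em x) - qs 2 (t * dif Ep x)) (s * dif Em y - qs (-2) (t * dif Ep y)))"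
proof -
  have step: "wedge_left q (frm q s t) (t11_sum (\<lambda>k. dfrm (w k)) (\<lambda>k. frm q (f k) (g k))) =
      t21 q (ups q 1) (frm q (sum3 (\<lambda>k. (qs 2 (s * dif Em (w k)) - t * dif Ep (w k)) * f k))
        (sum3 (\<lambda>k. (qs 2 (s * dif Em (w k)) - t * dif Ep (w k)) * g k)))"
    if w: "\<And>k. k < 3 \<Longrightarrow> homog 0 (w k)" and f: "\<And>k. k < 3 \<Longrightarrow> homog (-2) (f k)"
      and g: "\<And>k. k < 3 \<Longrightarrow> homog 2 (g k)" for w f g
  proof -
    define h where "h k = qs 2 (s * dif Em (w k)) - t * dif Ep (w k)" for k
    have h: "homog 0 (h k)" if "k < 3" for k
      unfolding h_def using assms w[OF that] by (auto intro!: homog_intros)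
    have hf: "homog (-2) (h k * f k)" "homog 2 (h k * g k)" if "k < 3" for k
      using h f g that by (auto intro!: homog_intros)
    have cl: "t11 q (dfrm (w k)) (frm q (f k) (g k)) \<in> carrier (T11 q)" if "k < 3" for k
      by (intro T11.tens_closed dfrm_closed frm_closed w f g that)
    have summand: "wedge_left q (frm q s t) (t11 q (dfrm (w k)) (frm q (f k) (g k))) =
        t21 q (ups q 1) (frm q (h k * f k) (h k * g k))" if "k < 3" for k
    proof -
      have "homog (-2) (dif Ep (w k))" "homog 2 (dif Em (w k))"
        using w[OF that] by (auto intro!: homog_intros)
      then show ?thesis
        using assms f[OF that] g[OF that] h[OF that]
        by (simp add: dfrm_def wedge_left_t11 frm_closed t21_ups flip: h_def)
    qed
    show ?thesis
      unfolding t11_sum_def h_def[symmetric] sum3_def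
      by (simp add: wedge_left_add assms cl summand t21_add hf homog_add)
  qed
  have closed: "nabla (frm q x 0) \<in> carrier (T11 q)" "nabla (frm q 0 y) \<in> carrier (T11 q)"
    using assms by (auto intro!: nabla_closed frm_closed homog_zero)
  have split: "nabla (frm q x y) = nabla (frm q x 0) \<oplus>\<^bsub>T11 q\<^esub> nabla (frm q 0 y)"
    using nabla_add[of "frm q x 0" "frm q 0 y"] assms by (simp add: Om1_calc frm_closed homog_zero)
  have e: "sum3 (\<lambda>k. (qs 2 (s * dif Em (w k)) - t * dif Ep (w k)) * f k) =
      qs 2 (s * sum3 (\<lambda>k. dif Em (w k) * f k)) - t * sum3 (\<lambda>k. dif Ep (w k) * f k)" for w f
    by (simp add: sum3_def algebra_simps)
  have "wedge_left q (frm q s t) (nabla (frm q x 0)) =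
      t21 q (ups q 1) (frm q (qs 4 (s * dif Em x) - qs 2 (t * dif Ep x)) 0)"
    unfolding nabla_frm[OF assms(3,4)]
    by (subst step) (use assms homog_triples in \<open>auto simp: e connection_identities sum3_def[of "\<lambda>_. 0"]
        simp del: dif_mult intro!: homog_intros\<close>)
  moreover have "wedge_left q (frm q s t) (nabla (frm q 0 y)) =
      t21 q (ups q 1) (frm q 0 (s * dif Em y - qs (-2) (t * dif Ep y)))"
    unfolding nabla_frm[OF assms(3,4)]
    by (subst step) (use assms homog_triples in \<open>auto simp: e connection_identities sum3_def[of "\<lambda>_. 0"]
        simp del: dif_mult intro!: homog_intros\<close>)
  moreover have "homog (-2) (qs 4 (s * dif Em x) - qs 2 (t * dif Ep x))"
    "homog 2 (s * dif Em y - qs (-2) (t * dif Ep y))"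
    using assms by (auto intro!: homog_intros)
  ultimately show ?thesis
    using assms by (simp add: split wedge_left_add closed t21_add homog_zero)
qed

section \<open>The curvature as a lifted map\<close>

abbreviation riemann_integrand where
  "riemann_integrand \<sigma> \<eta> \<equiv> wedge_left q \<sigma> (nabla \<eta>) \<ominus>\<^bsub>T21 q\<^esub> t21 q (d1 q \<sigma>) \<eta>"

lemma riemann_integrand_frm:
  assumes "homog (-2) s" "homog 2 t" "homog (-2) x" "homog 2 y"
  shows "riemann_integrand (frm q s t) (frm q x y) = t21 q (ups q 1) (riemann_form s t x y)"
proof -
  have "homog 0 (dif Ep t - qs 2 (dif Em s))" using assms by (auto intro!: homog_intros)
  then have "t21 q (d1 q (frm q s t)) (frm q x y) = t21 q (ups q 1)
      (frm q ((dif Ep t - qs 2 (dif Em s)) * x) ((dif Ep t - qs 2 (dif Em s)) * y))"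
    using assms by (simp add: d1_frm t21_ups del: left_diff_distrib)
  then show ?thesis
    unfolding riemann_form_def wedge_left_nabla[OF assms]
    by (simp only:) (rule t21_minus; use assms in \<open>auto intro!: homog_intros\<close>)
qed

text \<open>The last axiom is the delicate one: d of \<sigma> n on one side and \<open>nabla\<close>
  of n \<eta> on the other both produce \<sigma> wedged with d n. In the difference these terms
  match once the twists of homogeneous coefficients are made explicit.\<close>

lemma riemann_balanced: "balanced_map (S2 q) (Om1 q) (Om1 q) (T21 q) riemann_integrand"
proof (rule balanced_mapI)
  note closed = T21.tens_closed[OF ups_closed[OF homog_one] riemann_form_closed]
  note add = T21.tens_add_right[OF ups_closed[OF homog_one] riemann_form_closed riemann_form_closed, symmetric]
  show "riemann_integrand x y \<in> carrier (T21 q)"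
    if "x \<in> carrier (Om1 q)" "y \<in> carrier (Om1 q)" for x y
    using that by (elim Om1_cases) (simp add: riemann_integrand_frm closed)
  show "riemann_integrand (x \<oplus>\<^bsub>Om1 q\<^esub> x') y = riemann_integrand x y \<oplus>\<^bsub>T21 q\<^esub> riemann_integrand x' y"
    if "x \<in> carrier (Om1 q)" "x' \<in> carrier (Om1 q)" "y \<in> carrier (Om1 q)" for x x' y
    using that
    by (elim Om1_cases)
      (simp add: Om1_calc riemann_integrand_frm homog_add add, simp add: riemann_form_def Om1_calc algebra_simps)
  show "riemann_integrand x (y \<oplus>\<^bsub>Om1 q\<^esub> y') = riemann_integrand x y \<oplus>\<^bsub>T21 q\<^esub> riemann_integrand x y'"
    if "x \<in> carrier (Om1 q)" "y \<in> carrier (Om1 q)" "y' \<in> carrier (Om1 q)" for x y y'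
    using that
    by (elim Om1_cases)
      (simp add: Om1_calc riemann_integrand_frm homog_add add, simp add: riemann_form_def Om1_calc algebra_simps)
  show "riemann_integrand (x \<odot>r\<^bsub>Om1 q\<^esub> m) y = riemann_integrand x (m \<odot>\<^bsub>Om1 q\<^esub> y)"
    if "x \<in> carrier (Om1 q)" "m \<in> carrier (S2 q)" "y \<in> carrier (Om1 q)" for x m y
  proof -
    from that(1) obtain s t where "homog (-2) s" "homog 2 t" and x: "x = frm q s t" by (rule Om1_cases)
    moreover from that(3) obtain a b where "homog (-2) a" "homog 2 b" and y: "y = frm q a b" by (rule Om1_cases)
    moreover from that(2) obtain n where "homog 0 n" and m: "m = ev q n" by (rule S2_cases)
    ultimately have h: "homog (-2) s" "homog 2 t" "homog (-2) a" "homog 2 b" "homog 0 n"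
      "homog (-2) (s * n)" "homog 2 (t * n)" "homog (-2) (n * a)" "homog 2 (n * b)"
      by (auto intro!: homog_intros)
    have "riemann_form (s * n) (t * n) a b = riemann_form s t (n * a) (n * b)"
      by (simp add: riemann_form_def sg_homog[OF h(3)] sg_homog[OF h(4)] sg_homog[OF h(5)] algebra_simps)
    then show ?thesis
      by (simp add: x y m Om1_calc h riemann_integrand_frm)
  qed
qed

text \<open>The first factors are exact, so d d = 0 removes the contribution of \<open>d1\<close>.
  In \<open>dif_dif\<close> this rests on the derivative along e0 vanishing in degree 0.\<close>

lemma Riemann_t11_sum:
  assumes w: "\<And>k. k < 3 \<Longrightarrow> homog 0 (w k)" and f: "\<And>k. k < 3 \<Longrightarrow> homog (-2) (f k)"
    and g: "\<And>k. k < 3 \<Longrightarrow> homog 2 (g k)"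
  shows "tensor_lift (T21 q) riemann_integrand (t11_sum (\<lambda>k. dfrm (w k)) (\<lambda>k. frm q (f k) (g k))) =
    t21 q (ups q 1) (frm q
      (sum3 (\<lambda>k. qs 4 (dif Ep (w k) * dif Em (f k)) - qs 2 (dif Em (w k) * dif Ep (f k))))
      (sum3 (\<lambda>k. dif Ep (w k) * dif Em (g k) - qs (-2) (dif Em (w k) * dif Ep (g k)))))"
proof -
  note lift = T11.tensor_lift_add[OF abelian_group_T21 riemann_balanced]
    T11.tensor_lift_tens[OF abelian_group_T21 riemann_balanced]
  have cl: "dfrm (w k) \<in> carrier (Om1 q)" "frm q (f k) (g k) \<in> carrier (Om1 q)"
    "t11 q (dfrm (w k)) (frm q (f k) (g k)) \<in> carrier (T11 q)" if "k < 3" for k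
    by (intro T11.tens_closed dfrm_closed frm_closed w f g that)+
  have h: "homog (-2) (qs 4 (dif Ep (w k) * dif Em (f k)) - qs 2 (dif Em (w k) * dif Ep (f k)))"
    "homog 2 (dif Ep (w k) * dif Em (g k) - qs (-2) (dif Em (w k) * dif Ep (g k)))"
    if "k < 3" for k
    using w[OF that] f[OF that] g[OF that] by (auto intro!: homog_intros)
  have "riemann_integrand (dfrm (w k)) (frm q (f k) (g k)) = t21 q (ups q 1)
      (frm q (qs 4 (dif Ep (w k) * dif Em (f k)) - qs 2 (dif Em (w k) * dif Ep (f k)))
        (dif Ep (w k) * dif Em (g k) - qs (-2) (dif Em (w k) * dif Ep (g k))))" if "k < 3" for k
  proof -
    have d: "homog (-2) (dif Ep (w k))" "homog 2 (dif Em (w k))"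
      using w[OF that] by (auto intro!: homog_intros)
    have "dif Ep (dif Em (w k)) - qs 2 (dif Em (dif Ep (w k))) = 0"
      using dif_vertical(1)[OF w[OF that]] by (simp add: dif_dif)
    then have "riemann_form (dif Ep (w k)) (dif Em (w k)) (f k) (g k) =
        frm q (qs 4 (dif Ep (w k) * dif Em (f k)) - qs 2 (dif Em (w k) * dif Ep (f k)))
        (dif Ep (w k) * dif Em (g k) - qs (-2) (dif Em (w k) * dif Ep (g k)))"
      unfolding riemann_form_def by simp
    then show ?thesis
      using riemann_integrand_frm[OF d f[OF that] g[OF that]] by (simp add: dfrm_def)
  qed
  then show ?thesis
    unfolding t11_sum_def sum3_def by (simp add: lift cl t21_add h homog_add)
qed

lemma Riemann_frm:
  assumes "homog (-2) x" "homog 2 y"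
  shows "Riemann q nabla (frm q x y) = t21 q (ups q 1) (frm q (- qs 4 (tw x)) (tw y))"
proof -
  have closed: "nabla (frm q x 0) \<in> carrier (T11 q)" "nabla (frm q 0 y) \<in> carrier (T11 q)"
    using assms by (auto intro!: nabla_closed frm_closed homog_zero)
  have split: "nabla (frm q x y) = nabla (frm q x 0) \<oplus>\<^bsub>T11 q\<^esub> nabla (frm q 0 y)"
    using nabla_add[of "frm q x 0" "frm q 0 y"] assms by (simp add: Om1_calc frm_closed homog_zero)
  have "tensor_lift (T21 q) riemann_integrand (nabla (frm q x 0)) = t21 q (ups q 1) (frm q (- qs 4 (tw x)) 0)"
    unfolding nabla_frm[OF assms]
    by (subst Riemann_t11_sum) (use assms homog_triples in \<open>auto simp: curvature_identities sum3_def[of "\<lambda>_. 0"]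
        simp del: dif_mult intro!: homog_intros\<close>)
  moreover have "tensor_lift (T21 q) riemann_integrand (nabla (frm q 0 y)) = t21 q (ups q 1) (frm q 0 (tw y))"
    unfolding nabla_frm[OF assms]
    by (subst Riemann_t11_sum) (use assms homog_triples in \<open>auto simp: curvature_identities sum3_def[of "\<lambda>_. 0"]
        simp del: dif_mult intro!: homog_intros\<close>)
  ultimately show ?thesis
    unfolding Riemann_def split T11.tensor_lift_add[OF abelian_group_T21 riemann_balanced closed]
    using assms by (simp add: t21_add homog_intros tw_def)
qed

end

section \<open>The metric, the lift and the Ricci tensor\<close>

context sphere
begin

text \<open>Up to a power of q this is (z e+ + z' e-) \<otimes> e+. As e+ alone is not a form on the
  sphere, the partition of unity given by \<open>cp\<close> and \<open>bp\<close> spreads it over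
  genuine tensors; \<open>Xm\<close> does the same for e-.\<close>

definition Xp :: "qsl \<Rightarrow> qsl \<Rightarrow> ((form1 \<times> form1) \<Rightarrow>\<^sub>0 int) set" where
  "Xp z z' = t11_sum (\<lambda>k. frm q (z * cp k) (z' * cp k)) (\<lambda>k. frm q (bp k) 0)"

definition Xm :: "qsl \<Rightarrow> qsl \<Rightarrow> ((form1 \<times> form1) \<Rightarrow>\<^sub>0 int) set" where
  "Xm z z' = t11_sum (\<lambda>k. frm q (z * cm k) (z' * cm k)) (\<lambda>k. frm q 0 (bm k))"

lemma X_factors:
  assumes "k < 3"
  shows "homog (-4) z \<Longrightarrow> homog 0 z' \<Longrightarrow> frm q (z * cp k) (z' * cp k) \<in> carrier (Om1 q)"
    and "homog 0 z \<Longrightarrow> homog 4 z' \<Longrightarrow> frm q (z * cm k) (z' * cm k) \<in> carrier (Om1 q)"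
    and "frm q (bp k) 0 \<in> carrier (Om1 q)" "frm q 0 (bm k) \<in> carrier (Om1 q)"
  using homog_triples[OF assms] by (auto intro!: frm_closed homog_intros)

lemma X_closed:
  "homog (-4) z \<Longrightarrow> homog 0 z' \<Longrightarrow> Xp z z' \<in> carrier (T11 q)"
  "homog 0 z \<Longrightarrow> homog 4 z' \<Longrightarrow> Xm z z' \<in> carrier (T11 q)"
  unfolding Xp_def Xm_def by (intro t11_sum_closed; simp add: X_factors)+

lemma t11_sum_add:
  assumes "\<And>k. k < 3 \<Longrightarrow> \<sigma> k \<in> carrier (Om1 q)" "\<And>k. k < 3 \<Longrightarrow> \<sigma>' k \<in> carrier (Om1 q)"
    "\<And>k. k < 3 \<Longrightarrow> \<eta> k \<in> carrier (Om1 q)"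
  shows "t11_sum (\<lambda>k. \<sigma> k \<oplus>\<^bsub>Om1 q\<^esub> \<sigma>' k) \<eta> = t11_sum \<sigma> \<eta> \<oplus>\<^bsub>T11 q\<^esub> t11_sum \<sigma>' \<eta>"
proof -
  have "t11 q (\<sigma> k) (\<eta> k) \<in> carrier (T11 q)" "t11 q (\<sigma>' k) (\<eta> k) \<in> carrier (T11 q)" if "k < 3" for k
    using assms that by (auto intro: T11.tens_closed)
  then show ?thesis
    unfolding t11_sum_def by (simp add: T11.tens_add_left assms T11.T.a_ac)
qed

lemma X_add:
  "homog (-4) z \<Longrightarrow> homog 0 z' \<Longrightarrow> homog (-4) w \<Longrightarrow> homog 0 w' \<Longrightarrow>
    Xp (z + w) (z' + w') = Xp z z' \<oplus>\<^bsub>T11 q\<^esub> Xp w w'"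
  "homog 0 z \<Longrightarrow> homog 4 z' \<Longrightarrow> homog 0 w \<Longrightarrow> homog 4 w' \<Longrightarrow>
    Xm (z + w) (z' + w') = Xm z z' \<oplus>\<^bsub>T11 q\<^esub> Xm w w'"
  unfolding Xp_def Xm_def
  by (subst t11_sum_add[symmetric]; simp add: X_factors Om1_calc distrib_right)+

lemma t11_smult_right:
  assumes "homog 0 w" "homog (-2) s" "homog 2 t" "\<eta> \<in> carrier (Om1 q)"
  shows "t11 q (frm q s t) (ev q w \<odot>\<^bsub>Om1 q\<^esub> \<eta>) = t11 q (frm q (s * w) (t * w)) \<eta>"
  using T11.tens_balanced[of "frm q s t" "ev q w" \<eta>] assms by (simp add: Om1_calc frm_closed ev_S2)

lemma t11_smult_left:
  assumes "homog 0 w" "homog (-2) s" "homog 2 t" "\<eta> \<in> carrier (Om1 q)"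
  shows "ev q w \<odot>\<^bsub>T11 q\<^esub> t11 q (frm q s t) \<eta> = t11 q (frm q (w * s) (w * t)) \<eta>"
  using T11.smult_tens[of "ev q w" "frm q s t" \<eta>] assms by (simp add: Om1_calc frm_closed ev_S2)

lemma t11_combination:
  assumes s: "homog (-2) s" "homog 2 t" and w: "\<And>k. k < 3 \<Longrightarrow> homog 0 (w k)"
    and \<eta>: "\<And>k. k < 3 \<Longrightarrow> \<eta> k \<in> carrier (Om1 q)"
  shows "t11 q (frm q s t)
      (ev q (w 0) \<odot>\<^bsub>Om1 q\<^esub> \<eta> 0 \<oplus>\<^bsub>Om1 q\<^esub> ev q (w 1) \<odot>\<^bsub>Om1 q\<^esub> \<eta> 1 \<oplus>\<^bsub>Om1 q\<^esub> ev q (w 2) \<odot>\<^bsub>Om1 q\<^esub> \<eta> 2) =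
    t11_sum (\<lambda>k. frm q (s * w k) (t * w k)) \<eta>"
proof -
  have "ev q (w k) \<odot>\<^bsub>Om1 q\<^esub> \<eta> k \<in> carrier (Om1 q)" if "k < 3" for k
    by (intro Om1.smult_closed ev_S2 w \<eta> that)
  then show ?thesis
    using s by (simp add: t11_sum_def T11.tens_add_right frm_closed t11_smult_right w \<eta>)
qed

text \<open>
  Balancing moves the coefficient of the second factor into the first, so that only products
  of coefficients remain.
\<close>

lemma t11_normal_form:
  assumes "homog (-2) s" "homog 2 t" "homog (-2) x" "homog 2 y"
  shows "t11 q (frm q s t) (frm q x y) = Xp (s * x) (t * x) \<oplus>\<^bsub>T11 q\<^esub> Xm (s * y) (t * y)"
proof -
  have "homog 0 (x * cp k)" "homog 0 (y * cm k)" if "k < 3" for k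
    using assms homog_triples[OF that] by (auto intro!: homog_intros)
  then have "t11 q (frm q s t) (frm q x 0) = Xp (s * x) (t * x)"
    "t11 q (frm q s t) (frm q 0 y) = Xm (s * y) (t * y)"
    unfolding frm_combination[OF assms(3,4)]
    using t11_combination[OF assms(1,2), of "\<lambda>k. x * cp k" "\<lambda>k. frm q (bp k) 0"]
      t11_combination[OF assms(1,2), of "\<lambda>k. y * cm k" "\<lambda>k. frm q 0 (bm k)"]
    by (simp_all add: X_factors Xp_def Xm_def mult.assoc)
  then show ?thesis
    using T11.tens_add_right[of "frm q s t" "frm q x 0" "frm q 0 y"] assms
    by (simp add: Om1_calc frm_closed homog_zero)
qed

lemma t11_uminus:
  assumes "homog (-2) s" "homog 2 t" "\<eta> \<in> carrier (Om1 q)"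
  shows "\<ominus>\<^bsub>T11 q\<^esub> t11 q (frm q s t) \<eta> = t11 q (frm q (- s) (- t)) \<eta>"
proof (rule T11.T.minus_equality)
  have "t11 q (frm q (- s) (- t) \<oplus>\<^bsub>Om1 q\<^esub> frm q s t) \<eta> = \<zero>\<^bsub>T11 q\<^esub>"
    using T11.tens_zero_left[OF assms(3)] by (simp add: Om1_calc)
  then show "t11 q (frm q (- s) (- t)) \<eta> \<oplus>\<^bsub>T11 q\<^esub> t11 q (frm q s t) \<eta> = \<zero>\<^bsub>T11 q\<^esub>"
    using assms by (simp add: T11.tens_add_left frm_closed homog_uminus)
qed (use assms in \<open>auto intro!: T11.tens_closed frm_closed homog_uminus\<close>)

text \<open>The coefficients of the metric are those of the cofactors. Hence its e+ e+ and e- e-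
  parts vanish like the mixed sums in \<open>triple_identities\<close>, and the two remaining parts
  are the partitions of unity, with factors 1 and q^2.\<close>

lemma metric_normal_form: "metric q = Xp 0 (qs 2 1) \<oplus>\<^bsub>T11 q\<^esub> Xm 1 0"
proof -
  have sc2: "sc q (q ^ 2) = ev q (qs 2 1)" using sc_ev[of 2] by simp
  have sct: "sc q (qtwo q) = ev q (tw 1)" using ev_tw[of 1] by (simp add: ev_simps sc_closed)
  have tw: "tw 1 * x = tw x" for x by (simp add: tw_def algebra_simps)
  have h: "homog (-2) (bp k)" "homog 2 (bm k)" "homog (-2) (tw (bp k))" "homog 2 (tw (bm k))"
    if "k < 3" for k
    using homog_triples[OF that] by (auto simp: tw_def intro!: homog_intros)
  have h0: "homog 0 (qs 2 1)" "homog 0 (tw 1)"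
    by (auto simp: tw_def intro!: homog_intros homog_one)
  \<comment> \<open>\<open>S\<close> and \<open>U\<close> list the e+ coefficients of the first and
    second factors in the three metric terms, \<open>S'\<close> and \<open>U'\<close> those of e-;
    the constants q^2, 1, -[2] are absorbed into the first factors.\<close>
  define S where "S k = [qs 2 (bp 1), bp 0, - tw (bp 2)] ! k" for k
  define S' where "S' k = [qs 2 (bm 1), bm 0, - tw (bm 2)] ! k" for k
  define U where "U k = [bp 0, bp 1, bp 2] ! k" for k
  define U' where "U' k = [bm 0, bm 1, bm 2] ! k" for k
  have hS: "homog (-2) (S k)" "homog 2 (S' k)" "homog (-2) (U k)" "homog 2 (U' k)" if "k < 3" for k
    using less_3_cases[OF that] h
    by (auto simp: S_def S'_def U_def U'_def nth_Cons_Suc numeral_2_eq_2 intro!: homog_qs homog_uminus)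
  have hp: "homog (-4) (S k * U k)" "homog 0 (S' k * U k)" "homog 0 (S k * U' k)" "homog 4 (S' k * U' k)"
    if "k < 3" for k
    using hS[OF that] by (auto intro!: homog_intros)
  have vals: "S 0 = qs 2 (bp 1)" "S 1 = bp 0" "S 2 = - tw (bp 2)"
    "S' 0 = qs 2 (bm 1)" "S' 1 = bm 0" "S' 2 = - tw (bm 2)"
    "U 0 = bp 0" "U 1 = bp 1" "U 2 = bp 2" "U' 0 = bm 0" "U' 1 = bm 1" "U' 2 = bm 2"
    by (simp_all add: S_def S'_def U_def U'_def numeral_2_eq_2)
  have "metric q = t11_sum (\<lambda>k. frm q (S k) (S' k)) (\<lambda>k. frm q (U k) (U' k))"
    unfolding metric_def b_ev sc2 sct t11_sum_def vals
    by (simp add: d0_bb less_3_simps t11_smult_left t11_uminus frm_closed h h0 tw a_minus_def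
        del: One_nat_def)
  also have "\<dots> = (Xp (S 0 * U 0) (S' 0 * U 0) \<oplus>\<^bsub>T11 q\<^esub> Xm (S 0 * U' 0) (S' 0 * U' 0)) \<oplus>\<^bsub>T11 q\<^esub>
      (Xp (S 1 * U 1) (S' 1 * U 1) \<oplus>\<^bsub>T11 q\<^esub> Xm (S 1 * U' 1) (S' 1 * U' 1)) \<oplus>\<^bsub>T11 q\<^esub>
      (Xp (S 2 * U 2) (S' 2 * U 2) \<oplus>\<^bsub>T11 q\<^esub> Xm (S 2 * U' 2) (S' 2 * U' 2))"
    by (simp add: t11_sum_def t11_normal_form hS)
  also have "\<dots> = Xp (sum3 (\<lambda>k. S k * U k)) (sum3 (\<lambda>k. S' k * U k)) \<oplus>\<^bsub>T11 q\<^esub>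
      Xm (sum3 (\<lambda>k. S k * U' k)) (sum3 (\<lambda>k. S' k * U' k))"
    unfolding sum3_def
    by (simp add: X_add hp homog_add X_closed T11.T.a_ac)
  finally have "metric q = Xp (sum3 (\<lambda>k. S k * U k)) (sum3 (\<lambda>k. S' k * U k)) \<oplus>\<^bsub>T11 q\<^esub>
      Xm (sum3 (\<lambda>k. S k * U' k)) (sum3 (\<lambda>k. S' k * U' k))" .
  moreover have "sum3 (\<lambda>k. S k * U k) = 0" "sum3 (\<lambda>k. S' k * U k) = qs 2 1"
    "sum3 (\<lambda>k. S k * U' k) = 1" "sum3 (\<lambda>k. S' k * U' k) = 0"
    by (simp_all add: sum3_def S_def S'_def U_def U'_def triple_simps nf algebra_simps)
  ultimately show ?thesis by simp
qed

lemma map11_X: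
  assumes h: "scales c c' h"
  shows "homog (-4) z \<Longrightarrow> homog 0 z' \<Longrightarrow> map11 q (\<lambda>x. x) h (Xp z z') = sc q c \<odot>\<^bsub>T11 q\<^esub> Xp z z'"
    and "homog 0 z \<Longrightarrow> homog 4 z' \<Longrightarrow> map11 q (\<lambda>x. x) h (Xm z z') = sc q c' \<odot>\<^bsub>T11 q\<^esub> Xm z z'"
proof -
  note bal = map11_balanced[OF scales_hom[OF scales_maps(4)] scales_hom[OF h]]
  have ev_c: "sc q a = ev q (kc a)" for a by (simp add: ev_kc q_nz)
  have step: "map11 q (\<lambda>x. x) h (t11_sum (\<lambda>k. frm q (s k) (t k)) \<eta>) =
      sc q a \<odot>\<^bsub>T11 q\<^esub> t11_sum (\<lambda>k. frm q (s k) (t k)) \<eta>"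
    if s: "\<And>k. k < 3 \<Longrightarrow> homog (-2) (s k)" and t: "\<And>k. k < 3 \<Longrightarrow> homog 2 (t k)"
      and \<eta>: "\<And>k. k < 3 \<Longrightarrow> \<eta> k \<in> carrier (Om1 q)"
      and a: "\<And>k. k < 3 \<Longrightarrow> h (\<eta> k) = ev q (kc a) \<odot>\<^bsub>Om1 q\<^esub> \<eta> k" for s t \<eta> a
  proof -
    have cl: "t11 q (frm q (s k) (t k)) (\<eta> k) \<in> carrier (T11 q)" "frm q (s k) (t k) \<in> carrier (Om1 q)"
      if "k < 3" for k
      by (intro T11.tens_closed frm_closed s t \<eta> that)+
    have "t11 q (frm q (s k) (t k)) (h (\<eta> k)) = sc q a \<odot>\<^bsub>T11 q\<^esub> t11 q (frm q (s k) (t k)) (\<eta> k)" if "k < 3" for k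
      using that by (simp add: a t11_smult_right t11_smult_left homog_kc s t \<eta> ev_c kc_commute)
    then show ?thesis
      unfolding map11_def t11_sum_def
      by (simp add: T11.tensor_lift_add[OF abelian_group_T11 bal] T11.tensor_lift_tens[OF abelian_group_T11 bal]
          cl \<eta> T11.T_smult_add T11.T_smult_closed sc_S2)
  qed
  show "homog (-4) z \<Longrightarrow> homog 0 z' \<Longrightarrow> map11 q (\<lambda>x. x) h (Xp z z') = sc q c \<odot>\<^bsub>T11 q\<^esub> Xp z z'"
    unfolding Xp_def
    by (rule step) (use homog_triples in \<open>auto simp: Om1_calc scalesD[OF h] homog_zero X_factors intro!: homog_intros\<close>)
  show "homog 0 z \<Longrightarrow> homog 4 z' \<Longrightarrow> map11 q (\<lambda>x. x) h (Xm z z') = sc q c' \<odot>\<^bsub>T11 q\<^esub> Xm z z'"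
    unfolding Xm_def
    by (rule step) (use homog_triples in \<open>auto simp: Om1_calc scalesD[OF h] homog_zero X_factors intro!: homog_intros\<close>)
qed

text \<open>\<open>P\<close> is the half g_{+-} of the metric, \<open>N\<close> the half
  g_{-+}.\<close>

definition P :: "((form1 \<times> form1) \<Rightarrow>\<^sub>0 int) set" where "P = Xm 1 0"
definition N :: "((form1 \<times> form1) \<Rightarrow>\<^sub>0 int) set" where "N = Xp 0 (qs 2 1)"

lemma PN_closed: "P \<in> carrier (T11 q)" "N \<in> carrier (T11 q)"
  unfolding P_def N_def by (intro X_closed homog_zero homog_one homog_qs)+

text \<open>Coordinates in the span of the two metric halves, the one of g_{-+} first. Maps that
  scale the second factor are diagonal here, which reduces the Ricci tensor to arithmetic with two
  numbers.\<close>

definition pn :: "complex \<Rightarrow> complex \<Rightarrow> ((form1 \<times> form1) \<Rightarrow>\<^sub>0 int) set" where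
  "pn c c' = sc q c \<odot>\<^bsub>T11 q\<^esub> N \<oplus>\<^bsub>T11 q\<^esub> sc q c' \<odot>\<^bsub>T11 q\<^esub> P"

lemma pn_closed: "pn c c' \<in> carrier (T11 q)"
  unfolding pn_def by (intro T11.T.a_closed T11.T_smult_closed sc_S2 PN_closed)

lemma sc_smult_sc: "t \<in> carrier (T11 q) \<Longrightarrow> sc q a \<odot>\<^bsub>T11 q\<^esub> (sc q b \<odot>\<^bsub>T11 q\<^esub> t) = sc q (a * b) \<odot>\<^bsub>T11 q\<^esub> t"
  using T11.T_mult_smult[OF sc_S2 sc_S2, of t a b] by (simp add: S2_simps sc_mult)

lemma sc_add_smult: "t \<in> carrier (T11 q) \<Longrightarrow>
    sc q (a + b) \<odot>\<^bsub>T11 q\<^esub> t = sc q a \<odot>\<^bsub>T11 q\<^esub> t \<oplus>\<^bsub>T11 q\<^esub> sc q b \<odot>\<^bsub>T11 q\<^esub> t"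
  using T11.T_add_smult[OF sc_S2 sc_S2, of t a b] by (simp add: S2_simps sc_add)

lemma pn_smult: "sc q a \<odot>\<^bsub>T11 q\<^esub> pn c c' = pn (a * c) (a * c')"
  unfolding pn_def by (simp add: T11.T_smult_add T11.T_smult_closed sc_S2 PN_closed sc_smult_sc)

lemma pn_add: "pn c c' \<oplus>\<^bsub>T11 q\<^esub> pn b b' = pn (c + b) (c' + b')"
  unfolding pn_def by (simp add: sc_add_smult PN_closed T11.T_smult_closed sc_S2 T11.T.a_ac)

lemma pn_uminus: "\<ominus>\<^bsub>T11 q\<^esub> pn c c' = pn (- c) (- c')"
proof (rule T11.T.minus_equality)
  have "pn 0 0 = \<zero>\<^bsub>T11 q\<^esub>"
    unfolding pn_def
    using T11.T_zero_smult[OF PN_closed(1)] T11.T_zero_smult[OF PN_closed(2)] by (simp add: S2_simps sc_zero)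
  then show "pn (- c) (- c') \<oplus>\<^bsub>T11 q\<^esub> pn c c' = \<zero>\<^bsub>T11 q\<^esub>" by (simp add: pn_add)
qed (rule pn_closed)+

lemma metric_pn: "metric q = pn 1 1"
  unfolding pn_def metric_normal_form P_def[symmetric] N_def[symmetric]
  using T11.T_one_smult[OF PN_closed(1)] T11.T_one_smult[OF PN_closed(2)] by (simp add: S2_simps sc_one)

lemma map11_pn:
  assumes h: "scales c c' h"
  shows "map11 q (\<lambda>x. x) h (pn a a') = pn (c * a) (c' * a')"
proof -
  note bal = map11_balanced[OF scales_hom[OF scales_maps(4)] scales_hom[OF h]]
  have smult: "map11 q (\<lambda>x. x) h (sc q b \<odot>\<^bsub>T11 q\<^esub> t) = sc q b \<odot>\<^bsub>T11 q\<^esub> map11 q (\<lambda>x. x) h t"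
    if "t \<in> carrier (T11 q)" for b t
    unfolding map11_def
    by (rule T11.tensor_lift_smult[OF abelian_group_T11 bal sc_S2 that])
      (simp_all add: T11.smult_tens sc_S2 bimodule_homD[OF scales_hom[OF h]] T11.T_smult_add)
  have add: "map11 q (\<lambda>x. x) h (t \<oplus>\<^bsub>T11 q\<^esub> u) = map11 q (\<lambda>x. x) h t \<oplus>\<^bsub>T11 q\<^esub> map11 q (\<lambda>x. x) h u"
    if "t \<in> carrier (T11 q)" "u \<in> carrier (T11 q)" for t u
    unfolding map11_def by (rule T11.tensor_lift_add[OF abelian_group_T11 bal that])
  have "map11 q (\<lambda>x. x) h P = sc q c' \<odot>\<^bsub>T11 q\<^esub> P" "map11 q (\<lambda>x. x) h N = sc q c \<odot>\<^bsub>T11 q\<^esub> N"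
    unfolding P_def N_def by (intro map11_X[OF h] homog_zero homog_one homog_qs)+
  then show ?thesis
    unfolding pn_def
    by (simp add: add smult PN_closed T11.T_smult_closed sc_S2 sc_smult_sc mult.commute)
qed

text \<open>Acting on the second factor, the Hodge operator is 1 on g_{-+} and -1 on g_{+-}. With r
  = q^(-4) the bracket in the lift therefore has weights -1 + (1 - r)/(1 + r) and 1 + (1 - r)/(1 +
  r).\<close>

lemma lift_value_pn:
  assumes "qtwo q \<noteq> 0" "1 + q powi (-4) \<noteq> 0"
  shows "lift_value q = pn (- (2 * q powi (-4) * inverse q / (qtwo q * (1 + q powi (-4)))))
    (2 * inverse q / (qtwo q * (1 + q powi (-4))))"
proof -
  define r where "r = q powi (-4)"
  have "lift_value q = pn (inverse q / qtwo q * (-1 + (1 - r) / (1 + r))) (inverse q / qtwo q * (1 + (1 - r) / (1 + r)))"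
    unfolding lift_value_def metric_pn map11_pn[OF scales_maps(3)] r_def
    by (simp add: pn_smult pn_uminus pn_add)
  moreover have "inverse q / qtwo q * (-1 + (1 - r) / (1 + r)) = - (2 * r * inverse q / (qtwo q * (1 + r)))"
    "inverse q / qtwo q * (1 + (1 - r) / (1 + r)) = 2 * inverse q / (qtwo q * (1 + r))"
    using assms q_nz unfolding r_def[symmetric] by (simp_all add: field_simps)
  ultimately show ?thesis by (simp add: r_def)
qed

section \<open>The wedge product on the metric halves\<close>

lemma wedge_map_balanced: "balanced_map (S2 q) (Om1 q) (Om1 q) (Om2 q) (wedge q)"
proof (rule balanced_mapI)
  show "wedge q x y \<in> carrier (Om2 q)" if "x \<in> carrier (Om1 q)" "y \<in> carrier (Om1 q)" for x y
    using that by (elim Om1_cases) (auto simp: wedge_frm intro!: ups_closed homog_intros)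
  show "wedge q (x \<oplus>\<^bsub>Om1 q\<^esub> x') y = wedge q x y \<oplus>\<^bsub>Om2 q\<^esub> wedge q x' y"
    if "x \<in> carrier (Om1 q)" "x' \<in> carrier (Om1 q)" "y \<in> carrier (Om1 q)" for x x' y
    using that by (elim Om1_cases) (simp add: Om1_calc Om2_calc wedge_frm homog_add algebra_simps)
  show "wedge q x (y \<oplus>\<^bsub>Om1 q\<^esub> y') = wedge q x y \<oplus>\<^bsub>Om2 q\<^esub> wedge q x y'"
    if "x \<in> carrier (Om1 q)" "y \<in> carrier (Om1 q)" "y' \<in> carrier (Om1 q)" for x y y'
    using that by (elim Om1_cases) (simp add: Om1_calc Om2_calc wedge_frm homog_add algebra_simps)
  show "wedge q (x \<odot>r\<^bsub>Om1 q\<^esub> m) y = wedge q x (m \<odot>\<^bsub>Om1 q\<^esub> y)"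
    if "x \<in> carrier (Om1 q)" "m \<in> carrier (S2 q)" "y \<in> carrier (Om1 q)" for x m y
    using that by (elim Om1_cases S2_cases) (simp add: Om1_calc Om2_calc wedge_frm homog_mult mult.assoc)
qed

lemma wedge_map_smult:
  assumes "m \<in> carrier (S2 q)" "t \<in> carrier (T11 q)"
  shows "wedge_map q (m \<odot>\<^bsub>T11 q\<^esub> t) = m \<odot>\<^bsub>Om2 q\<^esub> wedge_map q t"
  unfolding wedge_map_def
proof (rule T11.tensor_lift_smult[OF Om2.M.abelian_group_axioms wedge_map_balanced assms])
  show "wedge q (m \<odot>\<^bsub>Om1 q\<^esub> x) y = m \<odot>\<^bsub>Om2 q\<^esub> wedge q x y"
    if "x \<in> carrier (Om1 q)" "y \<in> carrier (Om1 q)" for x y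
    using that assms(1)
    by (elim Om1_cases S2_cases) (simp add: Om1_calc Om2_calc wedge_frm homog_mult algebra_simps)
qed (simp add: Om2.smult_add assms)

text \<open>The partitions of unity leave only commutation factors: q^2 from e+ past
  \<open>bm k\<close>; for \<open>N\<close> the exchange factor -q^2, the q^(-2) from e- past
  \<open>bp k\<close>, and the coefficient q^2.\<close>

lemma wedge_map_PN: "wedge_map q P = ups q (qs 2 1)" "wedge_map q N = ups q (- qs 2 1)"
proof -
  note lift = T11.tensor_lift_add[OF Om2.M.abelian_group_axioms wedge_map_balanced]
    T11.tensor_lift_tens[OF Om2.M.abelian_group_axioms wedge_map_balanced]
  have step: "wedge_map q (t11_sum (\<lambda>k. frm q (s k) (t k)) (\<lambda>k. frm q (f k) (g k))) =
      ups q (sum3 (\<lambda>k. qs 2 (s k * g k) - t k * f k))"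
    if h: "\<And>k. k < 3 \<Longrightarrow> homog (-2) (s k)" "\<And>k. k < 3 \<Longrightarrow> homog 2 (t k)"
      "\<And>k. k < 3 \<Longrightarrow> homog (-2) (f k)" "\<And>k. k < 3 \<Longrightarrow> homog 2 (g k)" for s t f g
    unfolding wedge_map_def t11_sum_def sum3_def
    by (simp add: lift T11.tens_closed frm_closed h wedge_frm Om2_calc)
  have "wedge_map q P = ups q (sum3 (\<lambda>k. qs 2 (cm k * bm k)))"
    unfolding P_def Xm_def
    by (subst step) (use homog_triples in \<open>auto intro!: homog_intros\<close>)
  then show "wedge_map q P = ups q (qs 2 1)"
    by (simp add: sum3_def triple_simps nf algebra_simps)
  have "wedge_map q N = ups q (sum3 (\<lambda>k. - (qs 2 (cp k * bp k))))"
    unfolding N_def Xp_def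
    by (subst step) (use homog_triples in \<open>auto intro!: homog_intros\<close>)
  then show "wedge_map q N = ups q (- qs 2 1)"
    by (simp add: sum3_def triple_simps nf algebra_simps)
qed

lemma wedge_map_pn: "wedge_map q (pn c c') = sc q (q ^ 2 * (c' - c)) \<odot>\<^bsub>Om2 q\<^esub> ups q 1"
proof -
  have add: "wedge_map q (t \<oplus>\<^bsub>T11 q\<^esub> u) = wedge_map q t \<oplus>\<^bsub>Om2 q\<^esub> wedge_map q u"
    if "t \<in> carrier (T11 q)" "u \<in> carrier (T11 q)" for t u
    unfolding wedge_map_def by (rule T11.tensor_lift_add[OF Om2.M.abelian_group_axioms wedge_map_balanced that])
  have u: "ups q 1 \<in> carrier (Om2 q)" by (rule ups_closed[OF homog_one])
  have sc2: "sc q (q ^ 2) = ev q (qs 2 1)" using sc_ev[of 2] by simp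
  have "ups q (qs 2 1) = sc q (q ^ 2) \<odot>\<^bsub>Om2 q\<^esub> ups q 1" "ups q (- qs 2 1) = sc q (- (q ^ 2)) \<odot>\<^bsub>Om2 q\<^esub> ups q 1"
    by (simp_all add: Om2_calc sc2 sc_uminus ev_simps(5)[symmetric] del: ev_simps)
  moreover have "sc q a \<odot>\<^bsub>Om2 q\<^esub> (sc q b \<odot>\<^bsub>Om2 q\<^esub> ups q 1) = sc q (a * b) \<odot>\<^bsub>Om2 q\<^esub> ups q 1" for a b
    using Om2.mult_smult[OF sc_S2 sc_S2 u] by (simp add: S2_simps sc_mult)
  moreover have "sc q a \<odot>\<^bsub>Om2 q\<^esub> ups q 1 \<oplus>\<^bsub>Om2 q\<^esub> sc q b \<odot>\<^bsub>Om2 q\<^esub> ups q 1 = sc q (a + b) \<odot>\<^bsub>Om2 q\<^esub> ups q 1" for a b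
    using Om2.add_smult[OF sc_S2 sc_S2 u] by (simp add: S2_simps sc_add)
  ultimately have "wedge_map q (pn c c') = sc q (c * - (q ^ 2) + c' * q ^ 2) \<odot>\<^bsub>Om2 q\<^esub> ups q 1"
    unfolding pn_def
    by (simp only: add T11.T_smult_closed sc_S2 PN_closed wedge_map_smult wedge_map_PN)
  moreover have "c * - (q ^ 2) + c' * q ^ 2 = q ^ 2 * (c' - c)" by (simp add: algebra_simps)
  ultimately show ?thesis by simp
qed

text \<open>Multiplying the second factor by the e+ e- coefficient of the first is balanced and
  inverts \<eta> \<mapsto> Ups \<otimes> \<eta> from the left. This makes \<rho> unique on forms,
  and with it the description in \<open>Ricci\<close>.\<close>

lemma t21_Ups_inject:
  assumes "\<tau> \<in> carrier (Om1 q)" "\<tau>' \<in> carrier (Om1 q)" "t21 q (ups q 1) \<tau> = t21 q (ups q 1) \<tau>'"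
  shows "\<tau> = \<tau>'"
proof -
  let ?\<psi> = "\<lambda>\<omega> \<eta>. \<omega> EpEm \<odot>\<^bsub>Om1 q\<^esub> \<eta>"
  have ups: "ups q z EpEm = ev q z" for z by (simp add: ups_def form2_of_def)
  have "balanced_map (S2 q) (Om2 q) (Om1 q) (Om1 q) ?\<psi>"
  proof (rule balanced_mapI)
    show "?\<psi> u y \<in> carrier (Om1 q)" if "u \<in> carrier (Om2 q)" "y \<in> carrier (Om1 q)" for u y
      using that by (elim Om2_cases) (auto simp: ups intro!: Om1.smult_closed ev_S2)
    show "?\<psi> (u \<oplus>\<^bsub>Om2 q\<^esub> u') y = ?\<psi> u y \<oplus>\<^bsub>Om1 q\<^esub> ?\<psi> u' y"
      if "u \<in> carrier (Om2 q)" "u' \<in> carrier (Om2 q)" "y \<in> carrier (Om1 q)" for u u' y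
      using that by (elim Om2_cases Om1_cases) (simp add: Om2_calc Om1_calc ups algebra_simps)
    show "?\<psi> u (y \<oplus>\<^bsub>Om1 q\<^esub> y') = ?\<psi> u y \<oplus>\<^bsub>Om1 q\<^esub> ?\<psi> u y'"
      if "u \<in> carrier (Om2 q)" "y \<in> carrier (Om1 q)" "y' \<in> carrier (Om1 q)" for u y y'
      using that by (elim Om2_cases) (simp add: ups Om1.smult_add ev_S2)
    show "?\<psi> (u \<odot>r\<^bsub>Om2 q\<^esub> m) y = ?\<psi> u (m \<odot>\<^bsub>Om1 q\<^esub> y)"
      if "u \<in> carrier (Om2 q)" "m \<in> carrier (S2 q)" "y \<in> carrier (Om1 q)" for u m y
      using that by (elim Om2_cases Om1_cases S2_cases) (simp add: Om2_calc Om1_calc ups mult.assoc)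
  qed
  note lift = T21.tensor_lift_tens[OF Om1.M.abelian_group_axioms this ups_closed[OF homog_one]]
  have "?\<psi> (ups q 1) \<tau> = ?\<psi> (ups q 1) \<tau>'"
    using lift[OF assms(1)] lift[OF assms(2)] assms(3) by metis
  then show ?thesis
    using Om1.one_smult[OF assms(1)] Om1.one_smult[OF assms(2)] by (simp add: ups ev_simps S2_simps)
qed

end

section \<open>The curvature operator, the lift and the Ricci tensor\<close>

context monopole
begin

definition rho :: "form1 \<Rightarrow> form1" where
  "rho \<tau> = form1_of (sc q (- (q ^ 4) * qtwo q) \<otimes>\<^bsub>SL2 q\<^esub> \<tau> Ep) (sc q (qtwo q) \<otimes>\<^bsub>SL2 q\<^esub> \<tau> Em) \<zero>\<^bsub>SL2 q\<^esub>"

lemma scales_rho: "scales (- (q ^ 4) * qtwo q) (qtwo q) rho"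
  by (simp add: scales_def rho_def frm_def form1_of_def ev_simps ev_kc q_nz)

lemma Riemann_rho:
  assumes "\<tau> \<in> carrier (Om1 q)"
  shows "Riemann q nabla \<tau> = t21 q (Ups q) (rho \<tau>)"
proof -
  obtain x y where xy: "homog (-2) x" "homog 2 y" "\<tau> = frm q x y" using assms by (rule Om1_cases)
  have "sc q (- (q ^ 4) * qtwo q) = \<ominus>\<^bsub>SL2 q\<^esub> (sc q (q ^ 4) \<otimes>\<^bsub>SL2 q\<^esub> sc q (qtwo q))"
    by (simp add: sc_uminus flip: sc_mult)
  then have "ev q (- qs 4 (tw x)) = sc q (- (q ^ 4) * qtwo q) \<otimes>\<^bsub>SL2 q\<^esub> ev q x"
    by (simp only: ev_simps ev_tw) (simp add: A.l_minus A.m_assoc sc_closed ev_cl)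
  then have "frm q (- qs 4 (tw x)) (tw y) = rho \<tau>"
    by (simp add: rho_def xy(3) ev_tw, simp add: frm_def form1_of_def ev_tw)
  then show ?thesis
    using Riemann_frm[OF xy(1,2)] by (simp add: xy(3) Ups_eq)
qed

lemma sc_smult_t21:
  assumes "homog (-2) x" "homog 2 y"
  shows "sc q c \<odot>\<^bsub>T21 q\<^esub> t21 q (Ups q) (frm q x y) = t21 q (Ups q) (frm q (kc c * x) (kc c * y))"
proof -
  have "sc q c = ev q (kc c)" by (simp add: ev_kc q_nz)
  then show ?thesis
    using T21.smult_tens[of "ev q (kc c)" "ups q 1" "frm q x y"] assms
    by (simp add: Ups_eq ev_S2 homog_kc ups_closed homog_one frm_closed Om2_calc t21_ups[OF homog_kc])
qed

lemma Riemann_Om01: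
  assumes "\<tau> \<in> Om01 q"
  shows "Riemann q nabla \<tau> = sc q (qtwo q) \<odot>\<^bsub>T21 q\<^esub> t21 q (Ups q) \<tau>"
proof -
  obtain f where f: "f \<in> SL2_deg q 2" "\<tau> = form1_of \<zero>\<^bsub>SL2 q\<^esub> f \<zero>\<^bsub>SL2 q\<^esub>"
    using assms by (auto simp: Om01_def)
  then obtain y where y: "homog 2 y" "f = ev q y" using deg_cases by blast
  then have \<tau>: "\<tau> = frm q 0 y" by (simp add: f frm_def ev_simps)
  then show ?thesis
    using Riemann_rho[of \<tau>] scalesD[OF scales_rho homog_zero y(1)] y
    by (simp add: frm_closed homog_zero sc_smult_t21)
qed

lemma Riemann_Om10:
  assumes "\<tau> \<in> Om10 q"
  shows "Riemann q nabla \<tau> = sc q (- (q ^ 4) * qtwo q) \<odot>\<^bsub>T21 q\<^esub> t21 q (Ups q) \<tau>"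
proof -
  obtain f where f: "f \<in> SL2_deg q (-2)" "\<tau> = form1_of f \<zero>\<^bsub>SL2 q\<^esub> \<zero>\<^bsub>SL2 q\<^esub>"
    using assms by (auto simp: Om10_def)
  then obtain x where x: "homog (-2) x" "f = ev q x" using deg_cases by blast
  then have \<tau>: "\<tau> = frm q x 0" by (simp add: f frm_def ev_simps)
  then show ?thesis
    using Riemann_rho[of \<tau>] scalesD[OF scales_rho x(1) homog_zero] x
    by (simp add: frm_closed homog_zero sc_smult_t21)
qed

lemma lift_exists: "\<exists>i\<in>left_hom (S2 q) (Om2 q) (T11 q). i (Ups q) = lift_value q"
  if "qtwo q \<noteq> 0" "1 + q powi (-4) \<noteq> 0"
proof -
  have L: "lift_value q \<in> carrier (T11 q)"
    using lift_value_pn[OF that] pn_closed by simp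
  have ups: "ups q z EpEm = ev q z" for z by (simp add: ups_def form2_of_def)
  \<comment> \<open>A left-module map may take any value on \<open>Ups q\<close>, since 2-forms on
    the sphere are free on it with the e+ e- coefficient as coordinate.\<close>
  define i where "i \<omega> = \<omega> EpEm \<odot>\<^bsub>T11 q\<^esub> lift_value q" for \<omega> :: form2
  have "i \<in> left_hom (S2 q) (Om2 q) (T11 q)"
    unfolding left_hom_def
  proof (intro CollectI conjI ballI funcsetI)
    show "i u \<in> carrier (T11 q)" if "u \<in> carrier (Om2 q)" for u
      using that by (elim Om2_cases) (auto simp: i_def ups intro!: T11.T_smult_closed ev_S2 L)
    show "i (u \<oplus>\<^bsub>Om2 q\<^esub> v) = i u \<oplus>\<^bsub>T11 q\<^esub> i v" if "u \<in> carrier (Om2 q)" "v \<in> carrier (Om2 q)" for u v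
      using that by (elim Om2_cases) (simp add: i_def Om2_calc ups T11_add_ev L)
    show "i (s \<odot>\<^bsub>Om2 q\<^esub> u) = s \<odot>\<^bsub>T11 q\<^esub> i u" if "s \<in> carrier (S2 q)" "u \<in> carrier (Om2 q)" for s u
    proof -
      from that(2) obtain z where z: "homog 0 z" "u = ups q z" by (rule Om2_cases)
      from that(1) obtain m where m: "homog 0 m" "s = ev q m" by (rule S2_cases)
      show ?thesis
        using T11.T_mult_smult[OF ev_S2[OF m(1)] ev_S2[OF z(1)] L]
        by (simp add: i_def z m Om2_calc ups S2_simps ev_simps)
    qed
  qed
  moreover have "i (Ups q) = lift_value q"
    using T11.T_one_smult[OF L] by (simp add: i_def Ups_eq ups ev_simps S2_simps)
  ultimately show ?thesis by blast
qed

text \<open>The wedge product subtracts the weights of the two metric halves; in their difference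
  the factor 1 + q^(-4) cancels and 2 q^(-1) / [2] remains, which the factor q^2 of
  \<open>wedge_map_pn\<close> turns into 2 q / [2].\<close>

lemma wedge_map_lift:
  assumes nz: "qtwo q \<noteq> 0" "1 + q powi (-4) \<noteq> 0"
    and i: "i \<in> left_hom (S2 q) (Om2 q) (T11 q)" "i (Ups q) = lift_value q" and "\<omega> \<in> carrier (Om2 q)"
  shows "wedge_map q (i \<omega>) = sc q (2 * q / qtwo q) \<odot>\<^bsub>Om2 q\<^esub> \<omega>"
proof -
  obtain z where z: "homog 0 z" "\<omega> = ups q z" using \<open>\<omega> \<in> carrier (Om2 q)\<close> by (rule Om2_cases)
  have u: "ups q 1 \<in> carrier (Om2 q)" by (rule ups_closed[OF homog_one])
  have \<omega>: "\<omega> = ev q z \<odot>\<^bsub>Om2 q\<^esub> ups q 1" by (simp add: z Om2_calc)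
  have "i \<omega> = ev q z \<odot>\<^bsub>T11 q\<^esub> lift_value q"
    using i ev_S2[OF z(1)] u unfolding \<omega> Ups_eq by (simp add: left_hom_def)
  moreover have "lift_value q \<in> carrier (T11 q)"
    using lift_value_pn[OF nz] pn_closed by simp
  ultimately have "wedge_map q (i \<omega>) = ev q z \<odot>\<^bsub>Om2 q\<^esub> wedge_map q (lift_value q)"
    using ev_S2[OF z(1)] by (simp add: wedge_map_smult)
  also have "wedge_map q (lift_value q) = sc q (2 * q / qtwo q) \<odot>\<^bsub>Om2 q\<^esub> ups q 1"
  proof -
    define r where "r = q powi (-4)"
    have "2 * inverse q / (qtwo q * (1 + r)) - - (2 * r * inverse q / (qtwo q * (1 + r)))
        = (1 + r) * (2 * inverse q) / (qtwo q * (1 + r))"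
      by (simp add: add_divide_distrib[symmetric] algebra_simps)
    also have "\<dots> = 2 * inverse q / qtwo q"
      using nz(2) by (simp add: r_def)
    finally have "q ^ 2 * (2 * inverse q / (qtwo q * (1 + r)) - - (2 * r * inverse q / (qtwo q * (1 + r)))) = 2 * q / qtwo q"
      using q_nz by (simp add: power2_eq_square)
    then show ?thesis
      unfolding lift_value_pn[OF nz] wedge_map_pn r_def by (simp only:)
  qed
  also have "ev q z \<odot>\<^bsub>Om2 q\<^esub> (sc q (2 * q / qtwo q) \<odot>\<^bsub>Om2 q\<^esub> ups q 1) = sc q (2 * q / qtwo q) \<odot>\<^bsub>Om2 q\<^esub> \<omega>"
  proof -
    have "sc q c = ev q (kc c)" for c by (simp add: ev_kc q_nz)
    then show ?thesis by (simp add: \<omega> Om2_calc kc_commute)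
  qed
  finally show ?thesis .
qed

text \<open>The weights of the lift on g_{-+} and g_{+-} have ratio -q^(-4), the inverse of the
  ratio -q^4 of the curvature constants on their second factors. Both halves thus acquire the same
  number, which is the Einstein property.\<close>

lemma Ricci_eq:
  assumes nz: "qtwo q \<noteq> 0" "1 + q powi (-4) \<noteq> 0" and i: "i (Ups q) = lift_value q"
  shows "Ricci q nabla i = sc q (2 * inverse q / (1 + q powi (-4))) \<odot>\<^bsub>T11 q\<^esub> metric q"
proof -
  let ?R = "sc q (2 * inverse q / (1 + q powi (-4))) \<odot>\<^bsub>T11 q\<^esub> metric q"
  have eq: "map11 q (\<lambda>x. x) \<rho> (i (Ups q)) = ?R" if "scales (- (q ^ 4) * qtwo q) (qtwo q) \<rho>" for \<rho>
  proof -
    define r where "r = q powi (-4)"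
    have r: "q ^ 4 * r = 1" using q_nz by (simp add: r_def power_int_minus)
    have "- (q ^ 4) * qtwo q * - (2 * r * inverse q / (qtwo q * (1 + r))) = (q ^ 4 * r) * (2 * inverse q) / (1 + r)"
      using nz(1) by simp
    then have "- (q ^ 4) * qtwo q * - (2 * r * inverse q / (qtwo q * (1 + r))) = 2 * inverse q / (1 + r)"
      by (simp only: r mult_1_left)
    moreover have "qtwo q * (2 * inverse q / (qtwo q * (1 + r))) = 2 * inverse q / (1 + r)"
      using nz(1) by simp
    ultimately show ?thesis
      unfolding i lift_value_pn[OF nz] map11_pn[OF that] metric_pn pn_smult r_def by (simp only: mult_1_right)
  qed
  show ?thesis
    unfolding Ricci_def
  proof (rule the_equality)
    show "\<exists>\<rho>\<in>bimodule_hom (S2 q) (Om1 q) (Om1 q).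
        (\<forall>\<tau>\<in>carrier (Om1 q). Riemann q nabla \<tau> = t21 q (Ups q) (\<rho> \<tau>)) \<and> ?R = map11 q (\<lambda>x. x) \<rho> (i (Ups q))"
      using scales_hom[OF scales_rho] Riemann_rho eq[OF scales_rho] by metis
    fix R
    assume "\<exists>\<rho>\<in>bimodule_hom (S2 q) (Om1 q) (Om1 q).
        (\<forall>\<tau>\<in>carrier (Om1 q). Riemann q nabla \<tau> = t21 q (Ups q) (\<rho> \<tau>)) \<and> R = map11 q (\<lambda>x. x) \<rho> (i (Ups q))"
    then obtain \<rho> where \<rho>: "\<rho> \<in> bimodule_hom (S2 q) (Om1 q) (Om1 q)"
      "\<And>\<tau>. \<tau> \<in> carrier (Om1 q) \<Longrightarrow> Riemann q nabla \<tau> = t21 q (Ups q) (\<rho> \<tau>)"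
      "R = map11 q (\<lambda>x. x) \<rho> (i (Ups q))" by blast
    \<comment> \<open>A competing \<rho> may differ from \<open>rho\<close> off the carrier, but
      agreement on forms already gives the same scaling, and \<open>map11\<close> on the lift
      depends on nothing else.\<close>
    have "\<rho> \<tau> = rho \<tau>" if "\<tau> \<in> carrier (Om1 q)" for \<tau>
      using that \<rho>(2)[OF that] Riemann_rho[OF that] bimodule_homD(1)[OF \<rho>(1) that]
        bimodule_homD(1)[OF scales_hom[OF scales_rho] that]
      by (intro t21_Ups_inject) (simp_all add: Ups_eq)
    then have "scales (- (q ^ 4) * qtwo q) (qtwo q) \<rho>"
      using scales_rho by (simp add: scales_def frm_closed)
    then show "R = ?R" using eq \<rho>(3) by simp
  qed
qed

end

theorem proposition5p3:
  fixes q :: complex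
    and nabla :: "form1 \<Rightarrow> ((form1 \<times> form1) \<Rightarrow>\<^sub>0 int) set"
  assumes "q \<noteq> 0"
    and "monopole_levi_civita q nabla"
  shows "(\<forall>\<tau>\<in>Om01 q. Riemann q nabla \<tau> = sc q (qtwo q) \<odot>\<^bsub>T21 q\<^esub> t21 q (Ups q) \<tau>) \<and>
    (\<forall>\<tau>\<in>Om10 q. Riemann q nabla \<tau> = sc q (- (q ^ 4) * qtwo q) \<odot>\<^bsub>T21 q\<^esub> t21 q (Ups q) \<tau>) \<and>
    (qtwo q \<noteq> 0 \<and> 1 + q powi (-4) \<noteq> 0 \<longrightarrow>
      (\<exists>i\<in>left_hom (S2 q) (Om2 q) (T11 q). i (Ups q) = lift_value q) \<and>
      (\<forall>i\<in>left_hom (S2 q) (Om2 q) (T11 q). i (Ups q) = lift_value q \<longrightarrow>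
        (\<forall>\<omega>\<in>carrier (Om2 q). wedge_map q (i \<omega>) = sc q (2 * q / qtwo q) \<odot>\<^bsub>Om2 q\<^esub> \<omega>) \<and>
        Ricci q nabla i = sc q (2 * inverse q / (1 + q powi (-4))) \<odot>\<^bsub>T11 q\<^esub> metric q))"
proof -
  interpret monopole q nabla
    using assms by unfold_locales
  show ?thesis
    using Riemann_Om01 Riemann_Om10 lift_exists wedge_map_lift Ricci_eq by blast
qed

end
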